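(* Let $\mathfrak m=\mathfrak m(V,W,\beta)$ be a complex extended translation algebra with $\dim V=1$. Then $N$ is even and the maximal transitive prolongation of $\mathfrak m$ is $\mathfrak g=\mathfrak c_{N/2}(\mathbb C)$.
   Context: Let $V\neq0$ be a finite-dimensional complex vector space with a nondegenerate symmetric bilinear form $(\cdot,\cdot)$. The Clifford algebra $C\!\ell(V)$ has product satisfying $vu+uv=-2(v,u)\mathbf 1$ for $v,u\in V$. Let $W\ne0$ be a finite-dimensional complex $C\!\ell(V)$-module, with action written $c\cdot s$. $N\ge1$ denotes the number of irreducible $C\!\ell(V)$-components of $W$, counted with multiplicity. The Lie algebra $\mathfrak{so}(V)$ acts on $V$ in the defining way and on $W$ by the spin representation, i.e. the endomorphism $w\mapsto (v,w)u-(u,w)v$ acts on $W$ as $\frac14(vu-uv)\in C\!\ell(V)$ (for $\dim V=1$, $\mathfrak{so}(V)=0$). Let $\beta$ be a nondegenerate bilinear form on $W$ such that: (B1) $\beta$ is $\mathfrak{so}(V)$-invariant; (B2) $\beta$ is symmetric (put $\epsilon=-1$) or skew-symmetric (put $\epsilon=1$); (B3) $\beta(v\cdot s,t)=\epsilon\beta(s,v\cdot t)$ for all $v\in V$, $s,t\in W$. The (complex) extended translation algebra $\mathfrak m=\mathfrak m(V,W,\beta)$ is the graded Lie algebra $\mathfrak m=\mathfrak m_{-2}+\mathfrak m_{-1}$, $\mathfrak m_{-2}=V$, $\mathfrak m_{-1}=W$, whose only nonzero bracket $W\times W\to V$ is given by $([s,t],v)=\beta(v\cdot s,t)$. The maximal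 transitive prolongation of $\mathfrak m$ is the (unique) complex graded Lie algebra $\mathfrak g=\sum_{p\in\mathbb Z}\mathfrak g_p$ such that (1) each $\mathfrak g_p$ is finite-dimensional; (2) the negatively graded part of $\mathfrak g$ is $\mathfrak m$ ($\mathfrak g_p=\mathfrak m_p$ for $p=-1,-2$ and $\mathfrak g_p=0$ for $p<-2$); (3) for all $p\ge0$, $X\in\mathfrak g_p$ with $[X,\mathfrak g_{-1}]=0$ implies $X=0$; (4) $\mathfrak g$ is maximal: any complex graded Lie algebra $\mathfrak g'$ satisfying (1)-(3) admits an injective graded Lie algebra homomorphism $\mathfrak g'\to\mathfrak g$. $\mathfrak c_\ell(\mathbb C)$ denotes the infinite-dimensional complex contact algebra in dimension $2\ell+1$: the graded Lie algebra of polynomial vector fields on $\mathbb C^{2\ell+1}$ (coordinates $x_i,y_i,z$, $1\le i\le\ell$) preserving the contact distribution $\ker(dz-\sum_i y_i\,dx_i)$, graded by giving $x_i,y_i$ weight $1$, $z$ weight $2$, $\partial_{x_i},\partial_{y_i}$ weight $-1$ and $\partial_z$ weight $-2$. Equality means isomorphism of graded Lie algebras. *)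

theory Defs
  imports
    Complex_Main
    "HOL-Library.Poly_Mapping"
    "HOL-Library.Function_Algebras"
    "HOL-Library.Product_Plus"
    "HOL-Algebra.QuotRing"
begin

section \<open>Linear algebra over the complex numbers\<close>

definition fin_dim :: "(complex \<Rightarrow> 'a::ab_group_add \<Rightarrow> 'a) \<Rightarrow> 'a set \<Rightarrow> bool"
  where "fin_dim scl U \<longleftrightarrow> (\<exists>B. finite B \<and> U \<subseteq> module.span scl B)"

definition bilinear_form ::
    "(complex \<Rightarrow> 'a::ab_group_add \<Rightarrow> 'a) \<Rightarrow> ('a \<Rightarrow> 'a \<Rightarrow> complex) \<Rightarrow> bool"
  where "bilinear_form scl b \<longleftrightarrow>
    (\<forall>x. Vector_Spaces.linear scl (*) (b x)) \<and> (\<forall>y. Vector_Spaces.linear scl (*) (\<lambda>x. b x y))"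

definition nondegenerate :: "('a::zero \<Rightarrow> 'a \<Rightarrow> complex) \<Rightarrow> bool"
  where "nondegenerate b \<longleftrightarrow>
    (\<forall>x. (\<forall>y. b x y = 0) \<longrightarrow> x = 0) \<and> (\<forall>y. (\<forall>x. b x y = 0) \<longrightarrow> y = 0)"


section \<open>Clifford algebra and Clifford modules\<close>

text \<open>
  The complex monoid algebra of the free monoid of words over the set \<open>V\<close> is the free unital
  complex algebra on the \<^emph>\<open>set\<close> \<open>V\<close>. Dividing it by the ideal generated by the linearity
  relations gives the tensor algebra of the vector space \<open>V\<close>; adding the relations
  \<open>v u + u v = - 2 (v, u) 1\<close> gives the Clifford algebra.
\<close>

datatype 'v word = Word "'v list"

instantiation word :: (type) monoid_add
begin

definition zero_word_def: "0 = Word []"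

fun plus_word :: "'a word \<Rightarrow> 'a word \<Rightarrow> 'a word" where
  "plus_word (Word xs) (Word ys) = Word (xs @ ys)"

instance
proof
  fix a b c :: "'a word"
  show "a + b + c = a + (b + c)" by (cases a; cases b; cases c) simp
  show "0 + a = a" "a + 0 = a" by (cases a; simp add: zero_word_def)+
qed

end

type_synonym 'v free_algebra = "'v word \<Rightarrow>\<^sub>0 complex"

abbreviation const :: "complex \<Rightarrow> ('m::monoid_add \<Rightarrow>\<^sub>0 complex)"
  where "const c \<equiv> Poly_Mapping.single 0 c"

abbreviation gen :: "'v \<Rightarrow> 'v free_algebra"
  where "gen v \<equiv> Poly_Mapping.single (Word [v]) 1"

definition free_ring :: "'v free_algebra ring"
  where "free_ring = \<lparr>carrier = UNIV, mult = (*), one = 1, zero = 0, add = (+)\<rparr>"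

definition clifford_ideal ::
    "(complex \<Rightarrow> 'v::ab_group_add \<Rightarrow> 'v) \<Rightarrow> ('v \<Rightarrow> 'v \<Rightarrow> complex) \<Rightarrow> 'v free_algebra set"
  where "clifford_ideal scV form = genideal free_ring
    ({gen (v + u) - gen v - gen u | v u. True} \<union>
     {gen (scV c v) - const c * gen v | c v. True} \<union>
     {gen v * gen u + gen u * gen v + const (2 * form v u) | v u. True})"

type_synonym 'v clifford = "'v free_algebra set"

definition clifford_algebra ::
    "(complex \<Rightarrow> 'v::ab_group_add \<Rightarrow> 'v) \<Rightarrow> ('v \<Rightarrow> 'v \<Rightarrow> complex) \<Rightarrow> 'v clifford ring"
  where "clifford_algebra scV form = free_ring Quot (clifford_ideal scV form)"

definition clifford_class ::
    "(complex \<Rightarrow> 'v::ab_group_add \<Rightarrow> 'v) \<Rightarrow> ('v \<Rightarrow> 'v \<Rightarrow> complex) \<Rightarrow> 'v free_algebra \<Rightarrow> 'v clifford"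
  where "clifford_class scV form x = clifford_ideal scV form +>\<^bsub>free_ring\<^esub> x"

locale quadratic_space = vector_space scV
  for scV :: "complex \<Rightarrow> 'v::ab_group_add \<Rightarrow> 'v" +
  fixes form :: "'v \<Rightarrow> 'v \<Rightarrow> complex"
  assumes fin_dim_V: "fin_dim scV UNIV"
    and form_bilinear: "bilinear_form scV form"
    and form_sym: "form v u = form u v"
    and form_nondegenerate: "nondegenerate form"

locale clifford_module =
  V: quadratic_space scV form + W: vector_space scW
  for scV :: "complex \<Rightarrow> 'v::ab_group_add \<Rightarrow> 'v" and form :: "'v \<Rightarrow> 'v \<Rightarrow> complex"
    and scW :: "complex \<Rightarrow> 'w::ab_group_add \<Rightarrow> 'w" +
  fixes act :: "'v clifford \<Rightarrow> 'w \<Rightarrow> 'w"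
  assumes act_add_right: "a \<in> carrier (clifford_algebra scV form) \<Longrightarrow> act a (s + t) = act a s + act a t"
    and act_add_left: "a \<in> carrier (clifford_algebra scV form) \<Longrightarrow> b \<in> carrier (clifford_algebra scV form)
        \<Longrightarrow> act (a \<oplus>\<^bsub>clifford_algebra scV form\<^esub> b) s = act a s + act b s"
    and act_mult: "a \<in> carrier (clifford_algebra scV form) \<Longrightarrow> b \<in> carrier (clifford_algebra scV form)
        \<Longrightarrow> act (a \<otimes>\<^bsub>clifford_algebra scV form\<^esub> b) s = act a (act b s)"
    and act_one: "act \<one>\<^bsub>clifford_algebra scV form\<^esub> s = s"
    and act_const: "act (clifford_class scV form (const c)) s = scW c s"

abbreviation vact ::
    "(complex \<Rightarrow> 'v::ab_group_add \<Rightarrow> 'v) \<Rightarrow> ('v \<Rightarrow> 'v \<Rightarrow> complex) \<Rightarrow> ('v clifford \<Rightarrow> 'w \<Rightarrow> 'w)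
      \<Rightarrow> 'v \<Rightarrow> 'w \<Rightarrow> 'w"
  where "vact scV form act v s \<equiv> act (clifford_class scV form (gen v)) s"

definition clifford_submodule ::
    "(complex \<Rightarrow> 'v::ab_group_add \<Rightarrow> 'v) \<Rightarrow> ('v \<Rightarrow> 'v \<Rightarrow> complex)
      \<Rightarrow> (complex \<Rightarrow> 'w::ab_group_add \<Rightarrow> 'w) \<Rightarrow> ('v clifford \<Rightarrow> 'w \<Rightarrow> 'w) \<Rightarrow> 'w set \<Rightarrow> bool"
  where "clifford_submodule scV form scW act U \<longleftrightarrow>
    module.subspace scW U \<and> (\<forall>a\<in>carrier (clifford_algebra scV form). \<forall>s\<in>U. act a s \<in> U)"

definition irreducible_submodule ::
    "(complex \<Rightarrow> 'v::ab_group_add \<Rightarrow> 'v) \<Rightarrow> ('v \<Rightarrow> 'v \<Rightarrow> complex)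
      \<Rightarrow> (complex \<Rightarrow> 'w::ab_group_add \<Rightarrow> 'w) \<Rightarrow> ('v clifford \<Rightarrow> 'w \<Rightarrow> 'w) \<Rightarrow> 'w set \<Rightarrow> bool"
  where "irreducible_submodule scV form scW act U \<longleftrightarrow>
    clifford_submodule scV form scW act U \<and> U \<noteq> {0} \<and>
    (\<forall>U'. clifford_submodule scV form scW act U' \<and> U' \<subseteq> U \<longrightarrow> U' = {0} \<or> U' = U)"

text \<open>The number \<open>n\<close> of summands in a decomposition of \<open>W\<close> as a direct sum of irreducible submodules.\<close>

definition number_of_components ::
    "(complex \<Rightarrow> 'v::ab_group_add \<Rightarrow> 'v) \<Rightarrow> ('v \<Rightarrow> 'v \<Rightarrow> complex)
      \<Rightarrow> (complex \<Rightarrow> 'w::ab_group_add \<Rightarrow> 'w) \<Rightarrow> ('v clifford \<Rightarrow> 'w \<Rightarrow> 'w) \<Rightarrow> nat"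
  where "number_of_components scV form scW act = (THE n. \<exists>U :: nat \<Rightarrow> 'w set.
    (\<forall>i<n. irreducible_submodule scV form scW act (U i)) \<and>
    (\<forall>s. \<exists>!f. (\<forall>i<n. f i \<in> U i) \<and> (\<forall>i\<ge>n. f i = 0) \<and> s = (\<Sum>i<n. f i)))"


section \<open>The spin representation\<close>

definition so_algebra ::
    "(complex \<Rightarrow> 'v::ab_group_add \<Rightarrow> 'v) \<Rightarrow> ('v \<Rightarrow> 'v \<Rightarrow> complex) \<Rightarrow> ('v \<Rightarrow> 'v) set"
  where "so_algebra scV form =
    {A. Vector_Spaces.linear scV scV A \<and> (\<forall>v u. form (A v) u + form v (A u) = 0)}"

text \<open>
  The endomorphisms \<open>w \<mapsto> (v, w) u - (u, w) v\<close> span \<open>so(V)\<close>, so the conditions below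
  determine \<open>\<sigma>\<close> on \<open>so(V)\<close>.
\<close>

definition spin_representation ::
    "(complex \<Rightarrow> 'v::ab_group_add \<Rightarrow> 'v) \<Rightarrow> ('v \<Rightarrow> 'v \<Rightarrow> complex)
      \<Rightarrow> (complex \<Rightarrow> 'w::ab_group_add \<Rightarrow> 'w) \<Rightarrow> ('v clifford \<Rightarrow> 'w \<Rightarrow> 'w)
      \<Rightarrow> (('v \<Rightarrow> 'v) \<Rightarrow> 'w \<Rightarrow> 'w) \<Rightarrow> bool"
  where "spin_representation scV form scW act \<sigma> \<longleftrightarrow>
    (\<forall>A\<in>so_algebra scV form. \<forall>B\<in>so_algebra scV form. \<forall>s.
        \<sigma> (\<lambda>w. A w + B w) s = \<sigma> A s + \<sigma> B s) \<and>
    (\<forall>A\<in>so_algebra scV form. \<forall>c s. \<sigma> (\<lambda>w. scV c (A w)) s = scW c (\<sigma> A s)) \<and>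
    (\<forall>v u s. \<sigma> (\<lambda>w. scV (form v w) u - scV (form u w) v) s =
        act (clifford_class scV form (const (1/4) * (gen v * gen u - gen u * gen v))) s)"

definition so_invariant ::
    "(complex \<Rightarrow> 'v::ab_group_add \<Rightarrow> 'v) \<Rightarrow> ('v \<Rightarrow> 'v \<Rightarrow> complex)
      \<Rightarrow> (complex \<Rightarrow> 'w::ab_group_add \<Rightarrow> 'w) \<Rightarrow> ('v clifford \<Rightarrow> 'w \<Rightarrow> 'w)
      \<Rightarrow> ('w \<Rightarrow> 'w \<Rightarrow> complex) \<Rightarrow> bool"
  where "so_invariant scV form scW act \<beta> \<longleftrightarrow>
    (\<exists>\<sigma>. spin_representation scV form scW act \<sigma> \<and>
      (\<forall>A\<in>so_algebra scV form. \<forall>s t. \<beta> (\<sigma> A s) t + \<beta> s (\<sigma> A t) = 0))"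


section \<open>Graded Lie algebras\<close>

text \<open>
  A graded Lie algebra lives on a subspace \<open>carrier L\<close> of an ambient complex vector space, which is
  the direct sum of its homogeneous parts; nothing is assumed of the bracket off the carrier.
\<close>

record 'a graded_lie = "'a partial_object" +
  scl :: "complex \<Rightarrow> 'a \<Rightarrow> 'a"
  brk :: "'a \<Rightarrow> 'a \<Rightarrow> 'a"
  part :: "int \<Rightarrow> 'a set"

locale graded_lie_algebra = vector_space "scl L"
  for L :: "'a::ab_group_add graded_lie" +
  assumes part_subspace: "subspace (part L p)"
    and carrier_sum: "carrier L = span (\<Union>p. part L p)"
    and parts_independent:
      "finite I \<Longrightarrow> (\<And>p. p \<in> I \<Longrightarrow> x p \<in> part L p) \<Longrightarrow> (\<Sum>p\<in>I. x p) = 0 \<Longrightarrow> q \<in> I \<Longrightarrow> x q = 0"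
    and brk_add_left: "a \<in> carrier L \<Longrightarrow> b \<in> carrier L \<Longrightarrow> c \<in> carrier L
      \<Longrightarrow> brk L (a + b) c = brk L a c + brk L b c"
    and brk_add_right: "a \<in> carrier L \<Longrightarrow> b \<in> carrier L \<Longrightarrow> c \<in> carrier L
      \<Longrightarrow> brk L a (b + c) = brk L a b + brk L a c"
    and brk_scl_left: "a \<in> carrier L \<Longrightarrow> b \<in> carrier L \<Longrightarrow> brk L (scl L k a) b = scl L k (brk L a b)"
    and brk_scl_right: "a \<in> carrier L \<Longrightarrow> b \<in> carrier L \<Longrightarrow> brk L a (scl L k b) = scl L k (brk L a b)"
    and brk_alternating: "a \<in> carrier L \<Longrightarrow> brk L a a = 0"
    and jacobi: "a \<in> carrier L \<Longrightarrow> b \<in> carrier L \<Longrightarrow> c \<in> carrier L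
      \<Longrightarrow> brk L a (brk L b c) + brk L b (brk L c a) + brk L c (brk L a b) = 0"
    and brk_graded: "a \<in> part L p \<Longrightarrow> b \<in> part L q \<Longrightarrow> brk L a b \<in> part L (p + q)"

definition graded_lie_hom ::
    "'a::ab_group_add graded_lie \<Rightarrow> 'b::ab_group_add graded_lie \<Rightarrow> ('a \<Rightarrow> 'b) \<Rightarrow> bool"
  where "graded_lie_hom L M f \<longleftrightarrow>
    (\<forall>a\<in>carrier L. \<forall>b\<in>carrier L. f (a + b) = f a + f b) \<and>
    (\<forall>a\<in>carrier L. \<forall>k. f (scl L k a) = scl M k (f a)) \<and>
    (\<forall>a\<in>carrier L. \<forall>b\<in>carrier L. f (brk L a b) = brk M (f a) (f b)) \<and>
    (\<forall>p. f ` part L p \<subseteq> part M p)"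

definition graded_lie_isomorphic ::
    "'a::ab_group_add graded_lie \<Rightarrow> 'b::ab_group_add graded_lie \<Rightarrow> bool"
  where "graded_lie_isomorphic L M \<longleftrightarrow>
    (\<exists>f. graded_lie_hom L M f \<and> bij_betw f (carrier L) (carrier M))"

definition negative_part :: "'a::ab_group_add graded_lie \<Rightarrow> 'a graded_lie"
  where "negative_part L =
    L\<lparr>carrier := module.span (scl L) (\<Union>p\<in>{..<0}. part L p),
      part := (\<lambda>p. if p < 0 then part L p else {0})\<rparr>"

definition transitive_prolongation ::
    "'m::ab_group_add graded_lie \<Rightarrow> 'g::ab_group_add graded_lie \<Rightarrow> bool"
  where "transitive_prolongation \<mm> \<gg> \<longleftrightarrow>
    graded_lie_algebra \<gg> \<and>
    (\<forall>p. fin_dim (scl \<gg>) (part \<gg> p)) \<and>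
    graded_lie_isomorphic \<mm> (negative_part \<gg>) \<and>
    (\<forall>p\<ge>0. \<forall>x\<in>part \<gg> p. (\<forall>y\<in>part \<gg> (-1). brk \<gg> x y = 0) \<longrightarrow> x = 0)"

text \<open>
  Maximality among the transitive prolongations whose ambient vector space is the type \<open>'h\<close>;
  for full maximality \<open>'h\<close> has to be kept arbitrary.
\<close>

definition maximal_transitive_prolongation ::
    "'h::ab_group_add itself \<Rightarrow> 'm::ab_group_add graded_lie \<Rightarrow> 'g::ab_group_add graded_lie \<Rightarrow> bool"
  where "maximal_transitive_prolongation T \<mm> \<gg> \<longleftrightarrow>
    transitive_prolongation \<mm> \<gg> \<and>
    (\<forall>\<gg>' :: 'h graded_lie. transitive_prolongation \<mm> \<gg>' \<longrightarrow>
      (\<exists>f. graded_lie_hom \<gg>' \<gg> f \<and> inj_on f (carrier \<gg>')))"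


section \<open>Extended translation algebras\<close>

locale extended_translation_data =
  clifford_module scV form scW act
  for scV :: "complex \<Rightarrow> 'v::ab_group_add \<Rightarrow> 'v" and form :: "'v \<Rightarrow> 'v \<Rightarrow> complex"
    and scW :: "complex \<Rightarrow> 'w::ab_group_add \<Rightarrow> 'w" and act :: "'v clifford \<Rightarrow> 'w \<Rightarrow> 'w" +
  fixes \<beta> :: "'w \<Rightarrow> 'w \<Rightarrow> complex" and \<epsilon> :: complex
  assumes V_nonzero: "(UNIV :: 'v set) \<noteq> {0}"
    and W_nonzero: "(UNIV :: 'w set) \<noteq> {0}"
    and fin_dim_W: "fin_dim scW UNIV"
    and \<beta>_bilinear: "bilinear_form scW \<beta>"
    and \<beta>_nondegenerate: "nondegenerate \<beta>"
    and B1: "so_invariant scV form scW act \<beta>"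
    and B2: "(\<epsilon> = -1 \<and> (\<forall>s t. \<beta> s t = \<beta> t s)) \<or> (\<epsilon> = 1 \<and> (\<forall>s t. \<beta> s t = - \<beta> t s))"
    and B3: "\<beta> (vact scV form act v s) t = \<epsilon> * \<beta> s (vact scV form act v t)"

definition WW_bracket ::
    "(complex \<Rightarrow> 'v::ab_group_add \<Rightarrow> 'v) \<Rightarrow> ('v \<Rightarrow> 'v \<Rightarrow> complex) \<Rightarrow> ('v clifford \<Rightarrow> 'w \<Rightarrow> 'w)
      \<Rightarrow> ('w \<Rightarrow> 'w \<Rightarrow> complex) \<Rightarrow> 'w \<Rightarrow> 'w \<Rightarrow> 'v"
  where "WW_bracket scV form act \<beta> s t = (THE x. \<forall>v. form x v = \<beta> (vact scV form act v s) t)"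

definition extended_translation_algebra ::
    "(complex \<Rightarrow> 'v::ab_group_add \<Rightarrow> 'v) \<Rightarrow> ('v \<Rightarrow> 'v \<Rightarrow> complex)
      \<Rightarrow> (complex \<Rightarrow> 'w::ab_group_add \<Rightarrow> 'w) \<Rightarrow> ('v clifford \<Rightarrow> 'w \<Rightarrow> 'w)
      \<Rightarrow> ('w \<Rightarrow> 'w \<Rightarrow> complex) \<Rightarrow> ('v \<times> 'w) graded_lie"
  where "extended_translation_algebra scV form scW act \<beta> =
    \<lparr>carrier = UNIV,
     scl = (\<lambda>c (v, s). (scV c v, scW c s)),
     brk = (\<lambda>(v, s) (u, t). (WW_bracket scV form act \<beta> s t, 0)),
     part = (\<lambda>p. if p = -2 then UNIV \<times> {0} else if p = -1 then {0} \<times> UNIV else {0})\<rparr>"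


section \<open>The contact algebra\<close>

datatype coord = X nat | Y nat | Z

definition coords :: "nat \<Rightarrow> coord set"
  where "coords l = X ` {1..l} \<union> Y ` {1..l} \<union> {Z}"

fun weight :: "coord \<Rightarrow> nat" where
  "weight (X i) = 1"
| "weight (Y i) = 1"
| "weight Z = 2"

text \<open>Polynomials are finitely supported functions on monomials, monomials are exponent vectors.\<close>

type_synonym monomial = "coord \<Rightarrow>\<^sub>0 nat"
type_synonym polynomial = "monomial \<Rightarrow>\<^sub>0 complex"
type_synonym vector_field = "coord \<Rightarrow> polynomial" \<comment> \<open>\<open>F c\<close> is the coefficient of \<open>\<partial>/\<partial>c\<close>\<close>

definition var :: "coord \<Rightarrow> polynomial"
  where "var c = Poly_Mapping.single (Poly_Mapping.single c 1) 1"

definition partial_deriv :: "coord \<Rightarrow> polynomial \<Rightarrow> polynomial"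
  where "partial_deriv c f =
    (\<Sum>m\<in>Poly_Mapping.keys f. Poly_Mapping.single (m - Poly_Mapping.single c 1)
        (of_nat (Poly_Mapping.lookup m c) * Poly_Mapping.lookup f m))"

definition monomial_weight :: "monomial \<Rightarrow> nat"
  where "monomial_weight m = (\<Sum>c\<in>Poly_Mapping.keys m. Poly_Mapping.lookup m c * weight c)"

definition vector_fields :: "nat \<Rightarrow> vector_field set"
  where "vector_fields l =
    {F. (\<forall>c\<in>coords l. \<forall>m\<in>Poly_Mapping.keys (F c). Poly_Mapping.keys m \<subseteq> coords l) \<and>
        (\<forall>c. c \<notin> coords l \<longrightarrow> F c = 0)}"

definition field_bracket :: "nat \<Rightarrow> vector_field \<Rightarrow> vector_field \<Rightarrow> vector_field"
  where "field_bracket l F G =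
    (\<lambda>c. \<Sum>d\<in>coords l. F d * partial_deriv d (G c) - G d * partial_deriv d (F c))"

definition contact_form :: "nat \<Rightarrow> vector_field \<Rightarrow> polynomial"
  where "contact_form l F = F Z - (\<Sum>i=1..l. var (Y i) * F (X i))"

definition contact_distribution :: "nat \<Rightarrow> vector_field set"
  where "contact_distribution l = {F \<in> vector_fields l. contact_form l F = 0}"

text \<open>A field preserves the distribution if bracketing with it maps sections to sections.\<close>

definition contact_fields :: "nat \<Rightarrow> vector_field set"
  where "contact_fields l =
    {F \<in> vector_fields l. \<forall>G\<in>contact_distribution l. field_bracket l F G \<in> contact_distribution l}"

text \<open>In the grading, \<open>\<partial>/\<partial>c\<close> has weight \<open>- weight c\<close>.\<close>

definition contact_algebra :: "nat \<Rightarrow> vector_field graded_lie"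
  where "contact_algebra l =
    \<lparr>carrier = contact_fields l,
     scl = (\<lambda>k F c. const k * F c),
     brk = field_bracket l,
     part = (\<lambda>p. {F \<in> contact_fields l. \<forall>c. \<forall>m\<in>Poly_Mapping.keys (F c).
                    int (monomial_weight m) - int (weight c) = p})\<rparr>"

end

theory Submission
  imports Defs
begin

text \<open>
  Let \<open>e\<close> be a unit vector of the line \<open>V\<close>. Clifford multiplication by \<open>e\<close> is an operator \<open>J\<close> on \<open>W\<close> with
  \<open>J\<^sup>2 = -1\<close>, the irreducible submodules are the lines spanned by eigenvectors of \<open>J\<close>, and so \<open>N = dim W\<close>.
  The bracket of \<open>\<mm>\<close> is \<open>[s, t] = \<omega>(s, t) e\<close> with \<open>\<omega>(s, t) = \<beta>(J s, t)\<close>. In both cases of (B2) the sign in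
  (B3) makes \<open>\<omega>\<close> skew-symmetric, and it is nondegenerate because \<open>J\<close> is invertible. Hence \<open>N = 2 l\<close> is even,
  and a symplectic basis \<open>a\<^sub>i, b\<^sub>i\<close> of \<open>W\<close> identifies \<open>\<mm>\<close> with the Heisenberg algebra: \<open>[a\<^sub>i, b\<^sub>i] = e\<close> and
  all other brackets of basis vectors vanish (\<open>heisenberg_algebra_\<mm>\<close>).

  A contact field \<open>F\<close> is determined by its generating function \<open>f = \<alpha>(F)\<close>, where \<open>\<alpha> = dz - \<Sum> y\<^sub>i dx\<^sub>i\<close>
  (\<open>contact_fields_iff\<close>), and every polynomial occurs (\<open>contact_field_in_contact_fields\<close>). The generating functions \<open>-y\<^sub>i\<close>, \<open>x\<^sub>i\<close> and \<open>1\<close> give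
  the contact fields \<open>\<partial>/\<partial>x\<^sub>i\<close>, \<open>\<partial>/\<partial>y\<^sub>i + x\<^sub>i \<partial>/\<partial>z\<close> and \<open>\<partial>/\<partial>z\<close>, which satisfy the relations of \<open>a\<^sub>i\<close>, \<open>b\<^sub>i\<close>, \<open>e\<close>
  and act on generating functions as these same differential operators.

  Now let \<open>L\<close> be any transitive graded Lie algebra with negative part \<open>\<mm>\<close>. The generating function of
  \<open>X \<in> L\<close> has to be the polynomial whose derivatives at the origin are the \<open>e\<close>-coordinates of iterated
  brackets of \<open>X\<close> with the \<open>a\<^sub>i\<close>, \<open>b\<^sub>i\<close> and \<open>e\<close>. Taking this Taylor series as the definition
  (\<open>generating_function\<close>) gives a graded linear map \<open>\<phi>\<close> from \<open>L\<close> to the contact algebra which commutes with the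
  action of \<open>\<mm>\<close>; no integrability problem has to be solved. Everything else follows from transitivity.
  The map \<open>\<phi>\<close> is injective, because by induction on the degree an element of its kernel commutes with \<open>L\<^sub>-\<^sub>1\<close>.
  It is a homomorphism, because \<open>\<phi>[X, Y] - [\<phi> X, \<phi> Y]\<close> commutes, by induction on the sum of the degrees, with
  the degree \<open>-1\<close> part of the contact algebra, which is itself transitive (\<open>contact_transitive\<close>).

  Applied to \<open>L = \<mm>\<close> the embedding identifies \<open>\<mm>\<close> with the negative part of the contact algebra, and applied
  to an arbitrary \<open>L\<close> it is the maximality. Another maximal transitive prolongation embeds into the contact
  algebra and contains a copy of it; since the homogeneous parts are finite-dimensional, it is isomorphic to it.
\<close>

section \<open>Linear algebra\<close>

text \<open>
  The map is assumed to be linear on \<open>U\<close> only, since homomorphisms of graded Lie algebras are controlled only on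
  their carrier. The image of a basis of \<open>U\<close> is independent, and a vector of \<open>U\<close> outside its span
  would yield an independent subset of \<open>U\<close> with more elements than a basis.
\<close>

lemma (in vector_space) injective_endomorphism_surj:
  assumes C: "finite C" "U \<subseteq> span C" and U: "subspace U"
    and add: "\<And>x y. x \<in> U \<Longrightarrow> y \<in> U \<Longrightarrow> f (x + y) = f x + f y"
    and scale: "\<And>c x. x \<in> U \<Longrightarrow> f (scale c x) = scale c (f x)"
    and inj: "inj_on f U" and into: "f ` U \<subseteq> U"
  shows "f ` U = U"
proof -
  have f0: "f 0 = 0" using scale[OF subspace_0[OF U], of 0] by simp
  have fsum: "f (\<Sum>x\<in>A. scale (u x) x) = (\<Sum>x\<in>A. scale (u x) (f x)) \<and> (\<Sum>x\<in>A. scale (u x) x) \<in> U"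
    if "A \<subseteq> U" "finite A" for A u
    using that(2,1) by (induction A) (simp_all add: f0 subspace_0[OF U] add scale subspace_add[OF U] subspace_scale[OF U])
  obtain B where B: "B \<subseteq> U" "independent B" "U \<subseteq> span B" using basis_exists by metis
  have "B \<subseteq> span C" using B(1) C(2) by blast
  then have finB: "finite B" using independent_span_bound[OF C(1) B(2)] by blast
  have injB: "inj_on f B" using inj B(1) by (rule inj_on_subset)
  have ind: "independent (f ` B)"
  proof (rule independent_if_scalars_zero)
    fix u y assume sum0: "(\<Sum>y\<in>f ` B. scale (u y) y) = 0" and y: "y \<in> f ` B"
    then have "(\<Sum>x\<in>B. scale (u (f x)) (f x)) = 0" using injB by (simp add: sum.reindex)
    then have "f (\<Sum>x\<in>B. scale (u (f x)) x) = f 0" using fsum[OF B(1) finB, of "u \<circ> f"] f0 by simp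
    moreover have "(\<Sum>x\<in>B. scale (u (f x)) x) \<in> U" using fsum[OF B(1) finB, of "u \<circ> f"] by simp
    ultimately have "(\<Sum>x\<in>B. scale (u (f x)) x) = 0"
      using inj subspace_0[OF U] by (metis inj_onD)
    then show "u y = 0" using independentD[OF B(2) finB subset_refl, of "u \<circ> f"] y by auto
  qed (use finB in simp)
  have *: "U \<subseteq> span (f ` B)"
  proof
    fix x assume "x \<in> U"
    show "x \<in> span (f ` B)"
    proof (rule ccontr)
      assume x: "x \<notin> span (f ` B)"
      then have "independent (insert x (f ` B))" using ind by (rule independent_insertI)
      moreover have "insert x (f ` B) \<subseteq> span B" using \<open>x \<in> U\<close> B(1,3) into by blast
      ultimately have "card (insert x (f ` B)) \<le> card B" using independent_span_bound[OF finB] by blast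
      moreover have "x \<notin> f ` B" using x span_base by blast
      ultimately show False using finB card_image[OF injB] by simp
    qed
  qed
  have "U \<subseteq> f ` U"
  proof
    fix y assume "y \<in> U"
    then have "y \<in> span (f ` B)" using * by blast
    then obtain u where "y = (\<Sum>y\<in>f ` B. scale (u y) y)"
      unfolding span_finite[OF finite_imageI[OF finB]] by blast
    also have "\<dots> = f (\<Sum>x\<in>B. scale (u (f x)) x)"
      using fsum[OF B(1) finB, of "u \<circ> f"] injB by (simp add: sum.reindex)
    finally have y: "y = f (\<Sum>x\<in>B. scale (u (f x)) x)" .
    show "y \<in> f ` U" unfolding y using fsum[OF B(1) finB, of "u \<circ> f"] by (intro imageI) simp
  qed
  then show ?thesis using into by blast
qed

context vector_space
begin

text \<open>
  The component of \<open>s\<close> in the line of \<open>w i\<close> is a multiple of \<open>w i\<close>, so a unique decomposition along the lines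
  is the same as unique coordinates. This turns a count of one-dimensional summands into a dimension.
\<close>

lemma lines_decomposition_iff:
  fixes w :: "nat \<Rightarrow> 'b"
  assumes nz: "\<And>i. i < n \<Longrightarrow> w i \<noteq> 0"
  shows "(\<forall>s. \<exists>!f. (\<forall>i<n. f i \<in> span {w i}) \<and> (\<forall>i\<ge>n. f i = 0) \<and> s = (\<Sum>i<n. f i)) \<longleftrightarrow>
    inj_on w {..<n} \<and> independent (w ` {..<n}) \<and> span (w ` {..<n}) = UNIV"
    (is "?dec \<longleftrightarrow> ?basis")
proof
  assume dec: ?dec
  have unique: "f = g" if "(\<forall>i<n. f i \<in> span {w i}) \<and> (\<forall>i\<ge>n. f i = 0) \<and> s = (\<Sum>i<n. f i)"
    "(\<forall>i<n. g i \<in> span {w i}) \<and> (\<forall>i\<ge>n. g i = 0) \<and> s = (\<Sum>i<n. g i)" for f g s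
    using dec that by (blast dest: spec[of _ s])
  have coeffs0: "c i = 0" if "(\<Sum>i<n. scale (c i) (w i)) = 0" "i < n" for c i
  proof -
    let ?f = "\<lambda>i. if i < n then scale (c i) (w i) else 0"
    have "scale (c i) (w i) \<in> span {w i}" for i by (simp add: span_scale span_base)
    moreover have "(\<Sum>i<n. ?f i) = (\<Sum>i<n. scale (c i) (w i))" by (rule sum.cong) auto
    ultimately have "(\<forall>i<n. ?f i \<in> span {w i}) \<and> (\<forall>i\<ge>n. ?f i = 0) \<and> 0 = (\<Sum>i<n. ?f i)"
      using that(1) by auto
    moreover have "(\<forall>i<n. (\<lambda>_. 0::'b) i \<in> span {w i}) \<and> (\<forall>i\<ge>n. (\<lambda>_. 0) i = (0::'b)) \<and> 0 = (\<Sum>i<n. (\<lambda>_. 0::'b) i)"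
      by (simp add: span_zero)
    ultimately have "?f = (\<lambda>_. 0)" by (rule unique)
    then have "scale (c i) (w i) = 0" using that(2) by meson
    then show ?thesis using nz that(2) by simp
  qed
  have inj: "inj_on w {..<n}"
  proof (rule inj_onI, rule ccontr)
    fix i j assume ij: "i \<in> {..<n}" "j \<in> {..<n}" "w i = w j" "i \<noteq> j"
    let ?c = "\<lambda>k. if k = i then 1 else if k = j then -1 else 0 :: 'a"
    have "(\<Sum>k<n. scale (?c k) (w k)) = (\<Sum>k<n. (if k = i then w i else 0) + (if k = j then - w j else 0))"
      using ij(4) by (intro sum.cong) auto
    also have "\<dots> = 0" using ij by (simp add: sum.distrib)
    finally show False using coeffs0[of ?c i] ij by simp
  qed
  moreover have "independent (w ` {..<n})"
  proof (rule independent_if_scalars_zero)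
    fix u x assume "(\<Sum>x\<in>w ` {..<n}. scale (u x) x) = 0" and x: "x \<in> w ` {..<n}"
    then have "(\<Sum>i<n. scale (u (w i)) (w i)) = 0" using inj by (simp add: sum.reindex)
    then show "u x = 0" using coeffs0[of "u \<circ> w"] x by auto
  qed simp
  moreover have "s \<in> span (w ` {..<n})" for s
  proof -
    obtain f where f: "\<forall>i<n. f i \<in> span {w i}" "s = (\<Sum>i<n. f i)" using dec by blast
    have "f i \<in> span (w ` {..<n})" if "i < n" for i
      using f(1) that span_mono[of "{w i}" "w ` {..<n}"] by auto
    then show ?thesis unfolding f(2) by (intro span_sum) auto
  qed
  ultimately show ?basis by blast
next
  assume basis: ?basis
  then have inj: "inj_on w {..<n}" and ind: "independent (w ` {..<n})" and sp: "span (w ` {..<n}) = UNIV"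
    by auto
  have coeffs0: "c i = 0" if "(\<Sum>i<n. scale (c i) (w i)) = 0" "i < n" for c i
  proof -
    let ?u = "c \<circ> inv_into {..<n} w"
    have "(\<Sum>x\<in>w ` {..<n}. scale (?u x) x) = (\<Sum>i<n. scale (c i) (w i))"
      using inj by (simp add: sum.reindex inv_into_f_f)
    then have "?u (w i) = 0" using independentD[OF ind _ subset_refl, of ?u] that by simp
    then show ?thesis using inj that(2) by (simp add: inv_into_f_f)
  qed
  show ?dec
  proof (intro allI ex_ex1I)
    fix s
    have "s \<in> span (w ` {..<n})" using sp by simp
    then obtain u where u: "s = (\<Sum>x\<in>w ` {..<n}. scale (u x) x)" by (auto simp: span_finite)
    also have "\<dots> = (\<Sum>i<n. scale (u (w i)) (w i))" using inj by (simp add: sum.reindex)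
    finally show "\<exists>f. (\<forall>i<n. f i \<in> span {w i}) \<and> (\<forall>i\<ge>n. f i = 0) \<and> s = (\<Sum>i<n. f i)"
      by (intro exI[of _ "\<lambda>i. if i < n then scale (u (w i)) (w i) else 0"] conjI)
        (simp_all add: span_scale span_base)
  next
    fix s f g
    assume f: "(\<forall>i<n. f i \<in> span {w i}) \<and> (\<forall>i\<ge>n. f i = 0) \<and> s = (\<Sum>i<n. f i)"
      and g: "(\<forall>i<n. g i \<in> span {w i}) \<and> (\<forall>i\<ge>n. g i = 0) \<and> s = (\<Sum>i<n. g i)"
    have "f i - g i \<in> span {w i}" if "i < n" for i using f g that by (blast intro: span_diff)
    then have "\<forall>i\<in>{..<n}. \<exists>c. f i - g i = scale c (w i)" by (auto simp: span_singleton)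
    then obtain c where c: "\<And>i. i < n \<Longrightarrow> f i - g i = scale (c i) (w i)"
      unfolding bchoice_iff by blast
    have "(\<Sum>i<n. scale (c i) (w i)) = (\<Sum>i<n. f i - g i)" using c by (intro sum.cong) auto
    also have "\<dots> = 0" using f g by (simp add: sum_subtractf)
    finally have "f i = g i" if "i < n" for i using coeffs0[OF _ that, of c] c[OF that] by simp
    then show "f = g" using f g by (metis ext linorder_not_less)
  qed
qed

end

locale symplectic_space = vector_space scale
  for scale :: "complex \<Rightarrow> 'w::ab_group_add \<Rightarrow> 'w" +
  fixes \<omega> :: "'w \<Rightarrow> 'w \<Rightarrow> complex"
  assumes bilinear: "bilinear_form scale \<omega>"
    and skew: "\<omega> s t = - \<omega> t s"
    and nondeg: "nondegenerate \<omega>"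
    and fin_dim: "fin_dim scale UNIV"
begin

lemma \<omega>_add_left: "\<omega> (x + y) z = \<omega> x z + \<omega> y z"
  and \<omega>_add_right: "\<omega> z (x + y) = \<omega> z x + \<omega> z y"
  and \<omega>_scale_left: "\<omega> (scale c x) z = c * \<omega> x z"
  and \<omega>_scale_right: "\<omega> z (scale c x) = c * \<omega> z x"
  using bilinear unfolding bilinear_form_def Vector_Spaces.linear_iff by auto

lemma \<omega>_0_left: "\<omega> 0 z = 0" and \<omega>_0_right: "\<omega> z 0 = 0"
  using \<omega>_scale_left[of 0 0 z] \<omega>_scale_right[of z 0 0] by simp_all

lemma \<omega>_sum_left: "\<omega> (sum f A) z = (\<Sum>x\<in>A. \<omega> (f x) z)"
  by (induction A rule: infinite_finite_induct) (simp_all add: \<omega>_0_left \<omega>_add_left)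

lemma \<omega>_diff_left: "\<omega> (x - y) z = \<omega> x z - \<omega> y z"
  using \<omega>_add_left[of "x - y" y z] by simp

lemma \<omega>_self: "\<omega> x x = 0"
  using skew[of x x] by simp

definition symplectic_family :: "nat \<Rightarrow> (nat \<Rightarrow> 'w) \<Rightarrow> (nat \<Rightarrow> 'w) \<Rightarrow> bool"
  where "symplectic_family l a b \<longleftrightarrow> (\<forall>i\<in>{1..l}. \<forall>j\<in>{1..l}.
    \<omega> (a i) (b j) = (if i = j then 1 else 0) \<and> \<omega> (a i) (a j) = 0 \<and> \<omega> (b i) (b j) = 0)"

text \<open>
  Pairing a linear combination with \<open>b j\<close> or \<open>a j\<close> isolates, up to sign, the coefficient of \<open>a j\<close> or \<open>b j\<close>.
\<close>

lemma symplectic_family_independent: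
  assumes "symplectic_family l a b"
  shows "independent (a ` {1..l} \<union> b ` {1..l})" and "card (a ` {1..l} \<union> b ` {1..l}) = 2 * l"
proof -
  have ab: "\<omega> (a i) (b j) = (if i = j then 1 else 0)" and ba: "\<omega> (b j) (a i) = (if i = j then -1 else 0)"
    and aa: "\<omega> (a i) (a j) = 0" and bb: "\<omega> (b i) (b j) = 0"
    if "i \<in> {1..l}" "j \<in> {1..l}" for i j
    using assms that skew[of "b j" "a i"] by (simp_all add: symplectic_family_def)
  have inj_a: "a i = a j \<longleftrightarrow> i = j" if "i \<in> {1..l}" "j \<in> {1..l}" for i j
    using ab[OF that(1) that(1)] ab[OF that(2) that(1)] by (auto split: if_splits)
  have inj_b: "b i = b j \<longleftrightarrow> i = j" if "i \<in> {1..l}" "j \<in> {1..l}" for i j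
    using ab[OF that(1) that(1)] ab[OF that(1) that(2)] by (auto split: if_splits)
  have disj: "a i \<noteq> b j" if "i \<in> {1..l}" "j \<in> {1..l}" for i j
    using ab[OF that(1) that(1)] bb[OF that(2) that(1)] by auto
  have "a ` {1..l} \<inter> b ` {1..l} = {}" using disj by blast
  moreover have "inj_on a {1..l}" "inj_on b {1..l}" using inj_a inj_b by (auto intro!: inj_onI)
  ultimately show "card (a ` {1..l} \<union> b ` {1..l}) = 2 * l"
    by (simp add: card_Un_disjoint card_image)
  show "independent (a ` {1..l} \<union> b ` {1..l})"
  proof (rule independent_if_scalars_zero)
    let ?S = "a ` {1..l} \<union> b ` {1..l}"
    fix u x assume sum0: "(\<Sum>x\<in>?S. scale (u x) x) = 0" and x: "x \<in> ?S"
    have pair: "(\<Sum>x\<in>?S. u x * \<omega> x z) = 0" for z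
      using arg_cong[OF sum0, of "\<lambda>s. \<omega> s z"] by (simp add: \<omega>_sum_left \<omega>_scale_left \<omega>_0_left)
    from x show "u x = 0"
    proof
      assume "x \<in> a ` {1..l}"
      then obtain j where j: "j \<in> {1..l}" "x = a j" by blast
      have "(\<Sum>y\<in>?S. u y * \<omega> y (b j)) = (\<Sum>y\<in>?S. if y = x then u x else 0)"
        using j by (intro sum.cong refl) (auto simp: ab bb inj_a disj[symmetric])
      then show ?thesis using pair x by simp
    next
      assume "x \<in> b ` {1..l}"
      then obtain j where j: "j \<in> {1..l}" "x = b j" by blast
      have "(\<Sum>y\<in>?S. u y * \<omega> y (a j)) = (\<Sum>y\<in>?S. if y = x then - u x else 0)"
        using j by (intro sum.cong refl) (auto simp: ba aa inj_b disj)
      then show ?thesis using pair x by simp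
    qed
  qed simp
qed

text \<open>
  \<open>P\<close> is the projection onto the \<open>\<omega>\<close>-orthogonal complement of the span of the family.
\<close>

lemma symplectic_family_complement:
  assumes "symplectic_family l a b"
  defines "P \<equiv> \<lambda>s. s - (\<Sum>i=1..l. scale (\<omega> s (b i)) (a i) + scale (\<omega> (a i) s) (b i))"
  assumes j: "j \<in> {1..l}"
  shows "\<omega> (P s) (a j) = 0" and "\<omega> (P s) (b j) = 0"
proof -
  have ab: "\<omega> (a i) (b j) = (if i = j then 1 else 0)" and ba: "\<omega> (b i) (a j) = (if i = j then -1 else 0)"
    and aa: "\<omega> (a i) (a j) = 0" and bb: "\<omega> (b i) (b j) = 0"
    if "i \<in> {1..l}" "j \<in> {1..l}" for i j
    using assms(1) that skew[of "b i" "a j"] by (simp_all add: symplectic_family_def)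
  have "(\<Sum>i=1..l. \<omega> s (b i) * \<omega> (a i) (a j) + \<omega> (a i) s * \<omega> (b i) (a j)) =
      (\<Sum>i=1..l. if i = j then - \<omega> (a j) s else 0)"
    using j by (intro sum.cong) (auto simp: aa ba)
  then show "\<omega> (P s) (a j) = 0"
    using j skew[of s "a j"]
    by (simp add: P_def \<omega>_diff_left \<omega>_sum_left \<omega>_add_left \<omega>_scale_left)
  have "(\<Sum>i=1..l. \<omega> s (b i) * \<omega> (a i) (b j) + \<omega> (a i) s * \<omega> (b i) (b j)) =
      (\<Sum>i=1..l. if i = j then \<omega> s (b j) else 0)"
    using j by (intro sum.cong) (auto simp: ab bb)
  then show "\<omega> (P s) (b j) = 0"
    using j by (simp add: P_def \<omega>_diff_left \<omega>_sum_left \<omega>_add_left \<omega>_scale_left)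
qed

text \<open>
  A symplectic family of maximal length spans: a nonzero vector in the orthogonal complement has, by
  nondegeneracy, a partner, which can be projected to the complement and normalised, and the two vectors
  extend the family.
\<close>

theorem symplectic_basis:
  obtains l a b where "symplectic_family l a b"
    and "span (a ` {1..l} \<union> b ` {1..l}) = UNIV" and "dim UNIV = 2 * l"
proof -
  obtain B where B: "finite B" "UNIV \<subseteq> span B" using fin_dim by (auto simp: fin_dim_def)
  have bound: "l \<le> card B" if "symplectic_family l a b" for l a b
  proof -
    have "a ` {1..l} \<union> b ` {1..l} \<subseteq> span B" using B(2) by blast
    then have "2 * l \<le> card B"
      using independent_span_bound[OF B(1) symplectic_family_independent(1)[OF that]]
        symplectic_family_independent(2)[OF that] by simp
    then show ?thesis by simp
  qed
  have "\<exists>a b. symplectic_family 0 a b" by (simp add: symplectic_family_def)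
  then obtain l where ex: "\<exists>a b. symplectic_family l a b"
    and max: "\<And>k. \<exists>a b. symplectic_family k a b \<Longrightarrow> k \<le> l"
    using Nat.ex_has_greatest_nat[of "\<lambda>l. \<exists>a b. symplectic_family l a b" 0 "card B"] bound by blast
  then obtain a b where fam: "symplectic_family l a b" by blast
  define P where "P = (\<lambda>s. s - (\<Sum>i=1..l. scale (\<omega> s (b i)) (a i) + scale (\<omega> (a i) s) (b i)))"
  have orth: "\<omega> (P s) (a j) = 0" "\<omega> (P s) (b j) = 0" if "j \<in> {1..l}" for s j
    unfolding P_def using symplectic_family_complement[OF fam that] by blast+
  have P0: "P s = 0" for s
  proof (rule ccontr)
    assume "P s \<noteq> 0"
    then obtain t where t: "\<omega> (P s) t \<noteq> 0" using nondeg unfolding nondegenerate_def by blast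
    have "\<omega> (P t) (P s) = \<omega> t (P s)"
    proof -
      have "\<omega> (a i) (P s) = 0" "\<omega> (b i) (P s) = 0" if "i \<in> {1..l}" for i
        using orth[OF that, of s] skew[of "a i" "P s"] skew[of "b i" "P s"] by auto
      then have "(\<Sum>i=1..l. \<omega> t (b i) * \<omega> (a i) (P s) + \<omega> (a i) t * \<omega> (b i) (P s)) = 0"
        by (intro sum.neutral) simp
      then show ?thesis
        by (subst P_def) (simp add: \<omega>_diff_left \<omega>_sum_left \<omega>_add_left \<omega>_scale_left)
    qed
    then have Pt: "\<omega> (P s) (P t) \<noteq> 0" using t skew[of "P s"] by (metis neg_equal_0_iff_equal)
    define q where "q = scale (1 / \<omega> (P s) (P t)) (P t)"
    define a' b' where "a' = a(Suc l := P s)" and "b' = b(Suc l := q)"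
    have pq: "\<omega> (P s) q = 1" using Pt by (simp add: q_def \<omega>_scale_right)
    have q_orth: "\<omega> q (a j) = 0" "\<omega> q (b j) = 0" if "j \<in> {1..l}" for j
      using orth[OF that] by (simp_all add: q_def \<omega>_scale_left)
    have rev: "\<omega> (a j) q = 0" "\<omega> (b j) q = 0" "\<omega> (a j) (P s) = 0" "\<omega> (b j) (P s) = 0"
      if "j \<in> {1..l}" for j
      using q_orth[OF that] orth[OF that, of s] skew[of "a j"] skew[of "b j"] by simp_all
    have "symplectic_family (Suc l) a' b'"
      unfolding symplectic_family_def
    proof (intro ballI)
      fix i j assume ij: "i \<in> {1..Suc l}" "j \<in> {1..Suc l}"
      then consider "i = Suc l" "j = Suc l" | "i = Suc l" "j \<in> {1..l}" | "i \<in> {1..l}" "j = Suc l"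
        | "i \<in> {1..l}" "j \<in> {1..l}" by force
      then show "\<omega> (a' i) (b' j) = (if i = j then 1 else 0) \<and> \<omega> (a' i) (a' j) = 0 \<and> \<omega> (b' i) (b' j) = 0"
        by cases (use fam in \<open>auto simp: a'_def b'_def pq \<omega>_self orth q_orth rev symplectic_family_def\<close>)
    qed
    then show False using max[of "Suc l"] by auto
  qed
  have "s \<in> span (a ` {1..l} \<union> b ` {1..l})" for s
  proof -
    have "s = (\<Sum>i=1..l. scale (\<omega> s (b i)) (a i) + scale (\<omega> (a i) s) (b i))"
      using P0[of s] by (simp add: P_def)
    also have "\<dots> \<in> span (a ` {1..l} \<union> b ` {1..l})"
      by (intro span_sum span_add span_scale span_base) auto
    finally show ?thesis .
  qed
  then have "span (a ` {1..l} \<union> b ` {1..l}) = UNIV" by blast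
  moreover from this have "dim UNIV = 2 * l"
    using basis_card_eq_dim[OF subset_UNIV, of "a ` {1..l} \<union> b ` {1..l}"]
      symplectic_family_independent[OF fam] by simp
  ultimately show ?thesis using fam that by blast
qed

end

section \<open>Polynomial vector fields as derivations\<close>

text \<open>
  In the sum that defines the derivative only \<open>k = m + 1\<^sub>c\<close> contributes to \<open>m\<close>. The truncated subtraction
  \<open>k - 1\<^sub>c\<close> is not injective in \<open>k\<close>, but it fails to be so only at exponents 0 of \<open>c\<close>, where the coefficient vanishes.
\<close>

lemma lookup_partial_deriv:
  "Poly_Mapping.lookup (partial_deriv c f) m =
    of_nat (Poly_Mapping.lookup m c + 1) * Poly_Mapping.lookup f (m + Poly_Mapping.single c 1)"
proof -
  let ?s = "Poly_Mapping.single c (1::nat)"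
  have *: "Poly_Mapping.lookup (Poly_Mapping.single (k - ?s)
        (of_nat (Poly_Mapping.lookup k c) * Poly_Mapping.lookup f k)) m
      = (if k = m + ?s then of_nat (Poly_Mapping.lookup m c + 1) * Poly_Mapping.lookup f (m + ?s) else 0)"
    for k
  proof (cases "Poly_Mapping.lookup k c = 0")
    case True
    then show ?thesis by (auto simp: lookup_add)
  next
    case False
    then have k: "k - ?s + ?s = k"
      by (intro poly_mapping_eqI) (auto simp: lookup_add lookup_minus lookup_single when_def)
    then have "k - ?s = m \<longleftrightarrow> k = m + ?s" by (metis add_diff_cancel_right')
    then show ?thesis by (auto simp: lookup_single when_def lookup_add)
  qed
  show ?thesis
    unfolding partial_deriv_def lookup_sum *
    by (simp add: in_keys_iff)
qed

lemma partial_deriv_0 [simp]: "partial_deriv c 0 = 0"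
  and partial_deriv_add: "partial_deriv c (f + g) = partial_deriv c f + partial_deriv c g"
  and partial_deriv_minus: "partial_deriv c (- f) = - partial_deriv c f"
  and partial_deriv_diff: "partial_deriv c (f - g) = partial_deriv c f - partial_deriv c g"
  by (rule poly_mapping_eqI; simp add: lookup_partial_deriv lookup_add lookup_minus algebra_simps)+

lemma partial_deriv_sum: "partial_deriv c (sum f A) = (\<Sum>a\<in>A. partial_deriv c (f a))"
  by (induction A rule: infinite_finite_induct) (simp_all add: partial_deriv_add)

lemma partial_deriv_single:
  "partial_deriv c (Poly_Mapping.single m a) =
    Poly_Mapping.single (m - Poly_Mapping.single c 1) (of_nat (Poly_Mapping.lookup m c) * a)"
  by (simp add: partial_deriv_def)

lemma partial_deriv_commute: "partial_deriv c (partial_deriv d f) = partial_deriv d (partial_deriv c f)"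
  by (rule poly_mapping_eqI)
    (auto simp: lookup_partial_deriv lookup_add lookup_single when_def algebra_simps)

lemma polynomial_eq_sum_singles:
  "f = (\<Sum>m\<in>Poly_Mapping.keys f. Poly_Mapping.single m (Poly_Mapping.lookup f m))"
  by (rule poly_mapping_eqI) (simp add: lookup_sum lookup_single when_def in_keys_iff)

lemma lookup_const_mult: "Poly_Mapping.lookup (const c * f) m = c * Poly_Mapping.lookup (f :: polynomial) m"
  by (subst polynomial_eq_sum_singles[of f])
    (simp add: sum_distrib_left mult_single lookup_sum lookup_single when_def in_keys_iff)

text \<open>
  By bilinearity the product rule needs to be verified on monomials only.
\<close>

lemma partial_deriv_mult_singles:
  "partial_deriv c (Poly_Mapping.single m a * Poly_Mapping.single n b) =
    partial_deriv c (Poly_Mapping.single m a) * Poly_Mapping.single n b +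
    Poly_Mapping.single m a * partial_deriv c (Poly_Mapping.single n b)"
proof -
  let ?s = "Poly_Mapping.single c (1::nat)"
  have shift: "k + l - ?s = (k - ?s) + l" if "Poly_Mapping.lookup k c \<noteq> 0" for k l :: monomial
    by (rule poly_mapping_eqI) (use that in \<open>auto simp: lookup_add lookup_minus lookup_single when_def\<close>)
  have "m + n - ?s = (m - ?s) + n" if "Poly_Mapping.lookup m c \<noteq> 0"
    using shift[OF that] .
  moreover have "m + n - ?s = m + (n - ?s)" if "Poly_Mapping.lookup n c \<noteq> 0"
    using shift[OF that, of m] by (simp add: add.commute)
  ultimately show ?thesis
    by (cases "Poly_Mapping.lookup m c = 0"; cases "Poly_Mapping.lookup n c = 0")
      (simp_all add: partial_deriv_single mult_single lookup_add algebra_simps flip: single_add)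
qed

lemma partial_deriv_mult: "partial_deriv c (f * g) = partial_deriv c f * g + f * partial_deriv c g"
proof -
  let ?f = "\<lambda>m. Poly_Mapping.single m (Poly_Mapping.lookup f m)"
  let ?g = "\<lambda>m. Poly_Mapping.single m (Poly_Mapping.lookup g m)"
  let ?F = "Poly_Mapping.keys f" let ?G = "Poly_Mapping.keys g"
  have "partial_deriv c (sum ?f ?F * sum ?g ?G) =
      partial_deriv c (sum ?f ?F) * sum ?g ?G + sum ?f ?F * partial_deriv c (sum ?g ?G)"
    unfolding sum_product partial_deriv_sum partial_deriv_mult_singles
    by (simp add: sum.distrib)
  then show ?thesis by (simp flip: polynomial_eq_sum_singles)
qed

lemma partial_deriv_const [simp]: "partial_deriv c (const a) = 0"
  by (simp add: partial_deriv_single)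

lemma partial_deriv_one [simp]: "partial_deriv c 1 = 0"
  using partial_deriv_const[of c 1] by simp

lemma partial_deriv_var: "partial_deriv c (var d) = (if c = d then 1 else 0)"
  by (auto simp: var_def partial_deriv_single lookup_single when_def)

lemma keys_add_single: "Poly_Mapping.keys (m + Poly_Mapping.single c (1::nat)) = insert c (Poly_Mapping.keys m)"
  by (auto simp: in_keys_iff lookup_add lookup_single when_def split: if_splits)

lemma lookup_var_mult:
  "Poly_Mapping.lookup (var c * f) m =
    (if Poly_Mapping.lookup m c = 0 then 0 else Poly_Mapping.lookup f (m - Poly_Mapping.single c 1))"
proof -
  let ?s = "Poly_Mapping.single c (1::nat)"
  have eq: "?s + k = m \<longleftrightarrow> Poly_Mapping.lookup m c \<noteq> 0 \<and> k = m - ?s" for k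
  proof
    assume "?s + k = m"
    then show "Poly_Mapping.lookup m c \<noteq> 0 \<and> k = m - ?s" by (auto simp: lookup_add)
  next
    assume "Poly_Mapping.lookup m c \<noteq> 0 \<and> k = m - ?s"
    then show "?s + k = m"
      by (intro poly_mapping_eqI) (auto simp: lookup_add lookup_minus lookup_single when_def)
  qed
  show ?thesis
    by (subst polynomial_eq_sum_singles[of f])
      (simp add: var_def sum_distrib_left mult_single lookup_sum lookup_single when_def eq[unfolded One_nat_def]
        in_keys_iff)
qed

definition polynomials_on :: "coord set \<Rightarrow> polynomial set"
  where "polynomials_on S = {f. \<forall>m\<in>Poly_Mapping.keys f. Poly_Mapping.keys m \<subseteq> S}"

lemma polynomials_on_0 [simp]: "0 \<in> polynomials_on S"
  and polynomials_on_1 [simp]: "1 \<in> polynomials_on S"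
  and polynomials_on_const [simp]: "const a \<in> polynomials_on S"
  and polynomials_on_add: "f \<in> polynomials_on S \<Longrightarrow> g \<in> polynomials_on S \<Longrightarrow> f + g \<in> polynomials_on S"
  and polynomials_on_minus: "f \<in> polynomials_on S \<Longrightarrow> - f \<in> polynomials_on S"
  and polynomials_on_diff: "f \<in> polynomials_on S \<Longrightarrow> g \<in> polynomials_on S \<Longrightarrow> f - g \<in> polynomials_on S"
  using Poly_Mapping.keys_add[of f g] keys_diff[of f g]
  by (auto simp: polynomials_on_def)

lemma polynomials_on_mult:
  assumes "f \<in> polynomials_on S" "g \<in> polynomials_on S"
  shows "f * g \<in> polynomials_on S"
proof -
  have "Poly_Mapping.keys (a + b) \<subseteq> S"
    if "a \<in> Poly_Mapping.keys f" "b \<in> Poly_Mapping.keys g" for a b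
    using that assms Poly_Mapping.keys_add[of a b] unfolding polynomials_on_def by blast
  then show ?thesis using keys_mult[of f g] unfolding polynomials_on_def by blast
qed

lemma polynomials_on_sum: "(\<And>a. a \<in> A \<Longrightarrow> f a \<in> polynomials_on S) \<Longrightarrow> sum f A \<in> polynomials_on S"
  by (induction A rule: infinite_finite_induct) (simp_all add: polynomials_on_add)

lemma polynomials_on_var: "c \<in> S \<Longrightarrow> var c \<in> polynomials_on S"
  by (auto simp: polynomials_on_def var_def)

lemma polynomials_on_partial_deriv:
  assumes "f \<in> polynomials_on S" shows "partial_deriv c f \<in> polynomials_on S"
proof -
  have "Poly_Mapping.keys m \<subseteq> S" if "m \<in> Poly_Mapping.keys (partial_deriv c f)" for m
  proof -
    from that have "m + Poly_Mapping.single c 1 \<in> Poly_Mapping.keys f"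
      by (auto simp: in_keys_iff lookup_partial_deriv)
    then have "Poly_Mapping.keys (m + Poly_Mapping.single c 1) \<subseteq> S"
      using assms by (auto simp: polynomials_on_def)
    then show ?thesis by (auto simp: in_keys_iff lookup_add subset_iff)
  qed
  then show ?thesis by (auto simp: polynomials_on_def)
qed

lemmas polynomials_on_intros = polynomials_on_add polynomials_on_minus polynomials_on_diff
  polynomials_on_mult polynomials_on_sum polynomials_on_var polynomials_on_partial_deriv

text \<open>
  The derivation of the polynomial ring that a vector field defines. Identities between brackets of vector
  fields become identities between commutators of derivations.
\<close>

definition field_deriv :: "nat \<Rightarrow> vector_field \<Rightarrow> polynomial \<Rightarrow> polynomial"
  where "field_deriv l F p = (\<Sum>d\<in>coords l. F d * partial_deriv d p)"

lemma finite_coords [simp]: "finite (coords l)"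
  by (simp add: coords_def)

lemma sum_coords:
  "sum h (coords l) = (\<Sum>i=1..l. h (X i)) + (\<Sum>i=1..l. h (Y i)) + h Z"
proof -
  have "sum h (coords l) = sum h (X ` {1..l}) + sum h (Y ` {1..l}) + sum h {Z}"
    unfolding coords_def by (subst sum.union_disjoint; (subst sum.union_disjoint)?) auto
  also have "sum h (X ` {1..l}) = (\<Sum>i=1..l. h (X i))"
    by (subst sum.reindex) (auto intro: inj_onI)
  also have "sum h (Y ` {1..l}) = (\<Sum>i=1..l. h (Y i))"
    by (subst sum.reindex) (auto intro: inj_onI)
  finally show ?thesis by simp
qed

lemma field_deriv_0 [simp]: "field_deriv l F 0 = 0"
  and field_deriv_1 [simp]: "field_deriv l F 1 = 0"
  and field_deriv_const [simp]: "field_deriv l F (const a) = 0"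
  and field_deriv_add: "field_deriv l F (p + q) = field_deriv l F p + field_deriv l F q"
  and field_deriv_diff: "field_deriv l F (p - q) = field_deriv l F p - field_deriv l F q"
  and field_deriv_minus: "field_deriv l F (- p) = - field_deriv l F p"
  and field_deriv_mult: "field_deriv l F (p * q) = field_deriv l F p * q + p * field_deriv l F q"
  by (simp_all add: field_deriv_def partial_deriv_add partial_deriv_diff partial_deriv_minus
      partial_deriv_mult algebra_simps sum.distrib sum_subtractf sum_negf sum_distrib_left)

lemma field_deriv_sum: "field_deriv l F (sum f A) = (\<Sum>a\<in>A. field_deriv l F (f a))"
  by (induction A rule: infinite_finite_induct) (simp_all add: field_deriv_add)

lemma field_deriv_var: "c \<in> coords l \<Longrightarrow> field_deriv l F (var c) = F c"
  by (simp add: field_deriv_def partial_deriv_var if_distrib[of "\<lambda>x. _ * x"] cong: if_cong)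

lemma field_deriv_field_add: "field_deriv l (F + G) p = field_deriv l F p + field_deriv l G p"
  and field_deriv_field_diff: "field_deriv l (F - G) p = field_deriv l F p - field_deriv l G p"
  and field_deriv_field_scale: "field_deriv l (\<lambda>c. a * F c) p = a * field_deriv l F p"
  by (simp_all add: field_deriv_def algebra_simps sum.distrib sum_subtractf sum_distrib_left)

lemma field_bracket_eq: "field_bracket l F G c = field_deriv l F (G c) - field_deriv l G (F c)"
  by (simp add: field_bracket_def field_deriv_def sum_subtractf)

text \<open>
  The second-order terms of \<open>F G p\<close> and \<open>G F p\<close> agree because partial derivatives commute.
\<close>

lemma field_deriv_field_bracket:
  "field_deriv l (field_bracket l F G) p = field_deriv l F (field_deriv l G p) - field_deriv l G (field_deriv l F p)"
proof -
  have second: "field_deriv l F (field_deriv l G p) =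
      (\<Sum>e\<in>coords l. field_deriv l F (G e) * partial_deriv e p) +
      (\<Sum>e\<in>coords l. \<Sum>d\<in>coords l. G e * F d * partial_deriv d (partial_deriv e p))" for F G
    unfolding field_deriv_def[of l G p] field_deriv_sum field_deriv_mult sum.distrib
    by (simp add: field_deriv_def sum_distrib_left mult.assoc)
  have "(\<Sum>e\<in>coords l. \<Sum>d\<in>coords l. G e * F d * partial_deriv d (partial_deriv e p)) =
      (\<Sum>e\<in>coords l. \<Sum>d\<in>coords l. F e * G d * partial_deriv d (partial_deriv e p))"
    by (subst sum.swap) (simp add: partial_deriv_commute mult.commute)
  then show ?thesis
    unfolding second field_deriv_def[of l "field_bracket l F G"] field_bracket_eq
    by (simp add: algebra_simps sum_subtractf)
qed

lemma field_bracket_jacobi: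
  "field_bracket l F (field_bracket l G H) + field_bracket l G (field_bracket l H F)
    + field_bracket l H (field_bracket l F G) = 0"
  by (rule ext) (simp add: field_bracket_eq field_deriv_field_bracket field_deriv_diff)

lemma field_bracket_add_left: "field_bracket l (F + G) H = field_bracket l F H + field_bracket l G H"
  and field_bracket_add_right: "field_bracket l F (G + H) = field_bracket l F G + field_bracket l F H"
  and field_bracket_diff_right: "field_bracket l F (G - H) = field_bracket l F G - field_bracket l F H"
  and field_bracket_scale_left:
    "field_bracket l (\<lambda>c. const a * F c) G = (\<lambda>c. const a * field_bracket l F G c)"
  and field_bracket_scale_right:
    "field_bracket l F (\<lambda>c. const a * G c) = (\<lambda>c. const a * field_bracket l F G c)"
  and field_bracket_self: "field_bracket l F F = 0"
  and field_bracket_swap: "field_bracket l G F = - field_bracket l F G"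
  by (rule ext; simp add: field_bracket_eq field_deriv_add field_deriv_diff field_deriv_mult field_deriv_field_add field_deriv_field_diff
      field_deriv_field_scale right_diff_distrib)+

lemma vector_fields_eq:
  "vector_fields l = {F. (\<forall>c\<in>coords l. F c \<in> polynomials_on (coords l)) \<and> (\<forall>c. c \<notin> coords l \<longrightarrow> F c = 0)}"
  by (simp add: vector_fields_def polynomials_on_def)

lemma polynomials_on_vector_field: "F \<in> vector_fields l \<Longrightarrow> F c \<in> polynomials_on (coords l)"
  by (cases "c \<in> coords l") (auto simp: vector_fields_eq)

lemma polynomials_on_derive:
  "F \<in> vector_fields l \<Longrightarrow> p \<in> polynomials_on (coords l) \<Longrightarrow> field_deriv l F p \<in> polynomials_on (coords l)"
  unfolding field_deriv_def by (intro polynomials_on_intros) (auto simp: polynomials_on_vector_field)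

lemma vector_fields_0: "0 \<in> vector_fields l"
  and vector_fields_add: "F \<in> vector_fields l \<Longrightarrow> G \<in> vector_fields l \<Longrightarrow> F + G \<in> vector_fields l"
  and vector_fields_diff: "F \<in> vector_fields l \<Longrightarrow> G \<in> vector_fields l \<Longrightarrow> F - G \<in> vector_fields l"
  and vector_fields_scale: "F \<in> vector_fields l \<Longrightarrow> (\<lambda>c. const a * F c) \<in> vector_fields l"
  and vector_fields_bracket:
    "F \<in> vector_fields l \<Longrightarrow> G \<in> vector_fields l \<Longrightarrow> field_bracket l F G \<in> vector_fields l"
  unfolding vector_fields_eq
  by (auto intro!: polynomials_on_intros polynomials_on_derive[unfolded vector_fields_eq]
      simp: field_bracket_eq)

section \<open>Contact fields and their generating functions\<close>

lemma contact_form_0 [simp]: "contact_form l 0 = 0"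
  and contact_form_add: "contact_form l (F + G) = contact_form l F + contact_form l G"
  and contact_form_diff: "contact_form l (F - G) = contact_form l F - contact_form l G"
  and contact_form_scale: "contact_form l (\<lambda>c. const a * F c) = const a * contact_form l F"
  by (simp_all add: contact_form_def algebra_simps sum.distrib sum_subtractf sum_distrib_left)

text \<open>
  Cartan's formula \<open>\<alpha>([F, G]) = F(\<alpha>(G)) - G(\<alpha>(F)) - d\<alpha>(F, G)\<close> for \<open>\<alpha> = dz - \<Sum> y\<^sub>i dx\<^sub>i\<close>, where
  \<open>d\<alpha> = \<Sum> dx\<^sub>i \<and> dy\<^sub>i\<close>.
\<close>

lemma contact_form_bracket:
  "contact_form l (field_bracket l F G) =
    field_deriv l F (contact_form l G) - field_deriv l G (contact_form l F)
    - (\<Sum>i=1..l. F (X i) * G (Y i) - F (Y i) * G (X i))"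
proof -
  have *: "field_deriv l F (contact_form l G) =
      field_deriv l F (G Z) - (\<Sum>i=1..l. F (Y i) * G (X i)) - (\<Sum>i=1..l. var (Y i) * field_deriv l F (G (X i)))"
    for F G
  proof -
    have "field_deriv l F (\<Sum>i=1..l. var (Y i) * G (X i)) =
        (\<Sum>i=1..l. F (Y i) * G (X i) + var (Y i) * field_deriv l F (G (X i)))"
      unfolding field_deriv_sum field_deriv_mult by (intro sum.cong) (auto simp: field_deriv_var coords_def)
    then show ?thesis by (simp add: contact_form_def field_deriv_diff sum.distrib)
  qed
  have "contact_form l (field_bracket l F G) = field_deriv l F (G Z) - field_deriv l G (F Z)
      - ((\<Sum>i=1..l. var (Y i) * field_deriv l F (G (X i))) - (\<Sum>i=1..l. var (Y i) * field_deriv l G (F (X i))))"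
    by (simp add: contact_form_def field_bracket_eq right_diff_distrib sum_subtractf)
  then show ?thesis
    unfolding * by (simp add: sum_subtractf mult.commute)
qed

text \<open>
  A section \<open>G\<close> of the distribution is the combination of the frame \<open>\<partial>/\<partial>x\<^sub>i + y\<^sub>i \<partial>/\<partial>z\<close>, \<open>\<partial>/\<partial>y\<^sub>i\<close> with
  coefficients \<open>G (X i)\<close>, \<open>G (Y i)\<close>. The factors next to these coefficients are therefore the equations that
  characterise contact fields.
\<close>

lemma contact_form_bracket_horizontal:
  assumes "contact_form l G = 0"
  shows "contact_form l (field_bracket l F G) =
    (\<Sum>i=1..l. G (X i) * (F (Y i) - (partial_deriv (X i) (contact_form l F) +
        var (Y i) * partial_deriv Z (contact_form l F)))
      - G (Y i) * (F (X i) + partial_deriv (Y i) (contact_form l F)))"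
proof -
  have GZ: "G Z = (\<Sum>i=1..l. var (Y i) * G (X i))"
    using assms by (simp add: contact_form_def)
  show ?thesis
    unfolding contact_form_bracket assms field_deriv_0
    by (simp add: field_deriv_def sum_coords GZ sum_distrib_left sum_distrib_right algebra_simps
        sum.distrib sum_subtractf)
qed

text \<open>
  The solution of the contact equations with \<open>\<alpha>(F) = f\<close>, also known as the contact Hamiltonian field of \<open>f\<close>.
\<close>

definition contact_field :: "nat \<Rightarrow> polynomial \<Rightarrow> vector_field"
  where "contact_field l f = (\<lambda>c. case c of
      X i \<Rightarrow> if i \<in> {1..l} then - partial_deriv (Y i) f else 0
    | Y i \<Rightarrow> if i \<in> {1..l} then partial_deriv (X i) f + var (Y i) * partial_deriv Z f else 0
    | Z \<Rightarrow> f - (\<Sum>i=1..l. var (Y i) * partial_deriv (Y i) f))"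

lemma coords_simps [simp]:
  "X i \<in> coords l \<longleftrightarrow> i \<in> {1..l}" "Y i \<in> coords l \<longleftrightarrow> i \<in> {1..l}" "Z \<in> coords l"
  by (auto simp: coords_def)

lemma contact_form_contact_field [simp]: "contact_form l (contact_field l f) = f"
  by (simp add: contact_form_def contact_field_def sum_negf)

lemma contact_field_0 [simp]: "contact_field l 0 = 0"
  and contact_field_add: "contact_field l (f + g) = contact_field l f + contact_field l g"
  and contact_field_scale: "contact_field l (const a * f) = (\<lambda>c. const a * contact_field l f c)"
  by (rule ext; simp add: contact_field_def partial_deriv_add partial_deriv_mult sum.distrib sum_distrib_left
      algebra_simps split: coord.split)+

lemma contact_field_in_vector_fields:
  "f \<in> polynomials_on (coords l) \<Longrightarrow> contact_field l f \<in> vector_fields l"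
  unfolding vector_fields_eq contact_field_def
  by (auto intro!: polynomials_on_intros simp: split: coord.split)

lemma contact_form_in_polynomials_on: "F \<in> vector_fields l \<Longrightarrow> contact_form l F \<in> polynomials_on (coords l)"
  unfolding contact_form_def by (intro polynomials_on_intros polynomials_on_vector_field) auto

text \<open>
  Bracketing with the two kinds of frame fields of the distribution extracts the contact equations one by one;
  conversely the equations make the bracket with any section horizontal.
\<close>

lemma contact_fields_iff:
  "F \<in> contact_fields l \<longleftrightarrow> F \<in> vector_fields l \<and> F = contact_field l (contact_form l F)"
proof safe
  assume F: "F \<in> contact_fields l"
  then show vF: "F \<in> vector_fields l" by (simp add: contact_fields_def)
  let ?f = "contact_form l F"
  have FY: "F (Y i) = partial_deriv (X i) ?f + var (Y i) * partial_deriv Z ?f"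
    and FX: "F (X i) = - partial_deriv (Y i) ?f" if i: "i \<in> {1..l}" for i
  proof -
    \<comment> \<open>The frame fields \<open>\<partial>/\<partial>x\<^sub>i + y\<^sub>i \<partial>/\<partial>z\<close> and \<open>\<partial>/\<partial>y\<^sub>i\<close>.\<close>
    define G H :: vector_field where
      "G = (\<lambda>c. if c = X i then 1 else if c = Z then var (Y i) else 0)" and
      "H = (\<lambda>c. if c = Y i then 1 else 0)"
    have "G \<in> contact_distribution l" "H \<in> contact_distribution l"
      using i by (auto simp: contact_distribution_def vector_fields_eq contact_form_def G_def H_def
          polynomials_on_var if_distrib[of "\<lambda>x. _ * x"] cong: if_cong)
    then have "contact_form l G = 0" "contact_form l H = 0"
      "contact_form l (field_bracket l F G) = 0" "contact_form l (field_bracket l F H) = 0"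
      using F by (auto simp: contact_fields_def contact_distribution_def)
    then have eqs: "(\<Sum>j=1..l. G (X j) * (F (Y j) - (partial_deriv (X j) ?f + var (Y j) * partial_deriv Z ?f))
        - G (Y j) * (F (X j) + partial_deriv (Y j) ?f)) = 0"
      "(\<Sum>j=1..l. H (X j) * (F (Y j) - (partial_deriv (X j) ?f + var (Y j) * partial_deriv Z ?f))
        - H (Y j) * (F (X j) + partial_deriv (Y j) ?f)) = 0"
      using contact_form_bracket_horizontal[of l G F] contact_form_bracket_horizontal[of l H F] by simp_all
    show "F (Y i) = partial_deriv (X i) ?f + var (Y i) * partial_deriv Z ?f"
      using eqs(1) i by (simp add: G_def if_distrib[of "\<lambda>x. x * _"] cong: if_cong)
    show "F (X i) = - partial_deriv (Y i) ?f"
      using eqs(2) i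
      by (simp add: H_def if_distrib[of "\<lambda>x. x * _"] sum_negf eq_neg_iff_add_eq_0 cong: if_cong)
  qed
  have "F Z = ?f + (\<Sum>i=1..l. var (Y i) * F (X i))" by (simp add: contact_form_def)
  also have "\<dots> = contact_field l ?f Z"
    using FX by (simp add: contact_field_def flip: sum_negf)
  finally have FZ: "F Z = contact_field l ?f Z" .
  show "F = contact_field l ?f"
  proof
    fix c show "F c = contact_field l ?f c"
    proof (cases "c \<in> coords l")
      case False
      then show ?thesis using vF by (cases c) (auto simp: vector_fields_eq contact_field_def)
    next
      case True
      then show ?thesis using FX FY FZ by (cases c) (auto simp: contact_field_def)
    qed
  qed
next
  assume vF: "F \<in> vector_fields l" and F: "F = contact_field l (contact_form l F)"
  let ?f = "contact_form l F"
  have FY: "F (Y i) = partial_deriv (X i) ?f + var (Y i) * partial_deriv Z ?f"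
    and FX: "F (X i) = - partial_deriv (Y i) ?f" if "i \<in> {1..l}" for i
    using that by (subst F, simp add: contact_field_def)+
  have "contact_form l (field_bracket l F G) = 0" if "contact_form l G = 0" for G
    unfolding contact_form_bracket_horizontal[OF that]
    by (rule sum.neutral) (use FX FY in auto)
  then show "F \<in> contact_fields l"
    using vF by (auto simp: contact_fields_def contact_distribution_def vector_fields_bracket)
qed

lemma contact_field_in_contact_fields:
  "f \<in> polynomials_on (coords l) \<Longrightarrow> contact_field l f \<in> contact_fields l"
  by (simp add: contact_fields_iff contact_field_in_vector_fields)

lemma contact_fields_eqI:
  "F \<in> contact_fields l \<Longrightarrow> G \<in> contact_fields l \<Longrightarrow> contact_form l F = contact_form l G \<Longrightarrow> F = G"
  by (metis contact_fields_iff)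

lemma contact_fields_0: "0 \<in> contact_fields l"
  and contact_fields_add: "F \<in> contact_fields l \<Longrightarrow> G \<in> contact_fields l \<Longrightarrow> F + G \<in> contact_fields l"
  and contact_fields_scale: "F \<in> contact_fields l \<Longrightarrow> (\<lambda>c. const a * F c) \<in> contact_fields l"
  by (simp_all add: contact_fields_iff vector_fields_0 vector_fields_add vector_fields_scale
      contact_form_add contact_form_scale contact_field_add contact_field_scale)

lemma contact_fields_bracket:
  assumes F: "F \<in> contact_fields l" and G: "G \<in> contact_fields l"
  shows "field_bracket l F G \<in> contact_fields l"
proof -
  have vFG: "F \<in> vector_fields l" "G \<in> vector_fields l"
    using F G by (simp_all add: contact_fields_def)
  have "field_bracket l (field_bracket l F G) H \<in> contact_distribution l"
    if H: "H \<in> contact_distribution l" for H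
  proof -
    have "field_bracket l (field_bracket l F G) H =
        field_bracket l F (field_bracket l G H) - field_bracket l G (field_bracket l F H)"
      by (rule ext) (simp add: field_bracket_eq field_deriv_field_bracket field_deriv_diff)
    moreover have "field_bracket l F (field_bracket l G H) \<in> contact_distribution l"
      "field_bracket l G (field_bracket l F H) \<in> contact_distribution l"
      using F G H by (auto simp: contact_fields_def)
    ultimately show ?thesis
      by (auto simp: contact_distribution_def contact_form_diff vector_fields_diff)
  qed
  then show ?thesis using vFG by (simp add: contact_fields_def vector_fields_bracket)
qed

text \<open>
  The three kinds of fields of negative degree, \<open>\<partial>/\<partial>z\<close>, \<open>\<partial>/\<partial>x\<^sub>i\<close> and \<open>\<partial>/\<partial>y\<^sub>i + x\<^sub>i \<partial>/\<partial>z\<close>, have the generating functions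
  \<open>1\<close>, \<open>-y\<^sub>i\<close> and \<open>x\<^sub>i\<close>. On generating functions they act as the differential operators that they are.
\<close>

lemma contact_form_bracket_Z:
  "contact_form l (field_bracket l (contact_field l 1) G) = partial_deriv Z (contact_form l G)"
  unfolding contact_form_bracket contact_form_contact_field
  by (simp add: field_deriv_def sum_coords) (simp add: contact_field_def)

lemma contact_form_bracket_X:
  assumes i: "i \<in> {1..l}"
  shows "contact_form l (field_bracket l (contact_field l (- var (Y i))) G) =
    partial_deriv (X i) (contact_form l G)"
  unfolding contact_form_bracket contact_form_contact_field using i
  by (simp add: field_deriv_minus field_deriv_var)
     (simp add: field_deriv_def sum_coords contact_field_def partial_deriv_minus partial_deriv_var
       if_distrib[of "\<lambda>x. x * _"] if_distrib[of "\<lambda>x. _ * x"] if_distrib[of "\<lambda>x. - x"] cong: if_cong)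

lemma contact_form_bracket_Y:
  assumes i: "i \<in> {1..l}"
  shows "contact_form l (field_bracket l (contact_field l (var (X i))) G) =
    partial_deriv (Y i) (contact_form l G) + var (X i) * partial_deriv Z (contact_form l G)"
  unfolding contact_form_bracket contact_form_contact_field using i
  by (simp add: field_deriv_minus field_deriv_var)
     (simp add: field_deriv_def sum_coords contact_field_def partial_deriv_minus partial_deriv_var sum_negf
       if_distrib[of "\<lambda>x. x * _"] if_distrib[of "\<lambda>x. _ * x"] if_distrib[of "\<lambda>x. - x"] cong: if_cong)

section \<open>Graded Lie algebras\<close>

context graded_lie_algebra
begin

lemma carrier_subspace: "subspace (carrier L)"
  by (simp add: carrier_sum)

lemma part_in_carrier: "x \<in> part L p \<Longrightarrow> x \<in> carrier L"
  unfolding carrier_sum by (rule span_base) blast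

lemma part_0 [simp]: "0 \<in> part L p"
  using part_subspace by (rule subspace_0)

lemma carrier_induct [consumes 1, case_names zero part add]:
  assumes "x \<in> carrier L"
    and "P 0"
    and "\<And>p x. x \<in> part L p \<Longrightarrow> P x"
    and "\<And>x y. x \<in> carrier L \<Longrightarrow> y \<in> carrier L \<Longrightarrow> P x \<Longrightarrow> P y \<Longrightarrow> P (x + y)"
  shows "P x"
proof -
  have "x \<in> carrier L \<and> P x"
    using assms(1) unfolding carrier_sum
  proof (induction rule: span_induct_alt)
    case base
    then show ?case using assms(2) by (simp add: span_zero)
  next
    case (step c x y)
    then obtain p where "scl L c x \<in> part L p"
      using subspace_scale[OF part_subspace] by blast
    then show ?case
      using step assms(3,4) part_in_carrier subspace_add[OF carrier_subspace]
      unfolding carrier_sum by blast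
  qed
  then show ?thesis by simp
qed

lemma brk_zero_left: "a \<in> carrier L \<Longrightarrow> brk L 0 a = 0"
  and brk_zero_right: "a \<in> carrier L \<Longrightarrow> brk L a 0 = 0"
  using brk_scl_left[of 0 a 0] brk_scl_right[of a 0 0] subspace_0[OF carrier_subspace] by simp_all

lemma brk_closed:
  assumes "a \<in> carrier L" "b \<in> carrier L"
  shows "brk L a b \<in> carrier L"
  using assms(1)
proof (induction rule: carrier_induct)
  case zero
  then show ?case using assms(2) subspace_0[OF carrier_subspace] by (simp add: brk_zero_left)
next
  case (part p x)
  show ?case
    using assms(2)
  proof (induction rule: carrier_induct)
    case zero
    then show ?case
      using part subspace_0[OF carrier_subspace] by (simp add: brk_zero_right part_in_carrier)
  next
    case (part q y)
    then show ?case using brk_graded[OF \<open>x \<in> part L p\<close>] part_in_carrier by blast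
  next
    case (add y z)
    then show ?case
      using part part_in_carrier by (simp add: brk_add_right subspace_add[OF carrier_subspace])
  qed
next
  case (add x y)
  then show ?case using assms(2) by (simp add: brk_add_left subspace_add[OF carrier_subspace])
qed

lemma brk_skew:
  assumes "a \<in> carrier L" "b \<in> carrier L"
  shows "brk L b a = - brk L a b"
proof -
  have "a + b \<in> carrier L" using assms subspace_add[OF carrier_subspace] by blast
  then have "brk L (a + b) (a + b) = 0" by (rule brk_alternating)
  moreover have "brk L (a + b) (a + b) = brk L a b + brk L b a"
    using assms brk_add_left[OF assms \<open>a + b \<in> carrier L\<close>] brk_add_right[OF assms(1) assms]
      brk_add_right[OF assms(2) assms]
    by (simp add: brk_alternating)
  ultimately have "brk L a b + brk L b a = 0" by simp
  then show ?thesis by (simp add: eq_neg_iff_add_eq_0 add.commute)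
qed

lemma brk_minus_right: "a \<in> carrier L \<Longrightarrow> b \<in> carrier L \<Longrightarrow> brk L a (- b) = - brk L a b"
  using brk_scl_right[of a b "-1"] by simp

lemma brk_derivation:
  assumes "a \<in> carrier L" "b \<in> carrier L" "c \<in> carrier L"
  shows "brk L a (brk L b c) = brk L (brk L a b) c + brk L b (brk L a c)"
  using jacobi[OF assms] brk_skew[OF assms(1,3)] brk_skew[OF brk_closed[OF assms(1,2)] assms(3)]
    brk_minus_right[OF assms(2) brk_closed[OF assms(1,3)]]
  by (simp add: algebra_simps eq_neg_iff_add_eq_0)

lemma span_parts_decompose:
  assumes "s \<in> span (\<Union>p\<in>P. part L p)"
  obtains I x where "finite I" "\<And>p. x p \<in> part L p" "\<And>p. p \<notin> I \<inter> P \<Longrightarrow> x p = 0" "s = (\<Sum>p\<in>I. x p)"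
proof -
  have "\<exists>I x. finite I \<and> (\<forall>p. x p \<in> part L p) \<and> (\<forall>p. p \<notin> I \<inter> P \<longrightarrow> x p = 0) \<and> s = (\<Sum>p\<in>I. x p)"
    using assms
  proof (induction rule: span_induct_alt)
    case base
    show ?case by (rule exI[of _ "{}"], rule exI[of _ "\<lambda>_. 0"]) simp
  next
    case (step c y s)
    then obtain q I x where q: "q \<in> P" "y \<in> part L q" and x: "finite I" "\<forall>p. x p \<in> part L p"
      "\<forall>p. p \<notin> I \<inter> P \<longrightarrow> x p = 0" "s = (\<Sum>p\<in>I. x p)"
      by blast
    define x' where "x' = x(q := scl L c y + x q)"
    have "sum x' (insert q I) = x' q + sum x' (I - {q})" by (simp add: sum.insert_remove x(1))
    also have "sum x' (I - {q}) = sum x (I - {q})" by (rule sum.cong) (auto simp: x'_def)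
    also have "x' q + sum x (I - {q}) = scl L c y + sum x (insert q I)"
      by (simp add: sum.insert_remove x(1) x'_def add.assoc)
    also have "sum x (insert q I) = s"
      using x q by (cases "q \<in> I") (auto simp: insert_absorb)
    finally have "scl L c y + s = sum x' (insert q I)" ..
    moreover have "\<forall>p. x' p \<in> part L p"
      using x(2) q(2) part_subspace subspace_add subspace_scale by (auto simp: x'_def)
    moreover have "\<forall>p. p \<notin> insert q I \<inter> P \<longrightarrow> x' p = 0"
      using x(3) q(1) by (auto simp: x'_def)
    ultimately show ?case using x(1) by (metis finite_insert)
  qed
  then show ?thesis using that by blast
qed

text \<open>
  Otherwise \<open>-x\<close>, placed in degree \<open>q\<close>, would complete a decomposition of \<open>x\<close> to a nontrivial relation between
  homogeneous elements.
\<close>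

lemma part_inter_span_other_parts:
  assumes "x \<in> part L q" "x \<in> span (\<Union>p\<in>- {q}. part L p)"
  shows "x = 0"
proof -
  obtain I y where I: "finite I" "\<And>p. y p \<in> part L p" "\<And>p. p \<notin> I \<inter> - {q} \<Longrightarrow> y p = 0" "x = (\<Sum>p\<in>I. y p)"
    using span_parts_decompose[OF assms(2)] by blast
  define z where "z = y(q := - x)"
  have "sum z (insert q I) = z q + sum z (I - {q})" by (simp add: sum.insert_remove I(1))
  also have "sum z (I - {q}) = sum y (I - {q})" by (rule sum.cong) (auto simp: z_def)
  also have "sum y (I - {q}) = x"
    using I by (cases "q \<in> I") (simp_all add: sum.remove)
  finally have "sum z (insert q I) = 0" by (simp add: z_def)
  moreover have "z p \<in> part L p" for p
    using I(2) assms(1) subspace_neg[OF part_subspace] by (auto simp: z_def)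
  ultimately have "z q = 0" using parts_independent[of "insert q I" z q] I(1) by blast
  then show ?thesis by (simp add: z_def)
qed

end

section \<open>The contact algebra\<close>

lemma monomial_weight_superset:
  assumes "finite A" "Poly_Mapping.keys m \<subseteq> A"
  shows "monomial_weight m = (\<Sum>c\<in>A. Poly_Mapping.lookup m c * weight c)"
  unfolding monomial_weight_def using assms
  by (intro sum.mono_neutral_left) (auto simp: in_keys_iff)

lemma monomial_weight_add: "monomial_weight (m + n) = monomial_weight m + monomial_weight n"
proof -
  let ?A = "Poly_Mapping.keys m \<union> Poly_Mapping.keys n"
  have "Poly_Mapping.keys (m + n) \<subseteq> ?A" by (rule Poly_Mapping.keys_add)
  then show ?thesis
    using monomial_weight_superset[of ?A m] monomial_weight_superset[of ?A n]
      monomial_weight_superset[of ?A "m + n"]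
    by (simp add: lookup_add distrib_right sum.distrib)
qed

lemma monomial_weight_single [simp]: "monomial_weight (Poly_Mapping.single c k) = k * weight c"
  by (simp add: monomial_weight_def)

lemma monomial_weight_0 [simp]: "monomial_weight 0 = 0"
  by (simp add: monomial_weight_def)

lemma weight_pos: "0 < weight c"
  by (cases c) auto

lemma lookup_le_monomial_weight: "Poly_Mapping.lookup m c \<le> monomial_weight m"
proof (cases "c \<in> Poly_Mapping.keys m")
  case True
  have "Poly_Mapping.lookup m c \<le> Poly_Mapping.lookup m c * weight c" using weight_pos[of c] by simp
  also have "\<dots> \<le> monomial_weight m"
    unfolding monomial_weight_def by (rule member_le_sum[OF True]) auto
  finally show ?thesis .
qed (simp add: in_keys_iff)

lemma monomial_weight_eq_0: "monomial_weight m = 0 \<longleftrightarrow> m = 0"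
proof
  assume "monomial_weight m = 0"
  then show "m = 0" using lookup_le_monomial_weight[of m] by (intro poly_mapping_eqI) simp
qed simp

lemma monomial_split:
  assumes "Poly_Mapping.lookup m c \<noteq> 0"
  obtains n where "m = n + Poly_Mapping.single c (1::nat)"
proof
  show "m = (m - Poly_Mapping.single c 1) + Poly_Mapping.single c 1"
    using assms by (intro poly_mapping_eqI) (auto simp: lookup_add lookup_minus lookup_single when_def)
qed

lemma monomial_weight_eq_1:
  assumes "monomial_weight m = 1"
  obtains c where "m = Poly_Mapping.single c 1" "weight c = 1"
proof -
  obtain c where "Poly_Mapping.lookup m c \<noteq> 0"
    using assms monomial_weight_eq_0[of m] by (metis lookup_zero poly_mapping_eqI zero_neq_one)
  then obtain n where n: "m = n + Poly_Mapping.single c 1" by (rule monomial_split)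
  then have "monomial_weight n + weight c = 1" using assms by (simp add: monomial_weight_add)
  then have "weight c = 1" "monomial_weight n = 0" using weight_pos[of c] by auto
  then show ?thesis using that[of c] n by (simp add: monomial_weight_eq_0)
qed

definition homogeneous :: "int \<Rightarrow> polynomial \<Rightarrow> bool"
  where "homogeneous k f \<longleftrightarrow> (\<forall>m\<in>Poly_Mapping.keys f. int (monomial_weight m) = k)"

lemma homogeneous_0 [simp]: "homogeneous k 0"
  and homogeneous_add: "homogeneous k f \<Longrightarrow> homogeneous k g \<Longrightarrow> homogeneous k (f + g)"
  and homogeneous_minus: "homogeneous k f \<Longrightarrow> homogeneous k (- f)"
  and homogeneous_diff: "homogeneous k f \<Longrightarrow> homogeneous k g \<Longrightarrow> homogeneous k (f - g)"
  using Poly_Mapping.keys_add[of f g] keys_diff[of f g]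
  by (auto simp: homogeneous_def)

lemma homogeneous_sum: "(\<And>a. a \<in> A \<Longrightarrow> homogeneous k (f a)) \<Longrightarrow> homogeneous k (sum f A)"
  by (induction A rule: infinite_finite_induct) (simp_all add: homogeneous_add)

lemma homogeneous_mult:
  assumes "homogeneous j f" "homogeneous k g" "i = j + k"
  shows "homogeneous i (f * g)"
  using assms keys_mult[of f g] by (fastforce simp: homogeneous_def monomial_weight_add)

lemma homogeneous_const_mult: "homogeneous k f \<Longrightarrow> homogeneous k (const a * f)"
  by (rule homogeneous_mult[of 0]) (simp_all add: homogeneous_def)

lemma homogeneous_var: "homogeneous (int (weight c)) (var c)"
  by (simp add: homogeneous_def var_def)

lemma homogeneous_partial_deriv:
  assumes "homogeneous k f" "j = k - int (weight c)"
  shows "homogeneous j (partial_deriv c f)"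
  unfolding homogeneous_def
proof
  fix m assume "m \<in> Poly_Mapping.keys (partial_deriv c f)"
  then have "m + Poly_Mapping.single c 1 \<in> Poly_Mapping.keys f"
    by (auto simp: in_keys_iff lookup_partial_deriv)
  then have "int (monomial_weight (m + Poly_Mapping.single c 1)) = k"
    using assms(1) by (auto simp: homogeneous_def)
  then show "int (monomial_weight m) = j" using assms(2) by (simp add: monomial_weight_add)
qed

lemma contact_algebra_simps [simp]:
  "carrier (contact_algebra l) = contact_fields l"
  "scl (contact_algebra l) = (\<lambda>k F c. const k * F c)"
  "brk (contact_algebra l) = field_bracket l"
  by (simp_all add: contact_algebra_def)

lemma part_contact_algebra:
  "part (contact_algebra l) p = {F \<in> contact_fields l. \<forall>c. homogeneous (p + int (weight c)) (F c)}"
  by (simp add: contact_algebra_def homogeneous_def diff_eq_eq)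

text \<open>
  The contact form has weight 2, so a field of degree \<open>p\<close> has a generating function of weight \<open>p + 2\<close>.
\<close>

lemma part_contact_algebra_iff:
  "F \<in> part (contact_algebra l) p \<longleftrightarrow> F \<in> contact_fields l \<and> homogeneous (p + 2) (contact_form l F)"
proof safe
  assume "F \<in> part (contact_algebra l) p"
  then show "F \<in> contact_fields l" and "homogeneous (p + 2) (contact_form l F)"
    unfolding part_contact_algebra contact_form_def
    by (auto intro!: homogeneous_diff homogeneous_sum homogeneous_mult[OF homogeneous_var]
        dest: spec[of _ Z] spec[of _ "X _"])
next
  assume F: "F \<in> contact_fields l" and f: "homogeneous (p + 2) (contact_form l F)"
  have "homogeneous (p + int (weight c)) (contact_field l (contact_form l F) c)" for c
    using f by (cases c)
      (auto simp: contact_field_def intro!: homogeneous_add homogeneous_minus homogeneous_diff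
        homogeneous_sum homogeneous_mult[OF homogeneous_var] homogeneous_partial_deriv[OF f])
  then show "F \<in> part (contact_algebra l) p"
    unfolding part_contact_algebra using F contact_fields_iff[of F l] by auto
qed

lemma contact_field_in_part:
  assumes "f \<in> polynomials_on (coords l)" "homogeneous (p + 2) f"
  shows "contact_field l f \<in> part (contact_algebra l) p"
  using assms by (simp add: part_contact_algebra_iff contact_field_in_contact_fields)

lemma vector_space_vector_fields: "vector_space (\<lambda>k (F :: vector_field) c. const k * F c)"
  by unfold_locales (auto simp: fun_eq_iff algebra_simps single_add mult_single)

interpretation vector_fields: vector_space "\<lambda>k (F :: vector_field) c. const k * F c"
  by (rule vector_space_vector_fields)

lemma contact_field_sum: "contact_field l (sum f A) = (\<Sum>a\<in>A. contact_field l (f a))"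
  by (induction A rule: infinite_finite_induct) (simp_all add: contact_field_add)

lemma contact_field_span:
  assumes F: "F \<in> contact_fields l" and S: "Poly_Mapping.keys (contact_form l F) \<subseteq> S"
  shows "F \<in> vector_fields.span ((\<lambda>m. contact_field l (Poly_Mapping.single m 1)) ` S)"
proof -
  let ?f = "contact_form l F"
  have "contact_field l ?f = (\<Sum>m\<in>Poly_Mapping.keys ?f.
      contact_field l (const (Poly_Mapping.lookup ?f m) * Poly_Mapping.single m 1))"
    by (subst polynomial_eq_sum_singles) (simp add: contact_field_sum mult_single)
  also have "\<dots> \<in> vector_fields.span ((\<lambda>m. contact_field l (Poly_Mapping.single m 1)) ` S)"
    unfolding contact_field_scale
    using S by (intro vector_fields.span_sum vector_fields.span_scale vector_fields.span_base) auto
  finally show ?thesis using F by (simp add: contact_fields_iff)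
qed

lemma keys_contact_form:
  assumes "F \<in> contact_fields l" "m \<in> Poly_Mapping.keys (contact_form l F)"
  shows "Poly_Mapping.keys m \<subseteq> coords l"
  using assms contact_form_in_polynomials_on[of F l]
  by (auto simp: contact_fields_def polynomials_on_def)

lemma sum_vector_field_apply: "(sum x I :: vector_field) c = (\<Sum>p\<in>I. x p c)"
  by (induction I rule: infinite_finite_induct) simp_all

text \<open>
  The contact fields of monomials are homogeneous, and so the homogeneous parts span. They are independent,
  because the degree of a term of a field can be read off from its monomial and its coordinate.
\<close>

lemma graded_lie_algebra_contact: "graded_lie_algebra (contact_algebra l)"
proof (intro graded_lie_algebra.intro graded_lie_algebra_axioms.intro, unfold contact_algebra_simps)
  show "vector_space (\<lambda>k (F :: vector_field) c. const k * F c)" by (rule vector_space_vector_fields)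
  show sub: "vector_fields.subspace (part (contact_algebra l) p)" for p
    unfolding vector_fields.subspace_def
    by (auto simp: part_contact_algebra_iff contact_fields_0 contact_fields_add contact_fields_scale
        contact_form_add contact_form_scale homogeneous_add homogeneous_const_mult)
  have cs: "vector_fields.subspace (contact_fields l)"
    unfolding vector_fields.subspace_def
    by (auto simp: contact_fields_0 contact_fields_add contact_fields_scale)
  show "contact_fields l = vector_fields.span (\<Union>p. part (contact_algebra l) p)"
  proof
    show "vector_fields.span (\<Union>p. part (contact_algebra l) p) \<subseteq> contact_fields l"
      by (rule vector_fields.span_minimal[OF _ cs]) (auto simp: part_contact_algebra_iff)
    show "contact_fields l \<subseteq> vector_fields.span (\<Union>p. part (contact_algebra l) p)"
    proof
      fix F assume F: "F \<in> contact_fields l"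
      let ?S = "Poly_Mapping.keys (contact_form l F)"
      have "contact_field l (Poly_Mapping.single m 1) \<in> part (contact_algebra l) (int (monomial_weight m) - 2)"
        if "m \<in> ?S" for m
        using keys_contact_form[OF F that]
        by (intro contact_field_in_part) (auto simp: polynomials_on_def homogeneous_def)
      then have "(\<lambda>m. contact_field l (Poly_Mapping.single m 1)) ` ?S \<subseteq> (\<Union>p. part (contact_algebra l) p)"
        by blast
      then show "F \<in> vector_fields.span (\<Union>p. part (contact_algebra l) p)"
        using contact_field_span[OF F subset_refl] vector_fields.span_mono by blast
    qed
  qed
  show "x q = 0" if I: "finite I" and x: "\<And>p. p \<in> I \<Longrightarrow> x p \<in> part (contact_algebra l) p"
    and s: "(\<Sum>p\<in>I. x p) = 0" and q: "q \<in> I" for I q and x :: "int \<Rightarrow> vector_field"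
  proof (intro ext poly_mapping_eqI)
    fix c m
    have zero: "Poly_Mapping.lookup (x p c) m = 0"
      if "p \<in> I" "p \<noteq> int (monomial_weight m) - int (weight c)" for p
      using that x[OF that(1)] by (force simp: part_contact_algebra homogeneous_def in_keys_iff)
    have "(\<Sum>p\<in>I. x p c) = 0" using s by (metis sum_vector_field_apply zero_fun_apply)
    then have sum0: "(\<Sum>p\<in>I. Poly_Mapping.lookup (x p c) m) = 0" by (metis lookup_sum lookup_zero)
    show "Poly_Mapping.lookup (x q c) m = Poly_Mapping.lookup (0 c) m"
    proof (cases "q = int (monomial_weight m) - int (weight c)")
      case True
      have "(\<Sum>p\<in>I. Poly_Mapping.lookup (x p c) m) = (\<Sum>p\<in>{q}. Poly_Mapping.lookup (x p c) m)"
        using I q zero True by (intro sum.mono_neutral_right) auto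
      then show ?thesis using sum0 by simp
    qed (simp add: zero q)
  qed
  show "field_bracket l a b \<in> part (contact_algebra l) (p + q)"
    if a: "a \<in> part (contact_algebra l) p" and b: "b \<in> part (contact_algebra l) q" for a b p q
  proof -
    have ab: "a \<in> contact_fields l" "b \<in> contact_fields l"
      "homogeneous (p + int (weight c)) (a c)" "homogeneous (q + int (weight c)) (b c)" for c
      using a b by (simp_all add: part_contact_algebra)
    have "homogeneous (p + q + int (weight c)) (a d * partial_deriv d (b c))"
      "homogeneous (p + q + int (weight c)) (b d * partial_deriv d (a c))" for c d
      by (rule homogeneous_mult[OF ab(3) homogeneous_partial_deriv[OF ab(4) refl]],
          simp, rule homogeneous_mult[OF ab(4) homogeneous_partial_deriv[OF ab(3) refl]], simp)
    then have "homogeneous (p + q + int (weight c)) (field_bracket l a b c)" for c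
      unfolding field_bracket_eq field_deriv_def
      by (intro homogeneous_diff homogeneous_sum)
    then show ?thesis using ab contact_fields_bracket by (simp add: part_contact_algebra)
  qed
qed (simp_all add: field_bracket_add_left field_bracket_add_right field_bracket_scale_left
    field_bracket_scale_right field_bracket_self field_bracket_jacobi)

lemma finite_monomials: "finite {m. Poly_Mapping.keys m \<subseteq> coords l \<and> monomial_weight m \<le> n}"
proof -
  have "finite {f. \<forall>c. (c \<in> coords l \<longrightarrow> f c \<in> {..n}) \<and> (c \<notin> coords l \<longrightarrow> f c = (0::nat))}"
    by (rule finite_set_of_finite_funs) auto
  moreover have "Poly_Mapping.lookup ` {m. Poly_Mapping.keys m \<subseteq> coords l \<and> monomial_weight m \<le> n} \<subseteq>
      {f. \<forall>c. (c \<in> coords l \<longrightarrow> f c \<in> {..n}) \<and> (c \<notin> coords l \<longrightarrow> f c = (0::nat))}"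
    by (auto simp: in_keys_iff subset_iff intro: le_trans[OF lookup_le_monomial_weight])
  ultimately have "finite (Poly_Mapping.lookup ` {m. Poly_Mapping.keys m \<subseteq> coords l \<and> monomial_weight m \<le> n})"
    by (rule rev_finite_subset)
  then show ?thesis
    by (rule finite_imageD) (auto intro!: inj_onI poly_mapping_eqI)
qed

lemma fin_dim_part_contact: "fin_dim (scl (contact_algebra l)) (part (contact_algebra l) p)"
proof -
  let ?S = "{m. Poly_Mapping.keys m \<subseteq> coords l \<and> monomial_weight m \<le> nat (p + 2)}"
  have "part (contact_algebra l) p \<subseteq>
      vector_fields.span ((\<lambda>m. contact_field l (Poly_Mapping.single m 1)) ` ?S)"
  proof
    fix F assume "F \<in> part (contact_algebra l) p"
    then have F: "F \<in> contact_fields l" and hom: "homogeneous (p + 2) (contact_form l F)"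
      by (simp_all add: part_contact_algebra_iff)
    have "Poly_Mapping.keys (contact_form l F) \<subseteq> ?S"
      using keys_contact_form[OF F] hom by (fastforce simp: homogeneous_def)
    then show "F \<in> vector_fields.span ((\<lambda>m. contact_field l (Poly_Mapping.single m 1)) ` ?S)"
      by (rule contact_field_span[OF F])
  qed
  moreover have "finite ((\<lambda>m. contact_field l (Poly_Mapping.single m 1)) ` ?S)"
    using finite_monomials by blast
  ultimately show ?thesis unfolding fin_dim_def contact_algebra_simps by blast
qed

lemma constant_if_partial_derivs_0:
  assumes "f \<in> polynomials_on S" "\<And>c. c \<in> S \<Longrightarrow> partial_deriv c f = 0" "m \<in> Poly_Mapping.keys f"
  shows "m = 0"
proof (rule ccontr)
  assume "m \<noteq> 0"
  then obtain c where c: "Poly_Mapping.lookup m c \<noteq> 0" by (metis lookup_zero poly_mapping_eqI)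
  then obtain n where n: "m = n + Poly_Mapping.single c 1" by (rule monomial_split)
  have "c \<in> S" using assms(1,3) c by (auto simp: polynomials_on_def in_keys_iff subset_iff)
  then have "Poly_Mapping.lookup (partial_deriv c f) n = 0" by (simp add: assms(2))
  then have "(of_nat (Poly_Mapping.lookup n c + 1) :: complex) * Poly_Mapping.lookup f m = 0"
    unfolding lookup_partial_deriv n by simp
  then have "Poly_Mapping.lookup f m = 0" by (simp del: of_nat_add of_nat_Suc)
  then show False using assms(3) by (simp add: in_keys_iff)
qed

lemma linear_polynomial_eqI:
  assumes "f \<in> polynomials_on S" "g \<in> polynomials_on S"
    and "homogeneous 1 f" "homogeneous 1 g"
    and "\<And>c. c \<in> S \<Longrightarrow> partial_deriv c f = partial_deriv c g"
  shows "f = g"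
proof -
  have "m = 0" if "m \<in> Poly_Mapping.keys (f - g)" for m
    using constant_if_partial_derivs_0[OF polynomials_on_diff[OF assms(1,2)] _ that] assms(5)
    by (simp add: partial_deriv_diff)
  moreover have "homogeneous 1 (f - g)" using assms(3,4) by (rule homogeneous_diff)
  ultimately have "Poly_Mapping.keys (f - g) = {}" by (fastforce simp: homogeneous_def)
  then show ?thesis by simp
qed

text \<open>
  A field \<open>F\<close> that commutes with \<open>\<partial>/\<partial>x\<^sub>i\<close> and \<open>\<partial>/\<partial>y\<^sub>i + x\<^sub>i \<partial>/\<partial>z\<close> commutes with their bracket \<open>\<partial>/\<partial>z\<close>; this is where
  \<open>l\<close> has to be positive. All partial derivatives of the generating function are then zero, so it is a
  constant. Its weight \<open>p + 2\<close> is positive, and so it is zero.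
\<close>

lemma contact_transitive:
  assumes l: "1 \<le> l" and p: "-1 \<le> p" and F: "F \<in> part (contact_algebra l) p"
    and X: "\<And>i. i \<in> {1..l} \<Longrightarrow> field_bracket l F (contact_field l (- var (Y i))) = 0"
    and Y: "\<And>i. i \<in> {1..l} \<Longrightarrow> field_bracket l F (contact_field l (var (X i))) = 0"
  shows "F = 0"
proof -
  let ?f = "contact_form l F"
  have F': "F \<in> contact_fields l" "homogeneous (p + 2) ?f"
    using F by (simp_all add: part_contact_algebra_iff)
  have X0: "partial_deriv (X i) ?f = 0" if "i \<in> {1..l}" for i
    using contact_form_bracket_X[OF that, of F] field_bracket_swap[of l _ F] X[OF that] by simp
  have Y0: "partial_deriv (Y i) ?f + var (X i) * partial_deriv Z ?f = 0" if "i \<in> {1..l}" for i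
    using contact_form_bracket_Y[OF that, of F] field_bracket_swap[of l _ F] Y[OF that] by simp
  have Z0: "partial_deriv Z ?f = 0"
  proof -
    have i: "1 \<in> {1..l}" using l by simp
    have "partial_deriv (X 1) (partial_deriv (Y 1) ?f + var (X 1) * partial_deriv Z ?f) = 0"
      using Y0[OF i] by simp
    moreover have "partial_deriv (X 1) (partial_deriv c ?f) = 0" for c
      unfolding partial_deriv_commute[of "X 1"] X0[OF i] by simp
    ultimately show ?thesis
      by (simp add: partial_deriv_add partial_deriv_mult partial_deriv_var)
  qed
  have "partial_deriv c ?f = 0" if "c \<in> coords l" for c
    using that X0 Y0 Z0 by (cases c) auto
  then have "m = 0" if "m \<in> Poly_Mapping.keys ?f" for m
    using constant_if_partial_derivs_0[OF _ _ that] contact_form_in_polynomials_on F'(1)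
    by (auto simp: contact_fields_def)
  then have "Poly_Mapping.keys ?f = {}"
    using F'(2) p by (fastforce simp: homogeneous_def)
  then have "?f = 0" by simp
  then show ?thesis using F'(1) contact_fields_iff[of F l] by simp
qed

lemma part_contact_below: "p < -2 \<Longrightarrow> part (contact_algebra l) p = {0}"
proof -
  assume p: "p < -2"
  have "F = 0" if "F \<in> part (contact_algebra l) p" for F
  proof -
    have "Poly_Mapping.keys (contact_form l F) = {}"
      using that p by (fastforce simp: part_contact_algebra_iff homogeneous_def)
    then show ?thesis using that contact_fields_iff[of F l] by (simp add: part_contact_algebra_iff)
  qed
  then show ?thesis by (auto simp: part_contact_algebra_iff contact_fields_0)
qed

lemma part_contact_minus_2: "part (contact_algebra l) (-2) \<subseteq> vector_fields.span {contact_field l 1}"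
proof
  fix F assume F: "F \<in> part (contact_algebra l) (-2)"
  then have "Poly_Mapping.keys (contact_form l F) \<subseteq> {0}"
    by (auto simp: part_contact_algebra_iff homogeneous_def monomial_weight_eq_0)
  then have "F \<in> vector_fields.span ((\<lambda>m. contact_field l (Poly_Mapping.single m 1)) ` {0})"
    using F by (intro contact_field_span) (auto simp: part_contact_algebra_iff)
  then show "F \<in> vector_fields.span {contact_field l 1}" by simp
qed

lemma part_contact_minus_1:
  "part (contact_algebra l) (-1) \<subseteq> vector_fields.span
    ((\<lambda>i. contact_field l (- var (Y i))) ` {1..l} \<union> (\<lambda>i. contact_field l (var (X i))) ` {1..l})"
    (is "_ \<subseteq> vector_fields.span ?B")
proof
  fix F assume F: "F \<in> part (contact_algebra l) (-1)"
  have "contact_field l (Poly_Mapping.single m 1) \<in> vector_fields.span ?B"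
    if m: "m \<in> Poly_Mapping.keys (contact_form l F)" for m
  proof -
    have "monomial_weight m = 1"
      using F m by (auto simp: part_contact_algebra_iff homogeneous_def)
    then obtain c where c: "m = Poly_Mapping.single c 1" "weight c = 1"
      by (rule monomial_weight_eq_1)
    have mem: "c \<in> coords l"
      using keys_contact_form[OF _ m] F c by (auto simp: part_contact_algebra_iff)
    have eq: "contact_field l (Poly_Mapping.single m 1) = contact_field l (var c)"
      using c by (simp add: var_def)
    show ?thesis
    proof (cases c)
      case (X i)
      then show ?thesis using mem eq by (auto intro!: vector_fields.span_base)
    next
      case (Y i)
      have "contact_field l (var c) = (\<lambda>d. const (-1) * contact_field l (- var (Y i)) d)"
        using Y contact_field_scale[of l "-1" "- var c"] by (simp add: single_uminus)
      also have "\<dots> \<in> vector_fields.span ?B"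
        using mem Y by (intro vector_fields.span_scale vector_fields.span_base) auto
      finally show ?thesis using eq by simp
    qed (use c in auto)
  qed
  then have "vector_fields.span ((\<lambda>m. contact_field l (Poly_Mapping.single m 1)) `
      Poly_Mapping.keys (contact_form l F)) \<subseteq> vector_fields.span ?B"
    by (intro vector_fields.span_minimal) auto
  then show "F \<in> vector_fields.span ?B"
    using contact_field_span[OF _ subset_refl, of F l] F by (auto simp: part_contact_algebra_iff)
qed

section \<open>Embedding transitive prolongations of the Heisenberg algebra\<close>

text \<open>
  A transitive graded Lie algebra whose negative part is the Heisenberg algebra with basis \<open>a\<^sub>i, b\<^sub>i, e\<close>. The
  brackets and \<open>e \<noteq> 0\<close> imply that these elements are independent.
\<close>

locale heisenberg_prolongation = graded_lie_algebra L
  for L :: "'a::ab_group_add graded_lie" +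
  fixes l :: nat and a b :: "nat \<Rightarrow> 'a" and e :: 'a
  assumes l_pos: "1 \<le> l"
    and a_part: "i \<in> {1..l} \<Longrightarrow> a i \<in> part L (-1)"
    and b_part: "i \<in> {1..l} \<Longrightarrow> b i \<in> part L (-1)"
    and e_part: "e \<in> part L (-2)"
    and e_nonzero: "e \<noteq> 0"
    and part_below: "p < -2 \<Longrightarrow> part L p = {0}"
    and part_minus_2: "part L (-2) \<subseteq> span {e}"
    and part_minus_1: "part L (-1) \<subseteq> span (a ` {1..l} \<union> b ` {1..l})"
    and brk_a_b: "i \<in> {1..l} \<Longrightarrow> j \<in> {1..l} \<Longrightarrow> brk L (a i) (b j) = (if i = j then e else 0)"
    and brk_a_a: "i \<in> {1..l} \<Longrightarrow> j \<in> {1..l} \<Longrightarrow> brk L (a i) (a j) = 0"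
    and brk_b_b: "i \<in> {1..l} \<Longrightarrow> j \<in> {1..l} \<Longrightarrow> brk L (b i) (b j) = 0"
    and transitive: "0 \<le> p \<Longrightarrow> x \<in> part L p \<Longrightarrow> (\<And>y. y \<in> part L (-1) \<Longrightarrow> brk L x y = 0) \<Longrightarrow> x = 0"
begin

lemma carrier_intros:
  "i \<in> {1..l} \<Longrightarrow> a i \<in> carrier L" "i \<in> {1..l} \<Longrightarrow> b i \<in> carrier L" "e \<in> carrier L"
  "0 \<in> carrier L" "x \<in> carrier L \<Longrightarrow> y \<in> carrier L \<Longrightarrow> brk L x y \<in> carrier L"
  "x \<in> carrier L \<Longrightarrow> y \<in> carrier L \<Longrightarrow> x + y \<in> carrier L"
  "x \<in> carrier L \<Longrightarrow> scl L c x \<in> carrier L"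
  using a_part b_part e_part part_in_carrier brk_closed subspace_0[OF carrier_subspace]
    subspace_add[OF carrier_subspace] subspace_scale[OF carrier_subspace] by blast+

lemma brk_e_a: "i \<in> {1..l} \<Longrightarrow> brk L e (a i) = 0"
  and brk_e_b: "i \<in> {1..l} \<Longrightarrow> brk L e (b i) = 0"
  using brk_graded[OF e_part a_part] brk_graded[OF e_part b_part] part_below[of "-3"] by auto

lemma commute_e_a: "i \<in> {1..l} \<Longrightarrow> x \<in> carrier L \<Longrightarrow> brk L e (brk L (a i) x) = brk L (a i) (brk L e x)"
  and commute_e_b: "i \<in> {1..l} \<Longrightarrow> x \<in> carrier L \<Longrightarrow> brk L e (brk L (b i) x) = brk L (b i) (brk L e x)"
  and commute_a_a: "i \<in> {1..l} \<Longrightarrow> j \<in> {1..l} \<Longrightarrow> x \<in> carrier L \<Longrightarrow>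
    brk L (a i) (brk L (a j) x) = brk L (a j) (brk L (a i) x)"
  and commute_b_b: "i \<in> {1..l} \<Longrightarrow> j \<in> {1..l} \<Longrightarrow> x \<in> carrier L \<Longrightarrow>
    brk L (b i) (brk L (b j) x) = brk L (b j) (brk L (b i) x)"
  and commute_a_b: "i \<in> {1..l} \<Longrightarrow> j \<in> {1..l} \<Longrightarrow> x \<in> carrier L \<Longrightarrow>
    brk L (a i) (brk L (b j) x) = (if i = j then brk L e x else 0) + brk L (b j) (brk L (a i) x)"
  by (subst brk_derivation; simp add: carrier_intros brk_e_a brk_e_b brk_a_a brk_b_b brk_a_b brk_zero_left)+

lemma funpow_brk_closed: "y \<in> carrier L \<Longrightarrow> x \<in> carrier L \<Longrightarrow> (brk L y ^^ n) x \<in> carrier L"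
  by (induction n) (simp_all add: brk_closed)

lemma funpow_brk_commute:
  assumes "y \<in> carrier L" "x \<in> carrier L" "z \<in> carrier L"
    and "\<And>x. x \<in> carrier L \<Longrightarrow> brk L y (brk L z x) = brk L z (brk L y x)"
  shows "(brk L y ^^ n) (brk L z x) = brk L z ((brk L y ^^ n) x)"
  by (induction n) (simp_all add: assms funpow_brk_closed)

lemma funpow_brk_add:
  assumes "y \<in> carrier L" "x \<in> carrier L" "x' \<in> carrier L"
  shows "(brk L y ^^ n) (x + x') = (brk L y ^^ n) x + (brk L y ^^ n) x'"
  by (induction n) (simp_all add: assms funpow_brk_closed brk_add_right)

lemma funpow_brk_scale:
  assumes "y \<in> carrier L" "x \<in> carrier L"
  shows "(brk L y ^^ n) (scl L c x) = scl L c ((brk L y ^^ n) x)"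
  by (induction n) (simp_all add: assms funpow_brk_closed brk_scl_right)

lemma funpow_brk_part:
  assumes "y \<in> part L q" "x \<in> part L p"
  shows "(brk L y ^^ n) x \<in> part L (p + int n * q)"
proof (induction n)
  case (Suc n)
  have eq: "q + (p + int n * q) = p + int (Suc n) * q" by (simp add: algebra_simps)
  show ?case using brk_graded[OF assms(1) Suc.IH] unfolding eq by simp
qed (simp add: assms)

text \<open>
  The Heisenberg relation \<open>A^n B = B A^n + n E A^(n-1)\<close> for \<open>A = ad a\<^sub>i\<close>, \<open>B = ad b\<^sub>i\<close>, \<open>E = ad e\<close>. For \<open>n = 0\<close>, where
  \<open>n - 1\<close> is truncated, the last term has the factor 0.
\<close>

lemma funpow_a_b:
  assumes i: "i \<in> {1..l}" and x: "x \<in> carrier L"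
  shows "(brk L (a i) ^^ n) (brk L (b i) x) =
    brk L (b i) ((brk L (a i) ^^ n) x) + scl L (of_nat n) (brk L e ((brk L (a i) ^^ (n - 1)) x))"
proof (induction n)
  case (Suc n)
  have cl: "(brk L (a i) ^^ k) x \<in> carrier L" for k
    using i x by (intro funpow_brk_closed carrier_intros)
  have "brk L (a i) (brk L e ((brk L (a i) ^^ (n - 1)) x)) = brk L e ((brk L (a i) ^^ n) x)" if "n \<noteq> 0"
    using that i cl by (cases n) (simp_all add: commute_e_a)
  then have "scl L (of_nat n) (brk L (a i) (brk L e ((brk L (a i) ^^ (n - 1)) x))) =
      scl L (of_nat n) (brk L e ((brk L (a i) ^^ n) x))"
    by (cases "n = 0") simp_all
  then show ?case
    using i cl Suc.IH
    by (simp add: brk_add_right brk_scl_right carrier_intros commute_a_b scale_left_distrib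
        add.assoc add.commute add.left_commute)
qed (simp add: scale_zero_left)

text \<open>
  The composition \<open>(ad e)^c \<Prod> (ad b\<^sub>i)^q\<^sub>i (ad a\<^sub>i)^p\<^sub>i\<close> over \<open>i \<le> k\<close>, where \<open>p\<^sub>i, q\<^sub>i, c\<close> are the exponents of \<open>x\<^sub>i, y\<^sub>i, z\<close> in \<open>m\<close>.
  Only the order of \<open>ad a\<^sub>i\<close> and \<open>ad b\<^sub>i\<close> for the same \<open>i\<close> matters. With \<open>ad a\<^sub>i\<close> applied first, a further \<open>ad a\<^sub>i\<close> on
  the right only raises an exponent, as \<open>\<partial>/\<partial>x\<^sub>i\<close> does with Taylor coefficients, whereas \<open>ad b\<^sub>i\<close> has to be moved past
  the powers of \<open>ad a\<^sub>i\<close> and leaves the correction term of \<open>\<partial>/\<partial>y\<^sub>i + x\<^sub>i \<partial>/\<partial>z\<close>.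
\<close>

primrec iterated :: "nat \<Rightarrow> monomial \<Rightarrow> 'a \<Rightarrow> 'a" where
  "iterated 0 m x = (brk L e ^^ Poly_Mapping.lookup m Z) x"
| "iterated (Suc k) m x = iterated k m
    ((brk L (b (Suc k)) ^^ Poly_Mapping.lookup m (Y (Suc k)))
      ((brk L (a (Suc k)) ^^ Poly_Mapping.lookup m (X (Suc k))) x))"

lemma iterated_closed: "k \<le> l \<Longrightarrow> x \<in> carrier L \<Longrightarrow> iterated k m x \<in> carrier L"
  by (induction k arbitrary: x) (simp_all add: funpow_brk_closed carrier_intros)

lemma iterated_add: "k \<le> l \<Longrightarrow> x \<in> carrier L \<Longrightarrow> y \<in> carrier L \<Longrightarrow>
    iterated k m (x + y) = iterated k m x + iterated k m y"
  by (induction k arbitrary: x y) (simp_all add: funpow_brk_closed funpow_brk_add carrier_intros)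

lemma iterated_scale: "k \<le> l \<Longrightarrow> x \<in> carrier L \<Longrightarrow>
    iterated k m (scl L c x) = scl L c (iterated k m x)"
  by (induction k arbitrary: x) (simp_all add: funpow_brk_closed funpow_brk_scale carrier_intros)

lemma iterated_cong:
  "(\<And>c. c \<in> coords k \<Longrightarrow> Poly_Mapping.lookup m c = Poly_Mapping.lookup m' c) \<Longrightarrow>
    iterated k m x = iterated k m' x"
proof (induction k arbitrary: x)
  case (Suc k)
  have "iterated k m y = iterated k m' y" for y
    by (rule Suc.IH) (use Suc.prems in \<open>auto simp: coords_def\<close>)
  then show ?case by (simp add: Suc.prems)
qed simp

lemma iterated_part:
  "k \<le> l \<Longrightarrow> x \<in> part L p \<Longrightarrow> iterated k m x \<in> part L (p - 2 * int (Poly_Mapping.lookup m Z)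
      - (\<Sum>i=1..k. int (Poly_Mapping.lookup m (X i)) + int (Poly_Mapping.lookup m (Y i))))"
proof (induction k arbitrary: x p)
  case 0
  then show ?case using funpow_brk_part[OF e_part 0(2), of "Poly_Mapping.lookup m Z"]
    by (simp add: mult.commute)
next
  case (Suc k)
  then have k: "Suc k \<in> {1..l}" by simp
  let ?p = "Poly_Mapping.lookup m (X (Suc k))" and ?q = "Poly_Mapping.lookup m (Y (Suc k))"
  have "k \<le> l" using Suc.prems(1) by simp
  from Suc.IH[OF this funpow_brk_part[OF b_part[OF k] funpow_brk_part[OF a_part[OF k] Suc.prems(2), of ?p], of ?q]]
  show ?case by (simp add: algebra_simps)
qed

lemma iterated_Z:
  "k \<le> l \<Longrightarrow> x \<in> carrier L \<Longrightarrow>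
    iterated k m (brk L e x) = iterated k (m + Poly_Mapping.single Z 1) x"
proof (induction k arbitrary: x)
  case 0
  then show ?case by (simp add: lookup_add funpow_swap1)
next
  case (Suc k)
  then have k: "Suc k \<in> {1..l}" by simp
  have "(brk L (a (Suc k)) ^^ n) (brk L e x) = brk L e ((brk L (a (Suc k)) ^^ n) x)" for n
    using k Suc.prems(2) by (intro funpow_brk_commute) (simp_all add: carrier_intros commute_e_a)
  moreover have "(brk L (b (Suc k)) ^^ n) (brk L e y) = brk L e ((brk L (b (Suc k)) ^^ n) y)"
    if "y \<in> carrier L" for n y
    using k that by (intro funpow_brk_commute) (simp_all add: carrier_intros commute_e_b)
  ultimately show ?case
    using k Suc.prems Suc.IH by (simp add: funpow_brk_closed carrier_intros lookup_add lookup_single)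
qed

lemma iterated_X:
  "k \<le> l \<Longrightarrow> i \<in> {1..k} \<Longrightarrow> x \<in> carrier L \<Longrightarrow>
    iterated k m (brk L (a i) x) = iterated k (m + Poly_Mapping.single (X i) 1) x"
proof (induction k arbitrary: x)
  case (Suc k)
  then have k: "Suc k \<in> {1..l}" and i: "i \<in> {1..l}" by simp_all
  show ?case
  proof (cases "i = Suc k")
    case True
    have "iterated k m y = iterated k (m + Poly_Mapping.single (X i) 1) y" for y
      by (rule iterated_cong) (use True in \<open>auto simp: coords_def lookup_add lookup_single when_def\<close>)
    then show ?thesis using True by (simp add: lookup_add lookup_single funpow_swap1)
  next
    case False
    have "(brk L (a (Suc k)) ^^ n) (brk L (a i) x) = brk L (a i) ((brk L (a (Suc k)) ^^ n) x)" for n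
      using k i Suc.prems(3) by (intro funpow_brk_commute) (simp_all add: carrier_intros commute_a_a)
    moreover have "(brk L (b (Suc k)) ^^ n) (brk L (a i) y) = brk L (a i) ((brk L (b (Suc k)) ^^ n) y)"
      if "y \<in> carrier L" for n y
      using k i that False
      by (intro funpow_brk_commute) (simp_all add: carrier_intros commute_a_b)
    ultimately show ?thesis
      using k Suc.prems False Suc.IH
      by (simp add: funpow_brk_closed carrier_intros lookup_add lookup_single)
  qed
qed simp

text \<open>
  The second term is the commutator of \<open>ad b\<^sub>i\<close> with the power of \<open>ad a\<^sub>i\<close>: one factor \<open>ad a\<^sub>i\<close> is traded for \<open>ad e\<close>.
\<close>

lemma iterated_Y:
  "k \<le> l \<Longrightarrow> i \<in> {1..k} \<Longrightarrow> x \<in> carrier L \<Longrightarrow>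
    iterated k m (brk L (b i) x) = iterated k (m + Poly_Mapping.single (Y i) 1) x
      + scl L (of_nat (Poly_Mapping.lookup m (X i)))
          (iterated k (m - Poly_Mapping.single (X i) 1 + Poly_Mapping.single Z 1) x)"
proof (induction k arbitrary: x)
  case (Suc k)
  then have k: "Suc k \<in> {1..l}" and i: "i \<in> {1..l}" and kl: "k \<le> l" by simp_all
  let ?m' = "m - Poly_Mapping.single (X i) 1 + Poly_Mapping.single Z 1"
  show ?case
  proof (cases "i = Suc k")
    case True
    let ?A = "brk L (a i)" and ?B = "brk L (b i)"
    let ?p = "Poly_Mapping.lookup m (X i)" and ?q = "Poly_Mapping.lookup m (Y i)"
    have cl: "(?A ^^ n) x \<in> carrier L" "(?B ^^ n') ((?A ^^ n) x) \<in> carrier L" for n n'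
      using i Suc.prems(3) by (simp_all add: funpow_brk_closed carrier_intros)
    have B_e: "(?B ^^ ?q) (brk L e y) = brk L e ((?B ^^ ?q) y)" if "y \<in> carrier L" for y
      using i that by (intro funpow_brk_commute) (simp_all add: carrier_intros commute_e_b)
    have c1: "iterated k m y = iterated k (m + Poly_Mapping.single (Y i) 1) y" for y
      by (rule iterated_cong) (use True in \<open>auto simp: coords_def lookup_add lookup_single when_def\<close>)
    have c2: "iterated k (m + Poly_Mapping.single Z 1) y = iterated k ?m' y" for y
      by (rule iterated_cong)
        (use True in \<open>auto simp: coords_def lookup_add lookup_minus lookup_single when_def\<close>)
    have "(?B ^^ ?q) ((?A ^^ ?p) (?B x)) =
        (?B ^^ Suc ?q) ((?A ^^ ?p) x) + scl L (of_nat ?p) (brk L e ((?B ^^ ?q) ((?A ^^ (?p - 1)) x)))"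
      unfolding funpow_a_b[OF i Suc.prems(3)] using i cl
      by (simp add: funpow_brk_add funpow_brk_scale carrier_intros B_e funpow_swap1)
    then have "iterated (Suc k) m (?B x) = iterated k m ((?B ^^ Suc ?q) ((?A ^^ ?p) x))
        + scl L (of_nat ?p) (iterated k (m + Poly_Mapping.single Z 1) ((?B ^^ ?q) ((?A ^^ (?p - 1)) x)))"
      using True cl(2)[of "Suc ?q"] cl(2) kl
      by (simp add: iterated_add iterated_scale iterated_Z carrier_intros del: funpow.simps)
    also have "iterated k m ((?B ^^ Suc ?q) ((?A ^^ ?p) x)) =
        iterated (Suc k) (m + Poly_Mapping.single (Y i) 1) x"
      unfolding c1 using True by (simp add: lookup_add lookup_single)
    also have "iterated k (m + Poly_Mapping.single Z 1) ((?B ^^ ?q) ((?A ^^ (?p - 1)) x)) =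
        iterated (Suc k) ?m' x"
      unfolding c2 using True by (simp add: lookup_add lookup_minus lookup_single)
    finally show ?thesis .
  next
    case False
    have "(brk L (a (Suc k)) ^^ n) (brk L (b i) x) = brk L (b i) ((brk L (a (Suc k)) ^^ n) x)" for n
      using k i False Suc.prems(3)
      by (intro funpow_brk_commute) (simp_all add: carrier_intros commute_a_b)
    moreover have "(brk L (b (Suc k)) ^^ n) (brk L (b i) y) = brk L (b i) ((brk L (b (Suc k)) ^^ n) y)"
      if "y \<in> carrier L" for n y
      using k i that by (intro funpow_brk_commute) (simp_all add: carrier_intros commute_b_b)
    ultimately show ?thesis
      using k Suc.prems False Suc.IH
      by (simp add: funpow_brk_closed carrier_intros lookup_add lookup_minus lookup_single)
  qed
qed simp

text \<open>
  The coordinate of the degree \<open>-2\<close> component with respect to \<open>e\<close>, defined modulo all other homogeneous parts so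
  that it is a linear functional on the whole carrier.
\<close>

definition e_coord :: "'a \<Rightarrow> complex"
  where "e_coord x = (THE c. x - scl L c e \<in> span (\<Union>p\<in>-{-2}. part L p))"

lemma e_coord_unique:
  assumes "x - scl L c e \<in> span (\<Union>p\<in>-{-2}. part L p)"
  shows "e_coord x = c"
  unfolding e_coord_def
proof (rule the_equality)
  fix d assume "x - scl L d e \<in> span (\<Union>p\<in>-{-2}. part L p)"
  then have "(x - scl L d e) - (x - scl L c e) \<in> span (\<Union>p\<in>-{-2}. part L p)"
    using assms by (rule span_diff)
  then have "scl L (c - d) e \<in> span (\<Union>p\<in>-{-2}. part L p)"
    by (simp add: scale_left_diff_distrib)
  then have "scl L (c - d) e = 0"
    by (rule part_inter_span_other_parts[OF subspace_scale[OF part_subspace e_part]])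
  then show "d = c" using e_nonzero by simp
qed (rule assms)

lemma e_coord_part: "x \<in> part L p \<Longrightarrow> p \<noteq> -2 \<Longrightarrow> e_coord x = 0"
  by (rule e_coord_unique) (auto intro: span_base)

lemma e_coord_scale_e [simp]: "e_coord (scl L c e) = c"
  by (rule e_coord_unique) (simp add: span_zero)

lemma part_minus_2_eq: "x \<in> part L (-2) \<Longrightarrow> x = scl L (e_coord x) e"
  using part_minus_2 by (auto simp: span_singleton)

lemma e_coord_exists:
  assumes "x \<in> carrier L" shows "x - scl L (e_coord x) e \<in> span (\<Union>p\<in>-{-2}. part L p)"
proof -
  have "\<exists>c. x - scl L c e \<in> span (\<Union>p\<in>-{-2}. part L p)"
    using assms
  proof (induction rule: carrier_induct)
    case zero
    show ?case by (rule exI[of _ 0]) (simp add: span_zero)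
  next
    case (part p x)
    show ?case
    proof (cases "p = -2")
      case True
      then have "x - scl L (e_coord x) e = 0" using part part_minus_2_eq by simp
      then show ?thesis using span_zero by metis
    next
      case False
      then show ?thesis using part by (intro exI[of _ 0]) (auto intro: span_base)
    qed
  next
    case (add x y)
    then obtain c d where "x - scl L c e \<in> span (\<Union>p\<in>-{-2}. part L p)"
      "y - scl L d e \<in> span (\<Union>p\<in>-{-2}. part L p)" by blast
    then have "(x - scl L c e) + (y - scl L d e) \<in> span (\<Union>p\<in>-{-2}. part L p)" by (rule span_add)
    then show ?case by (intro exI[of _ "c + d"]) (simp add: scale_left_distrib algebra_simps)
  qed
  then show ?thesis using e_coord_unique by metis
qed

lemma e_coord_add:
  assumes "x \<in> carrier L" "y \<in> carrier L"
  shows "e_coord (x + y) = e_coord x + e_coord y"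
  using span_add[OF e_coord_exists[OF assms(1)] e_coord_exists[OF assms(2)]]
  by (intro e_coord_unique) (simp add: scale_left_distrib algebra_simps)

lemma e_coord_scale:
  assumes "x \<in> carrier L"
  shows "e_coord (scl L c x) = c * e_coord x"
  using span_scale[OF e_coord_exists[OF assms], of c]
  by (intro e_coord_unique) (simp add: scale_right_diff_distrib)

text \<open>
  The denominators \<open>m!\<close> of the Taylor coefficients.
\<close>

definition mfact :: "monomial \<Rightarrow> complex"
  where "mfact m = (\<Prod>c\<in>coords l. fact (Poly_Mapping.lookup m c))"

lemma mfact_nonzero [simp]: "mfact m \<noteq> 0"
  by (simp add: mfact_def)

lemma mfact_0 [simp]: "mfact 0 = 1"
  by (simp add: mfact_def)

lemma mfact_add_single:
  assumes "c \<in> coords l"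
  shows "mfact (m + Poly_Mapping.single c 1) = of_nat (Poly_Mapping.lookup m c + 1) * mfact m"
proof -
  have "(\<Prod>d\<in>coords l - {c}. fact (Poly_Mapping.lookup (m + Poly_Mapping.single c 1) d)) =
      (\<Prod>d\<in>coords l - {c}. fact (Poly_Mapping.lookup m d) :: complex)"
    by (rule prod.cong) (auto simp: lookup_add lookup_single when_def)
  then show ?thesis
    unfolding mfact_def using assms
    by (simp add: prod.remove[of _ c] lookup_add mult.assoc)
qed

text \<open>
  The Taylor series at the origin of the function whose derivatives there are the \<open>e\<close>-coordinates of the
  iterated brackets. It is a polynomial because the iterated bracket for \<open>m\<close> lowers the degree by the weight of
  \<open>m\<close>, and only elements with a component of degree \<open>-2\<close> have a nonzero \<open>e\<close>-coordinate.
\<close>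

definition generating_function :: "'a \<Rightarrow> polynomial"
  where "generating_function x = Poly_Mapping.Abs_poly_mapping
    (\<lambda>m. if Poly_Mapping.keys m \<subseteq> coords l then e_coord (iterated l m x) / mfact m else 0)"

lemma monomial_weight_coords:
  assumes "Poly_Mapping.keys m \<subseteq> coords l"
  shows "int (monomial_weight m) = 2 * int (Poly_Mapping.lookup m Z)
      + (\<Sum>i=1..l. int (Poly_Mapping.lookup m (X i)) + int (Poly_Mapping.lookup m (Y i)))"
  by (simp add: monomial_weight_superset[OF finite_coords assms] sum_coords sum.distrib)

lemma e_coord_iterated_homogeneous:
  assumes "x \<in> part L p" "Poly_Mapping.keys m \<subseteq> coords l" "e_coord (iterated l m x) \<noteq> 0"
  shows "int (monomial_weight m) = p + 2"
  using e_coord_part[OF iterated_part[OF order_refl assms(1)]] assms(3)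
    monomial_weight_coords[OF assms(2)] by force

lemma finite_support:
  assumes "x \<in> carrier L"
  shows "finite {m. Poly_Mapping.keys m \<subseteq> coords l \<and> e_coord (iterated l m x) \<noteq> 0}"
  using assms
proof (induction rule: carrier_induct)
  case zero
  have "iterated l m 0 = 0" for m
    using iterated_scale[of l 0 m 0] by (simp add: carrier_intros)
  then show ?case using e_coord_scale_e[of 0] by simp
next
  case (part p x)
  then have "{m. Poly_Mapping.keys m \<subseteq> coords l \<and> e_coord (iterated l m x) \<noteq> 0} \<subseteq>
      {m. Poly_Mapping.keys m \<subseteq> coords l \<and> monomial_weight m \<le> nat (p + 2)}"
    using e_coord_iterated_homogeneous by fastforce
  then show ?case using finite_monomials by (rule finite_subset)
next
  case (add x y)
  have "{m. Poly_Mapping.keys m \<subseteq> coords l \<and> e_coord (iterated l m (x + y)) \<noteq> 0} \<subseteq>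
      {m. Poly_Mapping.keys m \<subseteq> coords l \<and> e_coord (iterated l m x) \<noteq> 0} \<union>
      {m. Poly_Mapping.keys m \<subseteq> coords l \<and> e_coord (iterated l m y) \<noteq> 0}"
    using add by (auto simp: iterated_add iterated_closed e_coord_add)
  then show ?case by (rule finite_subset) (use add in blast)
qed

lemma lookup_generating_function:
  assumes "x \<in> carrier L"
  shows "Poly_Mapping.lookup (generating_function x) m =
    (if Poly_Mapping.keys m \<subseteq> coords l then e_coord (iterated l m x) / mfact m else 0)"
proof -
  have "{m. (if Poly_Mapping.keys m \<subseteq> coords l then e_coord (iterated l m x) / mfact m else 0) \<noteq> 0} =
      {m. Poly_Mapping.keys m \<subseteq> coords l \<and> e_coord (iterated l m x) \<noteq> 0}"
    by auto
  then show ?thesis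
    unfolding generating_function_def using finite_support[OF assms]
    by (subst lookup_Abs_poly_mapping) simp_all
qed

lemma generating_function_polynomials_on:
  "x \<in> carrier L \<Longrightarrow> generating_function x \<in> polynomials_on (coords l)"
  unfolding polynomials_on_def
  by (auto simp: lookup_generating_function lookup_not_eq_zero_eq_in_keys[of "generating_function x", symmetric]
      split: if_splits)

lemma generating_function_homogeneous:
  assumes "x \<in> part L p" shows "homogeneous (p + 2) (generating_function x)"
  using e_coord_iterated_homogeneous[OF assms] part_in_carrier[OF assms]
  by (auto simp: homogeneous_def lookup_generating_function
      simp flip: lookup_not_eq_zero_eq_in_keys split: if_splits)

lemma generating_function_add:
  "x \<in> carrier L \<Longrightarrow> y \<in> carrier L \<Longrightarrow>
    generating_function (x + y) = generating_function x + generating_function y"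
  by (rule poly_mapping_eqI)
    (simp add: lookup_add lookup_generating_function carrier_intros iterated_add iterated_closed
      e_coord_add add_divide_distrib)

lemma generating_function_scale:
  "x \<in> carrier L \<Longrightarrow> generating_function (scl L c x) = const c * generating_function x"
  by (rule poly_mapping_eqI)
    (simp add: lookup_const_mult lookup_generating_function carrier_intros iterated_scale iterated_closed
      e_coord_scale)

text \<open>
  The map to generating functions turns \<open>ad e\<close>, \<open>ad a\<^sub>i\<close>, \<open>ad b\<^sub>i\<close> into \<open>\<partial>/\<partial>z\<close>, \<open>\<partial>/\<partial>x\<^sub>i\<close>, \<open>\<partial>/\<partial>y\<^sub>i + x\<^sub>i \<partial>/\<partial>z\<close>.
  Each case compares Taylor coefficients by means of the corresponding rule for the iterated brackets.
\<close>

lemma generating_function_Z: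
  assumes "x \<in> carrier L"
  shows "generating_function (brk L e x) = partial_deriv Z (generating_function x)"
  using assms
  by (intro poly_mapping_eqI)
    (simp add: lookup_generating_function carrier_intros lookup_partial_deriv iterated_Z
      keys_add_single[unfolded One_nat_def] mfact_add_single[unfolded One_nat_def] del: of_nat_Suc)

lemma generating_function_X:
  assumes "i \<in> {1..l}" "x \<in> carrier L"
  shows "generating_function (brk L (a i) x) = partial_deriv (X i) (generating_function x)"
  using assms
  by (intro poly_mapping_eqI)
    (simp add: lookup_generating_function carrier_intros lookup_partial_deriv iterated_X
      keys_add_single[unfolded One_nat_def] mfact_add_single[unfolded One_nat_def] del: of_nat_Suc)

lemma generating_function_Y:
  assumes i: "i \<in> {1..l}" and x: "x \<in> carrier L"
  shows "generating_function (brk L (b i) x) =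
    partial_deriv (Y i) (generating_function x) + var (X i) * partial_deriv Z (generating_function x)"
proof (rule poly_mapping_eqI)
  fix m
  let ?n = "m - Poly_Mapping.single (X i) (1::nat)"
  have bx: "brk L (b i) x \<in> carrier L" using i x by (simp add: carrier_intros)
  show "Poly_Mapping.lookup (generating_function (brk L (b i) x)) m = Poly_Mapping.lookup
     (partial_deriv (Y i) (generating_function x) + var (X i) * partial_deriv Z (generating_function x)) m"
  proof (cases "Poly_Mapping.keys m \<subseteq> coords l")
    case False
    have "\<not> Poly_Mapping.keys ?n \<subseteq> coords l" if "Poly_Mapping.lookup m (X i) \<noteq> 0"
    proof -
      from that obtain n where n: "m = n + Poly_Mapping.single (X i) 1" by (rule monomial_split)
      then show ?thesis using False i keys_add_single[of n "X i"] by auto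
    qed
    then show ?thesis
      using False i x bx
      by (auto simp: lookup_generating_function lookup_add lookup_partial_deriv lookup_var_mult
          keys_add_single[unfolded One_nat_def])
  next
    case True
    let ?t = "e_coord (iterated l (?n + Poly_Mapping.single Z 1) x)"
    have "e_coord (iterated l m (brk L (b i) x)) =
        e_coord (iterated l (m + Poly_Mapping.single (Y i) 1) x) + of_nat (Poly_Mapping.lookup m (X i)) * ?t"
      using i x by (simp add: iterated_Y iterated_closed e_coord_add e_coord_scale carrier_intros)
    then have "Poly_Mapping.lookup (generating_function (brk L (b i) x)) m =
        e_coord (iterated l (m + Poly_Mapping.single (Y i) 1) x) / mfact m
        + of_nat (Poly_Mapping.lookup m (X i)) * ?t / mfact m"
      using True bx by (simp add: lookup_generating_function add_divide_distrib)
    also have "e_coord (iterated l (m + Poly_Mapping.single (Y i) 1) x) / mfact m =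
        Poly_Mapping.lookup (partial_deriv (Y i) (generating_function x)) m"
      using True i x by (simp add: lookup_partial_deriv lookup_generating_function
          keys_add_single[unfolded One_nat_def] mfact_add_single[unfolded One_nat_def] del: of_nat_Suc)
    also have "of_nat (Poly_Mapping.lookup m (X i)) * ?t / mfact m =
        Poly_Mapping.lookup (var (X i) * partial_deriv Z (generating_function x)) m"
    proof (cases "Poly_Mapping.lookup m (X i) = 0")
      case False
      then obtain n where n: "m = n + Poly_Mapping.single (X i) 1" by (rule monomial_split)
      have "Poly_Mapping.keys n \<subseteq> coords l" using True n keys_add_single[of n "X i"] by auto
      then show ?thesis using i x n
        by (simp add: lookup_var_mult lookup_partial_deriv lookup_generating_function lookup_add
          keys_add_single[unfolded One_nat_def] mfact_add_single[unfolded One_nat_def] del: of_nat_Suc)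
    qed (simp add: lookup_var_mult)
    finally show ?thesis by (simp add: lookup_add)
  qed
qed


definition contact_embedding :: "'a \<Rightarrow> vector_field"
  where "contact_embedding x = contact_field l (generating_function x)"

lemma contact_form_contact_embedding [simp]: "contact_form l (contact_embedding x) = generating_function x"
  by (simp add: contact_embedding_def)

lemma contact_embedding_in_contact_fields: "x \<in> carrier L \<Longrightarrow> contact_embedding x \<in> contact_fields l"
  by (simp add: contact_embedding_def contact_field_in_contact_fields generating_function_polynomials_on)

lemma contact_embedding_part: "x \<in> part L p \<Longrightarrow> contact_embedding x \<in> part (contact_algebra l) p"
  by (simp add: contact_embedding_def contact_field_in_part generating_function_polynomials_on
      generating_function_homogeneous part_in_carrier)

lemma contact_embedding_add:
  "x \<in> carrier L \<Longrightarrow> y \<in> carrier L \<Longrightarrow>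
    contact_embedding (x + y) = contact_embedding x + contact_embedding y"
  by (simp add: contact_embedding_def generating_function_add contact_field_add)

lemma contact_embedding_scale:
  "x \<in> carrier L \<Longrightarrow> contact_embedding (scl L c x) = (\<lambda>d. const c * contact_embedding x d)"
  by (simp add: contact_embedding_def generating_function_scale contact_field_scale)

lemma generating_function_0 [simp]: "generating_function 0 = 0"
  using generating_function_scale[of 0 0] by (simp add: carrier_intros)

lemma contact_embedding_0 [simp]: "contact_embedding 0 = 0"
  by (simp add: contact_embedding_def)

lemma contact_embedding_minus: "x \<in> carrier L \<Longrightarrow> contact_embedding (- x) = - contact_embedding x"
  using contact_embedding_scale[of x "-1"] by (simp add: fun_eq_iff single_uminus)

lemma lookup_generating_function_0: "x \<in> part L (-2) \<Longrightarrow>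
    Poly_Mapping.lookup (generating_function x) 0 = e_coord x"
proof -
  have "iterated k 0 x = x" for k by (induction k) simp_all
  then show "x \<in> part L (-2) \<Longrightarrow> Poly_Mapping.lookup (generating_function x) 0 = e_coord x"
    by (simp add: lookup_generating_function part_in_carrier)
qed

lemma generating_function_e: "generating_function e = 1"
proof (rule poly_mapping_eqI)
  fix m
  have "m = 0" if "Poly_Mapping.lookup (generating_function e) m \<noteq> 0"
    using that generating_function_homogeneous[OF e_part]
    by (auto simp: homogeneous_def in_keys_iff monomial_weight_eq_0)
  moreover have "Poly_Mapping.lookup (generating_function e) 0 = 1"
    using lookup_generating_function_0[OF e_part] e_coord_scale_e[of 1] by simp
  ultimately show "Poly_Mapping.lookup (generating_function e) m = Poly_Mapping.lookup 1 m"
    by (cases "m = 0") (auto simp: lookup_one)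
qed

lemma brk_b_a: "i \<in> {1..l} \<Longrightarrow> j \<in> {1..l} \<Longrightarrow> brk L (b i) (a j) = (if i = j then - e else 0)"
  using brk_skew[of "a j" "b i"] brk_a_b[of j i] by (auto simp: carrier_intros)

lemma generating_function_minus:
  "x \<in> carrier L \<Longrightarrow> generating_function (- x) = - generating_function x"
  using generating_function_scale[of x "-1"] by (simp add: single_uminus)

text \<open>
  Both sides are linear forms, and the equivariance gives the partial derivatives of the left-hand side.
\<close>

lemma generating_function_a:
  assumes i: "i \<in> {1..l}" shows "generating_function (a i) = - var (Y i)"
proof (rule linear_polynomial_eqI)
  have ai: "a i \<in> carrier L" using i by (rule carrier_intros)
  show "generating_function (a i) \<in> polynomials_on (coords l)"
    using ai by (rule generating_function_polynomials_on)
  show "- var (Y i) \<in> polynomials_on (coords l)"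
    using i by (intro polynomials_on_intros) simp
  show "homogeneous 1 (generating_function (a i))"
    using generating_function_homogeneous[OF a_part[OF i]] by simp
  show "homogeneous 1 (- var (Y i))" using homogeneous_minus[OF homogeneous_var[of "Y i"]] by simp
  have Z: "partial_deriv Z (generating_function (a i)) = 0"
    using generating_function_Z[OF ai] by (simp add: brk_e_a[OF i])
  show "partial_deriv c (generating_function (a i)) = partial_deriv c (- var (Y i))"
    if c: "c \<in> coords l" for c
  proof (cases c)
    case (X j)
    then show ?thesis using c i generating_function_X[OF _ ai, of j]
      by (simp add: brk_a_a partial_deriv_minus partial_deriv_var)
  next
    case (Y j)
    then show ?thesis using c i Z generating_function_Y[OF _ ai, of j]
      by (simp add: brk_b_a partial_deriv_minus partial_deriv_var generating_function_minus
          carrier_intros generating_function_e split: if_splits)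
  next
    case Z
    then show ?thesis using \<open>partial_deriv Z (generating_function (a i)) = 0\<close>
      by (simp add: partial_deriv_minus partial_deriv_var)
  qed
qed

lemma generating_function_b:
  assumes i: "i \<in> {1..l}" shows "generating_function (b i) = var (X i)"
proof (rule linear_polynomial_eqI)
  have bi: "b i \<in> carrier L" using i by (rule carrier_intros)
  show "generating_function (b i) \<in> polynomials_on (coords l)"
    using bi by (rule generating_function_polynomials_on)
  show "var (X i) \<in> polynomials_on (coords l)"
    using i by (intro polynomials_on_intros) simp
  show "homogeneous 1 (generating_function (b i))"
    using generating_function_homogeneous[OF b_part[OF i]] by simp
  show "homogeneous 1 (var (X i))" using homogeneous_var[of "X i"] by simp
  have Z: "partial_deriv Z (generating_function (b i)) = 0"
    using generating_function_Z[OF bi] by (simp add: brk_e_b[OF i])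
  show "partial_deriv c (generating_function (b i)) = partial_deriv c (var (X i))"
    if c: "c \<in> coords l" for c
  proof (cases c)
    case (X j)
    then show ?thesis using c i generating_function_X[OF _ bi, of j]
      by (simp add: brk_a_b partial_deriv_var generating_function_e split: if_splits)
  next
    case (Y j)
    then show ?thesis using c i Z generating_function_Y[OF _ bi, of j]
      by (simp add: brk_b_b partial_deriv_var)
  next
    case Z
    then show ?thesis using \<open>partial_deriv Z (generating_function (b i)) = 0\<close>
      by (simp add: partial_deriv_var)
  qed
qed

lemma contact_embedding_a: "i \<in> {1..l} \<Longrightarrow> contact_embedding (a i) = contact_field l (- var (Y i))"
  and contact_embedding_b: "i \<in> {1..l} \<Longrightarrow> contact_embedding (b i) = contact_field l (var (X i))"
  and contact_embedding_e: "contact_embedding e = contact_field l 1"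
  by (simp_all add: contact_embedding_def generating_function_a generating_function_b generating_function_e)

text \<open>
  Contact fields can be compared by their generating functions, on which both sides act as the same
  differential operators.
\<close>

lemma contact_embedding_brk_generators:
  assumes "x \<in> carrier L"
  shows "contact_embedding (brk L e x) = field_bracket l (contact_embedding e) (contact_embedding x)"
    and "i \<in> {1..l} \<Longrightarrow>
      contact_embedding (brk L (a i) x) = field_bracket l (contact_embedding (a i)) (contact_embedding x)"
    and "i \<in> {1..l} \<Longrightarrow>
      contact_embedding (brk L (b i) x) = field_bracket l (contact_embedding (b i)) (contact_embedding x)"
  using assms
  by (auto intro!: contact_fields_eqI[of _ l] contact_fields_bracket contact_embedding_in_contact_fields carrier_intros
      simp: contact_embedding_e contact_form_bracket_Z generating_function_Z
        contact_embedding_a contact_form_bracket_X generating_function_X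
        contact_embedding_b contact_form_bracket_Y generating_function_Y
        contact_field_in_contact_fields polynomials_on_minus polynomials_on_var)

lemma contact_embedding_brk_span:
  assumes x: "x \<in> carrier L" and y: "y \<in> span B" and B: "B \<subseteq> carrier L"
    and gen: "\<And>y. y \<in> B \<Longrightarrow>
      contact_embedding (brk L y x) = field_bracket l (contact_embedding y) (contact_embedding x)"
  shows "contact_embedding (brk L y x) = field_bracket l (contact_embedding y) (contact_embedding x)"
proof -
  have "y \<in> carrier L \<and>
      contact_embedding (brk L y x) = field_bracket l (contact_embedding y) (contact_embedding x)"
    using y
  proof (induction rule: span_induct_alt)
    case base
    show ?case using x field_bracket_scale_left[of l 0 0 "contact_embedding x"]
      by (simp add: carrier_intros brk_zero_left zero_fun_def)
  next
    case (step c y z)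
    have y: "y \<in> carrier L" using step B by blast
    have z: "z \<in> carrier L" and IH: "contact_embedding (brk L z x) =
        field_bracket l (contact_embedding z) (contact_embedding x)"
      using step by simp_all
    have "contact_embedding (brk L (scl L c y + z) x) = contact_embedding (scl L c (brk L y x) + brk L z x)"
      using y z x by (simp add: carrier_intros brk_add_left brk_scl_left)
    also have "\<dots> = (\<lambda>d. const c * contact_embedding (brk L y x) d) + contact_embedding (brk L z x)"
      using y z x by (simp add: carrier_intros contact_embedding_add contact_embedding_scale)
    also have "\<dots> = field_bracket l ((\<lambda>d. const c * contact_embedding y d) + contact_embedding z)
        (contact_embedding x)"
      unfolding IH gen[OF step(1)] field_bracket_add_left field_bracket_scale_left ..
    also have "(\<lambda>d. const c * contact_embedding y d) + contact_embedding z =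
        contact_embedding (scl L c y + z)"
      using y z by (simp add: carrier_intros contact_embedding_add contact_embedding_scale)
    finally show ?case using y z by (simp add: carrier_intros)
  qed
  then show ?thesis ..
qed

lemma contact_embedding_brk_negative:
  assumes x: "x \<in> carrier L" and y: "y \<in> part L p" and p: "p < 0"
  shows "contact_embedding (brk L y x) = field_bracket l (contact_embedding y) (contact_embedding x)"
proof -
  consider "p < -2" | "p = -2" | "p = -1" using p by linarith
  then show ?thesis
  proof cases
    case 1
    then have "y \<in> span {}" using y part_below by simp
    then show ?thesis by (rule contact_embedding_brk_span[OF x]) auto
  next
    case 2
    then have "y \<in> span {e}" using y part_minus_2 by blast
    then show ?thesis
      by (rule contact_embedding_brk_span[OF x])
        (auto simp: carrier_intros contact_embedding_brk_generators x)
  next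
    case 3
    then have "y \<in> span (a ` {1..l} \<union> b ` {1..l})" using y part_minus_1 by blast
    then show ?thesis
      by (rule contact_embedding_brk_span[OF x])
        (auto simp: carrier_intros contact_embedding_brk_generators x)
  qed
qed

text \<open>
  If one degree is negative, this is equivariance. Otherwise let \<open>D\<close> be the difference of the two sides and
  \<open>w\<close> of degree \<open>-1\<close>. By the Jacobi identity \<open>[\<phi> w, D]\<close> is the sum of the differences for the pairs
  \<open>([w, x], y)\<close> and \<open>(x, [w, y])\<close>, whose degrees have a smaller sum, hence it is zero. As the contact algebra is
  transitive, \<open>D = 0\<close>.
\<close>

lemma contact_embedding_brk_parts:
  assumes "x \<in> part L p" "y \<in> part L q"
  shows "contact_embedding (brk L x y) = field_bracket l (contact_embedding x) (contact_embedding y)"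
  using assms
proof (induction "nat (p + q)" arbitrary: p q x y rule: less_induct)
  case less
  have x: "x \<in> carrier L" and y: "y \<in> carrier L" using less.prems part_in_carrier by blast+
  consider "p < 0" | "q < 0" | "0 \<le> p" "0 \<le> q" by linarith
  then show ?case
  proof cases
    case 1
    then show ?thesis using contact_embedding_brk_negative[OF y less.prems(1)] by simp
  next
    case 2
    have "contact_embedding (brk L x y) = - contact_embedding (brk L y x)"
      using brk_skew[OF y x] contact_embedding_minus[of "brk L y x"] x y by (simp add: carrier_intros)
    also have "\<dots> = - field_bracket l (contact_embedding y) (contact_embedding x)"
      using contact_embedding_brk_negative[OF x less.prems(2) 2] by simp
    also have "\<dots> = field_bracket l (contact_embedding x) (contact_embedding y)"
      by (rule field_bracket_swap[symmetric])
    finally show ?thesis .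
  next
    case 3
    let ?D = "contact_embedding (brk L x y) - field_bracket l (contact_embedding x) (contact_embedding y)"
    have *: "field_bracket l ?D (contact_embedding w) = 0" if w: "w \<in> part L (-1)" for w
    proof -
      have wc: "w \<in> carrier L" using w part_in_carrier by blast
      have wx: "brk L w x \<in> part L (p - 1)" and wy: "brk L w y \<in> part L (q - 1)"
        using brk_graded[OF w less.prems(1)] brk_graded[OF w less.prems(2)] by simp_all
      have neg: "contact_embedding (brk L w z) = field_bracket l (contact_embedding w) (contact_embedding z)"
        if "z \<in> carrier L" for z
        using contact_embedding_brk_negative[OF that w] by simp
      \<comment> \<open>The measure \<open>nat (p + q)\<close> does not decrease below 0, but for \<open>p = 0\<close> the bracket \<open>[w, x]\<close> has
        negative degree, and likewise \<open>[w, y]\<close> for \<open>q = 0\<close>.\<close>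
      have IH1: "contact_embedding (brk L (brk L w x) y) =
          field_bracket l (contact_embedding (brk L w x)) (contact_embedding y)"
      proof (cases "p = 0")
        case True
        then show ?thesis using contact_embedding_brk_negative[OF y wx] by simp
      next
        case False
        then show ?thesis using 3 by (intro less.hyps[OF _ wx less.prems(2)]) simp
      qed
      have IH2: "contact_embedding (brk L x (brk L w y)) =
          field_bracket l (contact_embedding x) (contact_embedding (brk L w y))"
      proof (cases "q = 0")
        case True
        have wyc: "brk L w y \<in> carrier L" using y wc by (simp add: carrier_intros)
        have "contact_embedding (brk L x (brk L w y)) = - contact_embedding (brk L (brk L w y) x)"
          unfolding brk_skew[OF wyc x] using brk_closed[OF wyc x] by (rule contact_embedding_minus)
        also have "\<dots> = - field_bracket l (contact_embedding (brk L w y)) (contact_embedding x)"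
          using contact_embedding_brk_negative[OF x wy] True by simp
        also have "\<dots> = field_bracket l (contact_embedding x) (contact_embedding (brk L w y))"
          by (rule field_bracket_swap[symmetric])
        finally show ?thesis .
      next
        case False
        then show ?thesis using 3 by (intro less.hyps[OF _ less.prems(1) wy]) simp
      qed
      have "field_bracket l (contact_embedding w) (contact_embedding (brk L x y)) =
          contact_embedding (brk L w (brk L x y))"
        using neg x y by (simp add: carrier_intros)
      also have "brk L w (brk L x y) = brk L (brk L w x) y + brk L x (brk L w y)"
        using wc x y by (rule brk_derivation)
      also have "contact_embedding \<dots> =
          field_bracket l (field_bracket l (contact_embedding w) (contact_embedding x)) (contact_embedding y)
          + field_bracket l (contact_embedding x) (field_bracket l (contact_embedding w) (contact_embedding y))"
        using x y wc by (simp add: contact_embedding_add carrier_intros IH1 IH2 neg)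
      also have "\<dots> = field_bracket l (contact_embedding w)
          (field_bracket l (contact_embedding x) (contact_embedding y))"
        by (rule ext) (simp add: field_bracket_eq field_deriv_field_bracket field_deriv_diff)
      finally have "field_bracket l (contact_embedding w) ?D = 0"
        by (simp add: field_bracket_diff_right)
      then show ?thesis using field_bracket_swap[of l ?D "contact_embedding w"] by simp
    qed
    have "?D = 0"
    proof (rule contact_transitive[OF l_pos])
      show "-1 \<le> p + q" using 3 by simp
      interpret C: graded_lie_algebra "contact_algebra l" by (rule graded_lie_algebra_contact)
      show "?D \<in> part (contact_algebra l) (p + q)"
        using contact_embedding_part[OF brk_graded[OF less.prems]]
          C.brk_graded[OF contact_embedding_part[OF less.prems(1)] contact_embedding_part[OF less.prems(2)]]
        by (intro C.subspace_diff[OF C.part_subspace]) simp_all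
    qed (use *[OF a_part] *[OF b_part] contact_embedding_a contact_embedding_b in auto)
    then show ?thesis by simp
  qed
qed

lemma contact_embedding_brk:
  assumes "x \<in> carrier L" "y \<in> carrier L"
  shows "contact_embedding (brk L x y) = field_bracket l (contact_embedding x) (contact_embedding y)"
  using assms(1)
proof (induction rule: carrier_induct)
  case zero
  then show ?case using assms(2) field_bracket_scale_left[of l 0 0 "contact_embedding y"]
    by (simp add: brk_zero_left zero_fun_def)
next
  case (part p x)
  then have x: "x \<in> carrier L" by (rule part_in_carrier)
  show ?case
    using assms(2)
  proof (induction rule: carrier_induct)
    case zero
    then show ?case using x field_bracket_scale_right[of l "contact_embedding x" 0 0]
      by (simp add: brk_zero_right zero_fun_def)
  next
    case (part q y)
    then show ?case using contact_embedding_brk_parts[OF \<open>x \<in> part L p\<close>] by simp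
  next
    case (add y z)
    then show ?case using x
      by (simp only: brk_add_right contact_embedding_add carrier_intros field_bracket_add_right)
  qed
next
  case (add x y)
  then show ?case using assms(2)
    by (simp only: brk_add_left contact_embedding_add carrier_intros field_bracket_add_left)
qed

theorem graded_lie_hom_contact_embedding: "graded_lie_hom L (contact_algebra l) contact_embedding"
  unfolding graded_lie_hom_def
  by (auto simp: contact_embedding_add contact_embedding_scale contact_embedding_brk contact_embedding_part)

text \<open>
  The basis \<open>a\<^sub>i, b\<^sub>i\<close> is symplectic for the form \<open>e_coord [x, y]\<close>, so coordinates are values of this form.
\<close>

lemma part_minus_1_expand:
  assumes "x \<in> part L (-1)"
  shows "x = (\<Sum>i=1..l. scl L (e_coord (brk L x (b i))) (a i) + scl L (e_coord (brk L (a i) x)) (b i))"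
proof -
  have "x \<in> carrier L \<and>
      x = (\<Sum>i=1..l. scl L (e_coord (brk L x (b i))) (a i) + scl L (e_coord (brk L (a i) x)) (b i))"
    if "x \<in> span (a ` {1..l} \<union> b ` {1..l})" for x
    using that
  proof (induction rule: span_induct_alt)
    case base
    then show ?case using e_coord_scale_e[of 0] by (simp add: carrier_intros brk_zero_left brk_zero_right)
  next
    case (step c y z)
    have e: "e_coord e = 1" and zero: "e_coord 0 = 0"
      using e_coord_scale_e[of 1] e_coord_scale_e[of 0] by simp_all
    have y: "y \<in> carrier L" using step by (auto simp: carrier_intros)
    have "y = (\<Sum>i=1..l. scl L (e_coord (brk L y (b i))) (a i) + scl L (e_coord (brk L (a i) y)) (b i))"
      using step(1)
    proof
      assume "y \<in> a ` {1..l}"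
      then obtain j where j: "j \<in> {1..l}" "y = a j" by blast
      have "(\<Sum>i=1..l. scl L (e_coord (brk L y (b i))) (a i) + scl L (e_coord (brk L (a i) y)) (b i)) =
          (\<Sum>i=1..l. if j = i then a j else 0)"
        using j by (intro sum.cong) (auto simp: brk_a_b brk_a_a e zero)
      then show ?thesis using j by simp
    next
      assume "y \<in> b ` {1..l}"
      then obtain j where j: "j \<in> {1..l}" "y = b j" by blast
      have "(\<Sum>i=1..l. scl L (e_coord (brk L y (b i))) (a i) + scl L (e_coord (brk L (a i) y)) (b i)) =
          (\<Sum>i=1..l. if j = i then b j else 0)"
        using j by (intro sum.cong) (auto simp: brk_a_b brk_b_b e zero)
      then show ?thesis using j by simp
    qed
    then have eq: "scl L c y + z =
        scl L c (\<Sum>i=1..l. scl L (e_coord (brk L y (b i))) (a i) + scl L (e_coord (brk L (a i) y)) (b i)) +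
        (\<Sum>i=1..l. scl L (e_coord (brk L z (b i))) (a i) + scl L (e_coord (brk L (a i) z)) (b i))"
      using step by simp
    also have "\<dots> = (\<Sum>i=1..l. scl L (e_coord (brk L (scl L c y + z) (b i))) (a i)
        + scl L (e_coord (brk L (a i) (scl L c y + z))) (b i))"
      unfolding scale_sum_right sum.distrib[symmetric] using step y
      by (intro sum.cong) (auto simp: brk_add_left brk_add_right brk_scl_left brk_scl_right carrier_intros
          e_coord_add e_coord_scale scale_left_distrib scale_right_distrib)
    finally show ?case using step y by (simp add: carrier_intros)
  qed
  then show ?thesis using assms part_minus_1 by blast
qed

text \<open>
  By equivariance the brackets of \<open>x\<close> with elements of degree \<open>-1\<close> are again in the kernel, hence zero by
  induction, and transitivity applies. Below degree 0 the place of transitivity is taken by the nondegeneracy of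
  the bracket of degree \<open>-1\<close> elements and by the value of the generating function at the origin.
\<close>

lemma contact_embedding_kernel_part:
  assumes "x \<in> part L p" "contact_embedding x = 0" shows "x = 0"
  using assms
proof (induction "nat (p + 2)" arbitrary: p x rule: less_induct)
  case less
  have x: "x \<in> carrier L" using less.prems part_in_carrier by blast
  consider "p < -2" | "p = -2" | "-1 \<le> p" by linarith
  then show ?case
  proof cases
    case 1
    then show ?thesis using part_below less.prems by blast
  next
    case 2
    have "generating_function x = 0"
      using less.prems(2) contact_form_contact_embedding[of x] by simp
    then have "e_coord x = 0" using lookup_generating_function_0[of x] less.prems 2 by simp
    then show ?thesis using part_minus_2_eq[of x] less.prems 2 by simp
  next
    case 3
    have yx: "brk L y x = 0" if y: "y \<in> part L (-1)" for y
    proof (rule less.hyps)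
      show "brk L y x \<in> part L (p - 1)" using brk_graded[OF y less.prems(1)] by simp
      show "contact_embedding (brk L y x) = 0"
        using contact_embedding_brk[OF part_in_carrier[OF y] x] less.prems(2)
          field_bracket_scale_right[of l "contact_embedding y" 0 0] by (simp add: zero_fun_def)
      show "nat (p - 1 + 2) < nat (p + 2)" using 3 by simp
    qed
    then have xy: "brk L x y = 0" if "y \<in> part L (-1)" for y
      using brk_skew[OF part_in_carrier[OF that] x] that by simp
    show ?thesis
    proof (cases "p = -1")
      case True
      have "e_coord 0 = 0" using e_coord_scale_e[of 0] by simp
      then show ?thesis using part_minus_1_expand[of x] less.prems(1) True
        by (simp add: yx[OF a_part] xy[OF b_part])
    next
      case False
      then show ?thesis using transitive[OF _ less.prems(1)] xy 3 by simp
    qed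
  qed
qed

theorem inj_on_contact_embedding: "inj_on contact_embedding (carrier L)"
proof (rule inj_onI)
  fix x y assume xy: "x \<in> carrier L" "y \<in> carrier L" "contact_embedding x = contact_embedding y"
  interpret C: graded_lie_algebra "contact_algebra l" by (rule graded_lie_algebra_contact)
  define z where "z = x - y"
  have z: "z \<in> carrier L" using xy subspace_diff[OF carrier_subspace] by (simp add: z_def)
  have "contact_embedding (z + y) = contact_embedding z + contact_embedding y"
    using z xy by (intro contact_embedding_add)
  then have z0: "contact_embedding z = 0" using xy by (simp add: z_def)
  have zs: "z \<in> span (\<Union>p\<in>UNIV. part L p)" using z by (simp add: carrier_sum)
  obtain I u where I: "finite I" "\<And>p. u p \<in> part L p" "z = (\<Sum>p\<in>I. u p)"
    using span_parts_decompose[OF zs] by metis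
  have uc: "u p \<in> carrier L" for p using I(2) by (rule part_in_carrier)
  have "contact_embedding (sum u J) = (\<Sum>p\<in>J. contact_embedding (u p)) \<and> sum u J \<in> carrier L"
    if "finite J" for J
    using that by (induction J) (simp_all add: contact_embedding_add uc carrier_intros)
  then have "(\<Sum>p\<in>I. contact_embedding (u p)) = 0" using z0 I by simp
  then have "contact_embedding (u p) = 0" if "p \<in> I" for p
    by (intro C.parts_independent[OF I(1) _ _ that, of "\<lambda>p. contact_embedding (u p)"]
        contact_embedding_part I(2))
  then have "u p = 0" if "p \<in> I" for p
    using contact_embedding_kernel_part[OF I(2)] that by blast
  then have "z = 0" using I(3) by simp
  then show "x = y" by (simp add: z_def)
qed

end

section \<open>The maximal transitive prolongation of the Heisenberg algebra\<close>

lemma negative_part_simps [simp]: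
  "scl (negative_part L) = scl L" "brk (negative_part L) = brk L"
  "carrier (negative_part L) = module.span (scl L) (\<Union>p\<in>{..<0}. part L p)"
  "part (negative_part L) p = (if p < 0 then part L p else {0})"
  by (simp_all add: negative_part_def)

text \<open>
  The Heisenberg algebra itself, for which transitivity is vacuous. It is thus one of the algebras to
  which the embedding applies.
\<close>

locale heisenberg_algebra = heisenberg_prolongation L l a b e
  for L :: "'a::ab_group_add graded_lie" and l :: nat and a b :: "nat \<Rightarrow> 'a" and e :: 'a +
  assumes part_nonneg: "0 \<le> p \<Longrightarrow> part L p = {0}"
begin

lemma carrier_decompose:
  assumes "x \<in> carrier L"
  obtains y z where "y \<in> part L (-2)" "z \<in> part L (-1)" "x = y + z"
proof -
  have "\<exists>y z. y \<in> part L (-2) \<and> z \<in> part L (-1) \<and> x = y + z"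
    using assms
  proof (induction rule: carrier_induct)
    case zero
    show ?case by (intro exI[of _ 0]) simp
  next
    case (part p x)
    consider "p < -2" | "p = -2" | "p = -1" | "0 \<le> p" by linarith
    then show ?case
    proof cases
      case 1
      then show ?thesis using part part_below by (intro exI[of _ 0]) auto
    next
      case 2
      then show ?thesis using part by (intro exI[of _ x] exI[of _ 0]) auto
    next
      case 3
      then show ?thesis using part by (intro exI[of _ 0] exI[of _ x]) auto
    next
      case 4
      then show ?thesis using part part_nonneg by (intro exI[of _ 0]) auto
    qed
  next
    case (add x x')
    then obtain y z y' z' where "y \<in> part L (-2)" "z \<in> part L (-1)" "x = y + z"
      "y' \<in> part L (-2)" "z' \<in> part L (-1)" "x' = y' + z'" by blast
    then show ?case
      by (intro exI[of _ "y + y'"] exI[of _ "z + z'"]) (simp add: subspace_add[OF part_subspace] algebra_simps)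
  qed
  then show ?thesis using that by blast
qed

text \<open>
  The isomorphism \<open>f\<close> of \<open>L\<close> with the negative part of \<open>M\<close> preserves degrees and is surjective only on the sum of
  the parts of negative degree. The independence of the parts of \<open>M\<close> makes it surjective on each of them.
\<close>

lemma heisenberg_prolongation_of_transitive:
  fixes M :: "'g::ab_group_add graded_lie"
  assumes M: "transitive_prolongation L M"
  obtains f where "heisenberg_prolongation M l (f \<circ> a) (f \<circ> b) (f e)"
proof -
  interpret M: graded_lie_algebra M using M by (simp add: transitive_prolongation_def)
  obtain f where f: "graded_lie_hom L (negative_part M) f"
    and bij: "bij_betw f (carrier L) (carrier (negative_part M))"
    using M by (auto simp: transitive_prolongation_def graded_lie_isomorphic_def)
  have f_add: "f (x + y) = f x + f y" and f_brk: "f (brk L x y) = brk M (f x) (f y)"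
    if "x \<in> carrier L" "y \<in> carrier L" for x y
    using f that by (auto simp: graded_lie_hom_def)
  have f_scale: "f (scl L c x) = scl M c (f x)" if "x \<in> carrier L" for c x
    using f that by (auto simp: graded_lie_hom_def)
  have f_part: "f x \<in> part M p" if "x \<in> part L p" "p < 0" for x p
    using f that unfolding graded_lie_hom_def by (fastforce dest: spec[of _ p])
  have f_0: "f 0 = 0" using f_scale[of 0 0] by (simp add: carrier_intros)
  have f_span: "f x \<in> M.span (f ` B)" if x: "x \<in> span B" and B: "B \<subseteq> carrier L" for x B
  proof -
    have "x \<in> carrier L \<and> f x \<in> M.span (f ` B)"
      using x
    proof (induction rule: span_induct_alt)
      case base
      then show ?case by (simp add: f_0 M.span_zero carrier_intros)
    next
      case (step c y z)
      then have "y \<in> carrier L" using B by blast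
      then show ?case using step
        by (simp add: f_add f_scale carrier_intros M.span_add M.span_scale M.span_base)
    qed
    then show ?thesis ..
  qed
  have onto: "\<exists>y\<in>part L (-2). \<exists>z\<in>part L (-1). w = f y + f z" if "w \<in> part M p" "p < 0" for w p
  proof -
    have "w \<in> carrier (negative_part M)" using that by (auto intro: M.span_base)
    then obtain x where x: "x \<in> carrier L" "w = f x" using bij by (metis bij_betw_imp_surj_on imageE)
    obtain y z where "y \<in> part L (-2)" "z \<in> part L (-1)" "x = y + z"
      using carrier_decompose[OF x(1)] .
    then show ?thesis using x f_add part_in_carrier by blast
  qed
  have in_other: "w \<in> M.span (\<Union>q\<in>-{p}. part M q)" if "w \<in> part M q" "q \<noteq> p" for w p q
    using that by (auto intro: M.span_base)
  have below: "part M p = {0}" if p: "p < -2" for p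
  proof -
    have "w = 0" if w: "w \<in> part M p" for w
    proof -
      obtain y z where yz: "y \<in> part L (-2)" "z \<in> part L (-1)" "w = f y + f z"
        using onto[OF w] p by auto
      have "w \<in> M.span (\<Union>q\<in>-{p}. part M q)"
        unfolding yz(3) using p by (intro M.span_add in_other[OF f_part[OF yz(1)]] in_other[OF f_part[OF yz(2)]]) auto
      then show ?thesis by (rule M.part_inter_span_other_parts[OF w])
    qed
    then show ?thesis by auto
  qed
  have minus_2: "part M (-2) = f ` part L (-2)"
  proof -
    have "\<exists>y\<in>part L (-2). w = f y" if w: "w \<in> part M (-2)" for w
    proof -
      obtain y z where yz: "y \<in> part L (-2)" "z \<in> part L (-1)" "w = f y + f z"
        using onto[OF w] by auto
      have "w - f y \<in> part M (-2)" using w f_part[OF yz(1)] M.subspace_diff[OF M.part_subspace] by simp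
      moreover have "w - f y \<in> part M (-1)" using yz f_part by simp
      ultimately have "w - f y = 0"
        by (intro M.part_inter_span_other_parts[of _ "-2"] in_other[of _ "-1"]) auto
      then show ?thesis using yz by auto
    qed
    then show ?thesis using f_part by force
  qed
  have minus_1: "part M (-1) = f ` part L (-1)"
  proof -
    have "\<exists>z\<in>part L (-1). w = f z" if w: "w \<in> part M (-1)" for w
    proof -
      obtain y z where yz: "y \<in> part L (-2)" "z \<in> part L (-1)" "w = f y + f z"
        using onto[OF w] by auto
      have "w - f z \<in> part M (-1)" using w f_part[OF yz(2)] M.subspace_diff[OF M.part_subspace] by simp
      moreover have "w - f z \<in> part M (-2)" using yz f_part by simp
      ultimately have "w - f z = 0"
        by (intro M.part_inter_span_other_parts[of _ "-1"] in_other[of _ "-2"]) auto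
      then show ?thesis using yz by auto
    qed
    then show ?thesis using f_part by force
  qed
  have "heisenberg_prolongation M l (f \<circ> a) (f \<circ> b) (f e)"
  proof
    show "1 \<le> l" by (rule l_pos)
    show "(f \<circ> a) i \<in> part M (-1)" "(f \<circ> b) i \<in> part M (-1)" if "i \<in> {1..l}" for i
      using that a_part b_part f_part by auto
    show "f e \<in> part M (-2)" using e_part f_part by auto
    show "f e \<noteq> 0"
      using bij e_nonzero f_0 carrier_intros(3,4) by (metis bij_betw_def inj_onD)
    show "part M p = {0}" if "p < -2" for p using that by (rule below)
    show "part M (-2) \<subseteq> M.span {f e}"
      using f_span[of _ "{e}"] part_minus_2 by (auto simp: minus_2 carrier_intros)
    have "a ` {1..l} \<union> b ` {1..l} \<subseteq> carrier L" by (auto simp: carrier_intros)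
    then show "part M (-1) \<subseteq> M.span ((f \<circ> a) ` {1..l} \<union> (f \<circ> b) ` {1..l})"
      using f_span[of _ "a ` {1..l} \<union> b ` {1..l}"] part_minus_1 by (auto simp: minus_1 image_Un image_comp)
    show "brk M ((f \<circ> a) i) ((f \<circ> b) j) = (if i = j then f e else 0)"
      "brk M ((f \<circ> a) i) ((f \<circ> a) j) = 0" "brk M ((f \<circ> b) i) ((f \<circ> b) j) = 0"
      if "i \<in> {1..l}" "j \<in> {1..l}" for i j
      using that brk_a_b brk_a_a brk_b_b by (simp_all add: carrier_intros f_0 flip: f_brk)
    show "x = 0" if "0 \<le> p" "x \<in> part M p" "\<And>y. y \<in> part M (-1) \<Longrightarrow> brk M x y = 0" for p x
      using M that unfolding transitive_prolongation_def by blast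
  qed
  then show ?thesis by (rule that)
qed

text \<open>
  The isomorphism of \<open>L\<close> with the negative part of the contact algebra is the embedding of \<open>L\<close>, which reaches the
  generators of that negative part as the images of \<open>a\<^sub>i\<close>, \<open>b\<^sub>i\<close> and \<open>e\<close>.
\<close>

theorem transitive_prolongation_contact: "transitive_prolongation L (contact_algebra l)"
  unfolding transitive_prolongation_def
proof (intro conjI allI ballI impI)
  interpret C: graded_lie_algebra "contact_algebra l" by (rule graded_lie_algebra_contact)
  show "graded_lie_algebra (contact_algebra l)" by (rule graded_lie_algebra_contact)
  show "fin_dim (scl (contact_algebra l)) (part (contact_algebra l) p)" for p
    by (rule fin_dim_part_contact)
  show "graded_lie_isomorphic L (negative_part (contact_algebra l))"
    unfolding graded_lie_isomorphic_def
  proof (intro exI conjI)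
    show "graded_lie_hom L (negative_part (contact_algebra l)) contact_embedding"
      using graded_lie_hom_contact_embedding part_nonneg unfolding graded_lie_hom_def by auto
    let ?neg = "C.span (\<Union>p\<in>{..<0}. part (contact_algebra l) p)"
    have "contact_embedding x \<in> ?neg" if x: "x \<in> carrier L" for x
    proof -
      obtain y z where yz: "y \<in> part L (-2)" "z \<in> part L (-1)" "x = y + z"
        using carrier_decompose[OF x] .
      have "contact_embedding y \<in> ?neg" "contact_embedding z \<in> ?neg"
        by (rule C.span_base, rule UN_I[where a = "-2"], simp, rule contact_embedding_part[OF yz(1)],
            rule C.span_base, rule UN_I[where a = "-1"], simp, rule contact_embedding_part[OF yz(2)])
      then show ?thesis
        using yz C.span_add by (simp add: contact_embedding_add part_in_carrier)
    qed
    moreover have "?neg \<subseteq> contact_embedding ` carrier L"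
    proof (rule C.span_minimal)
      show sub: "C.subspace (contact_embedding ` carrier L)"
        unfolding C.subspace_def
      proof (intro conjI ballI allI)
        show "0 \<in> contact_embedding ` carrier L"
          using contact_embedding_0 carrier_intros(4) by (metis image_eqI)
        show "F + G \<in> contact_embedding ` carrier L"
          if "F \<in> contact_embedding ` carrier L" "G \<in> contact_embedding ` carrier L" for F G
        proof -
          obtain x y where "x \<in> carrier L" "y \<in> carrier L" "F = contact_embedding x" "G = contact_embedding y"
            using \<open>F \<in> _\<close> \<open>G \<in> _\<close> by blast
          then show ?thesis
            by (simp only: contact_embedding_add[symmetric] carrier_intros imageI)
        qed
        show "scl (contact_algebra l) c F \<in> contact_embedding ` carrier L"
          if "F \<in> contact_embedding ` carrier L" for F c
        proof -
          obtain x where "x \<in> carrier L" "F = contact_embedding x" using \<open>F \<in> _\<close> by blast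
          then show ?thesis
            by (simp only: contact_algebra_simps contact_embedding_scale[symmetric] carrier_intros imageI)
        qed
      qed
      have gens: "contact_field l 1 \<in> contact_embedding ` carrier L"
        "i \<in> {1..l} \<Longrightarrow> contact_field l (- var (Y i)) \<in> contact_embedding ` carrier L"
        "i \<in> {1..l} \<Longrightarrow> contact_field l (var (X i)) \<in> contact_embedding ` carrier L" for i
        using carrier_intros(1,2,3)
        by (simp_all flip: contact_embedding_e contact_embedding_a contact_embedding_b)
      show "(\<Union>p\<in>{..<0}. part (contact_algebra l) p) \<subseteq> contact_embedding ` carrier L"
      proof safe
        fix p F assume p: "p < (0::int)" and F: "F \<in> part (contact_algebra l) p"
        consider "p < -2" | "p = -2" | "p = -1" using p by linarith
        then show "F \<in> contact_embedding ` carrier L"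
        proof cases
          case 1
          then show ?thesis using F part_contact_below C.subspace_0[OF sub] by auto
        next
          case 2
          have "C.span {contact_field l 1} \<subseteq> contact_embedding ` carrier L"
            by (rule C.span_minimal[OF _ sub]) (use gens in auto)
          then show ?thesis using F 2 part_contact_minus_2[of l] by auto
        next
          case 3
          have "C.span ((\<lambda>i. contact_field l (- var (Y i))) ` {1..l} \<union> (\<lambda>i. contact_field l (var (X i))) ` {1..l})
              \<subseteq> contact_embedding ` carrier L"
            by (rule C.span_minimal[OF _ sub]) (use gens in auto)
          then show ?thesis using F 3 part_contact_minus_1[of l] by auto
        qed
      qed
    qed
    ultimately show "bij_betw contact_embedding (carrier L) (carrier (negative_part (contact_algebra l)))"
      using inj_on_contact_embedding unfolding bij_betw_def negative_part_simps by blast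
  qed
  show "F = 0" if p: "0 \<le> p" and F: "F \<in> part (contact_algebra l) p"
    and *: "\<forall>G\<in>part (contact_algebra l) (-1). brk (contact_algebra l) F G = 0" for p F
  proof (rule contact_transitive[OF l_pos _ F])
    show "-1 \<le> p" using p by simp
    show "field_bracket l F (contact_field l (- var (Y i))) = 0" if i: "i \<in> {1..l}" for i
      using * contact_embedding_part[OF a_part[OF i]] contact_embedding_a[OF i] by simp
    show "field_bracket l F (contact_field l (var (X i))) = 0" if i: "i \<in> {1..l}" for i
      using * contact_embedding_part[OF b_part[OF i]] contact_embedding_b[OF i] by simp
  qed
qed

theorem maximal_transitive_prolongation_contact:
  "maximal_transitive_prolongation TYPE('h::ab_group_add) L (contact_algebra l)"
  unfolding maximal_transitive_prolongation_def
proof (intro conjI allI impI transitive_prolongation_contact)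
  fix M :: "'h graded_lie" assume "transitive_prolongation L M"
  then obtain f where "heisenberg_prolongation M l (f \<circ> a) (f \<circ> b) (f e)"
    by (rule heisenberg_prolongation_of_transitive)
  then interpret H: heisenberg_prolongation M l "f \<circ> a" "f \<circ> b" "f e" .
  show "\<exists>h. graded_lie_hom M (contact_algebra l) h \<and> inj_on h (carrier M)"
    using H.graded_lie_hom_contact_embedding H.inj_on_contact_embedding by blast
qed

text \<open>
  By the two maximality properties there are embeddings \<open>k\<close> of the contact algebra into \<open>M\<close> and \<open>h\<close> of \<open>M\<close> into the
  contact algebra. On each finite-dimensional part \<open>h \<circ> k\<close> is injective, hence surjective, and so \<open>h\<close> is
  bijective.
\<close>

theorem maximal_transitive_prolongation_unique:
  fixes M :: "'g::ab_group_add graded_lie"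
  assumes M: "maximal_transitive_prolongation TYPE(vector_field) L M"
  shows "graded_lie_isomorphic M (contact_algebra l)"
proof -
  have tM: "transitive_prolongation L M" using M by (simp add: maximal_transitive_prolongation_def)
  interpret M: graded_lie_algebra M using tM by (simp add: transitive_prolongation_def)
  interpret C: graded_lie_algebra "contact_algebra l" by (rule graded_lie_algebra_contact)
  obtain k where k: "graded_lie_hom (contact_algebra l) M k" "inj_on k (carrier (contact_algebra l))"
    using M transitive_prolongation_contact unfolding maximal_transitive_prolongation_def by blast
  obtain h where h: "graded_lie_hom M (contact_algebra l) h" "inj_on h (carrier M)"
    using maximal_transitive_prolongation_contact tM unfolding maximal_transitive_prolongation_def by blast
  have kc: "k F \<in> part M p" "k F \<in> carrier M" if "F \<in> part (contact_algebra l) p" for F p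
    using k(1) that M.part_in_carrier unfolding graded_lie_hom_def by blast+
  have hc: "h x \<in> part (contact_algebra l) p" if "x \<in> part M p" for x p
    using h(1) that unfolding graded_lie_hom_def by blast
  have *: "(h \<circ> k) ` part (contact_algebra l) p = part (contact_algebra l) p" for p
  proof -
    obtain S where S: "finite S" "part (contact_algebra l) p \<subseteq> C.span S"
      using fin_dim_part_contact unfolding fin_dim_def by blast
    show ?thesis
    proof (rule C.injective_endomorphism_surj[OF S C.part_subspace])
      show "(h \<circ> k) (F + G) = (h \<circ> k) F + (h \<circ> k) G"
        if "F \<in> part (contact_algebra l) p" "G \<in> part (contact_algebra l) p" for F G
        using kc(2)[OF that(1)] kc(2)[OF that(2)] that[THEN C.part_in_carrier] h(1) k(1)
        unfolding graded_lie_hom_def by simp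
      show "(h \<circ> k) (scl (contact_algebra l) c F) = scl (contact_algebra l) c ((h \<circ> k) F)"
        if "F \<in> part (contact_algebra l) p" for F c
        using kc(2)[OF that] that[THEN C.part_in_carrier] h(1) k(1)
        unfolding graded_lie_hom_def by simp
      show "inj_on (h \<circ> k) (part (contact_algebra l) p)"
      proof (rule comp_inj_on)
        show "inj_on k (part (contact_algebra l) p)"
          using C.part_in_carrier by (intro inj_on_subset[OF k(2)]) blast
        show "inj_on h (k ` part (contact_algebra l) p)"
          using kc by (intro inj_on_subset[OF h(2)]) blast
      qed
      show "(h \<circ> k) ` part (contact_algebra l) p \<subseteq> part (contact_algebra l) p"
        using kc hc by auto
    qed
  qed
  have parts: "part (contact_algebra l) p \<subseteq> h ` carrier M" for p
  proof
    fix F assume "F \<in> part (contact_algebra l) p"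
    then have "F \<in> (h \<circ> k) ` part (contact_algebra l) p" by (simp only: *)
    then obtain G where "G \<in> part (contact_algebra l) p" "F = h (k G)" by auto
    then show "F \<in> h ` carrier M" using kc(2) by blast
  qed
  have "h ` carrier M \<subseteq> carrier (contact_algebra l)"
  proof safe
    fix x assume "x \<in> carrier M"
    then show "h x \<in> carrier (contact_algebra l)"
    proof (induction rule: M.carrier_induct)
      case zero
      have "h (scl M 0 0) = scl (contact_algebra l) 0 (h 0)"
        using h(1) M.subspace_0[OF M.carrier_subspace] unfolding graded_lie_hom_def by blast
      then show ?case using C.subspace_0[OF C.carrier_subspace] by (simp add: zero_fun_def)
    next
      case (part p x)
      then show ?case using hc C.part_in_carrier by blast
    next
      case (add x y)
      then have "h (x + y) = h x + h y" using h(1) unfolding graded_lie_hom_def by blast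
      then show ?case using C.subspace_add[OF C.carrier_subspace add.IH] by (simp only:)
    qed
  qed
  moreover have "carrier (contact_algebra l) \<subseteq> h ` carrier M"
  proof
    fix F assume "F \<in> carrier (contact_algebra l)"
    then show "F \<in> h ` carrier M"
    proof (induction rule: C.carrier_induct)
      case zero
      then show ?case using parts C.part_0 by blast
    next
      case (part p F)
      then show ?case using parts by blast
    next
      case (add F G)
      then obtain x y where "x \<in> carrier M" "y \<in> carrier M" "F = h x" "G = h y" by blast
      then have "F + G = h (x + y)" "x + y \<in> carrier M"
        using h(1) M.subspace_add[OF M.carrier_subspace] unfolding graded_lie_hom_def by auto
      then show ?case by blast
    qed
  qed
  ultimately show ?thesis
    unfolding graded_lie_isomorphic_def bij_betw_def using h by blast
qed

end

section \<open>Clifford modules\<close>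

lemma free_ring_simps [simp]:
  "carrier free_ring = UNIV" "x \<otimes>\<^bsub>free_ring\<^esub> y = x * y" "x \<oplus>\<^bsub>free_ring\<^esub> y = x + y"
  "\<one>\<^bsub>free_ring\<^esub> = 1" "\<zero>\<^bsub>free_ring\<^esub> = 0"
  by (simp_all add: free_ring_def)

lemma ring_free_ring: "ring free_ring"
proof (intro ringI abelian_groupI monoidI)
  show "\<exists>y\<in>carrier free_ring. y \<oplus>\<^bsub>free_ring\<^esub> x = \<zero>\<^bsub>free_ring\<^esub>" for x :: "'v free_algebra"
    by (auto intro: exI[of _ "- x"])
qed (auto simp: algebra_simps)

lemma free_ring_minus: "x \<ominus>\<^bsub>free_ring\<^esub> y = x - y"
proof -
  interpret ring free_ring by (rule ring_free_ring)
  have "x \<ominus>\<^bsub>free_ring\<^esub> y \<oplus>\<^bsub>free_ring\<^esub> y = x" by (simp add: a_minus_def a_assoc l_neg del: free_ring_simps(3))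
  then show ?thesis by (simp add: eq_diff_eq)
qed

context clifford_module
begin

abbreviation "cls \<equiv> clifford_class scV form"

lemma ideal_clifford_ideal: "ideal (clifford_ideal scV form) free_ring"
  unfolding clifford_ideal_def by (rule ring.genideal_ideal[OF ring_free_ring]) simp

lemma cls_ring_hom: "cls \<in> ring_hom free_ring (clifford_algebra scV form)"
  using ideal.rcos_ring_hom[OF ideal_clifford_ideal]
  by (simp add: clifford_algebra_def clifford_class_def[abs_def])

lemma cls_carrier: "cls x \<in> carrier (clifford_algebra scV form)"
  using ring_hom_closed[OF cls_ring_hom] by simp

lemma carrier_clifford_algebra: "carrier (clifford_algebra scV form) = range cls"
  by (auto simp: clifford_algebra_def FactRing_def A_RCOSETS_def' clifford_class_def)

lemma cls_eqI:
  assumes "x - y \<in> {gen (v + u) - gen v - gen u | v u. True} \<union>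
     {gen (scV c v) - const c * gen v | c v. True} \<union>
     {gen v * gen u + gen u * gen v + const (2 * form v u) | v u. True}"
  shows "cls x = cls y"
proof -
  have "x - y \<in> clifford_ideal scV form"
    unfolding clifford_ideal_def
    by (rule subsetD[OF ring.genideal_self[OF ring_free_ring] assms]) simp
  then show ?thesis
    using ring.quotient_eq_iff_same_a_r_cos[OF ring_free_ring ideal_clifford_ideal, of x y]
    by (simp add: free_ring_minus clifford_class_def)
qed

lemma act_cls_add: "act (cls (x + y)) s = act (cls x) s + act (cls y) s"
  using ring_hom_add[OF cls_ring_hom, of x y] act_add_left[OF cls_carrier cls_carrier] by simp

lemma act_cls_mult: "act (cls (x * y)) s = act (cls x) (act (cls y) s)"
  using ring_hom_mult[OF cls_ring_hom, of x y] act_mult[OF cls_carrier cls_carrier] by simp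

lemma act_cls_const_mult: "act (cls (const c * x)) s = scW c (act (cls x) s)"
  by (simp add: act_cls_mult act_const)

lemma vact_add_right: "vact scV form act v (s + t) = vact scV form act v s + vact scV form act v t"
  by (rule act_add_right[OF cls_carrier])

lemma vact_scale_right: "vact scV form act v (scW c s) = scW c (vact scV form act v s)"
proof -
  have "gen v * const c = const c * gen v" by (simp add: mult_single)
  then have "act (cls (gen v * const c)) s = act (cls (const c * gen v)) s" by simp
  then show ?thesis by (simp add: act_cls_mult act_const)
qed

lemma vact_scale_left: "vact scV form act (scV c v) s = scW c (vact scV form act v s)"
proof -
  have "cls (gen (scV c v)) = cls (const c * gen v)" by (rule cls_eqI) blast
  then show ?thesis by (simp add: act_cls_const_mult)
qed

lemma vact_square: "vact scV form act v (vact scV form act v s) = scW (- form v v) s"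
proof -
  have "cls (gen v * gen v + gen v * gen v + const (2 * form v v)) = cls 0"
    by (rule cls_eqI) auto
  moreover have "act (cls 0) s = 0" using act_const[of 0 s] by simp
  ultimately have "vact scV form act v (vact scV form act v s) + vact scV form act v (vact scV form act v s)
      + scW (2 * form v v) s = 0"
    by (metis act_cls_add act_cls_mult act_const)
  then have "scW 2 (vact scV form act v (vact scV form act v s) + scW (form v v) s) = 0"
    by (simp add: W.scale_right_distrib W.scale_left_distrib[of 1 1, simplified] add.assoc)
  then have "vact scV form act v (vact scV form act v s) + scW (form v v) s = 0" by simp
  then show ?thesis by (simp add: eq_neg_iff_add_eq_0)
qed

text \<open>
  The Clifford algebra is spanned by products of vectors.
\<close>

lemma clifford_submoduleI:
  assumes U: "W.subspace U" and v: "\<And>v s. s \<in> U \<Longrightarrow> vact scV form act v s \<in> U"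
  shows "clifford_submodule scV form scW act U"
  unfolding clifford_submodule_def
proof (intro conjI ballI)
  fix a s assume "a \<in> carrier (clifford_algebra scV form)" and s: "s \<in> U"
  then obtain x where a: "a = cls x" by (auto simp: carrier_clifford_algebra)
  have word: "act (cls (Poly_Mapping.single (Word vs) c)) s \<in> U" for vs c
  proof (induction vs)
    case Nil
    show ?case using act_const[of c s] W.subspace_scale[OF U s] by (simp add: zero_word_def)
  next
    case (Cons v vs)
    have "Poly_Mapping.single (Word (v # vs)) c = gen v * Poly_Mapping.single (Word vs) c"
      by (simp add: mult_single)
    then show ?case using v[OF Cons.IH] by (simp add: act_cls_mult)
  qed
  have "act (cls (\<Sum>m\<in>A. Poly_Mapping.single m (Poly_Mapping.lookup x m))) s \<in> U" if "finite A" for A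
    using that
  proof (induction A)
    case empty
    then show ?case using act_const[of 0 s] W.subspace_0[OF U] by simp
  next
    case (insert m A)
    then show ?case using word by (cases m) (simp add: act_cls_add W.subspace_add[OF U])
  qed
  then show "act a s \<in> U" using a polynomial_eq_sum_singles[of x] by (metis finite_keys)
qed (rule U)

end

section \<open>Extended translation algebras of a line\<close>

text \<open>
  With a unit vector \<open>e\<close> of the line, the data reduce to the operator \<open>J\<close> with \<open>J\<^sup>2 = -1\<close> and to the form \<open>\<omega>\<close> below,
  in terms of which the bracket is \<open>[s, t] = \<omega>(s, t) e\<close>.
\<close>

locale translation_data_on_line =
  extended_translation_data scV form scW act \<beta> \<epsilon>
  for scV :: "complex \<Rightarrow> 'v::ab_group_add \<Rightarrow> 'v" and form :: "'v \<Rightarrow> 'v \<Rightarrow> complex"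
    and scW :: "complex \<Rightarrow> 'w::ab_group_add \<Rightarrow> 'w" and act :: "'v clifford \<Rightarrow> 'w \<Rightarrow> 'w"
    and \<beta> :: "'w \<Rightarrow> 'w \<Rightarrow> complex" and \<epsilon> :: complex +
  fixes e :: 'v
  assumes e_unit: "form e e = 1" and span_e: "V.span {e} = UNIV"
begin

definition J :: "'w \<Rightarrow> 'w" where "J s = vact scV form act e s"

definition \<omega> :: "'w \<Rightarrow> 'w \<Rightarrow> complex" where "\<omega> s t = \<beta> (J s) t"

lemma J_add: "J (s + t) = J s + J t" and J_scale: "J (scW c s) = scW c (J s)" and J_J: "J (J s) = - s"
  by (simp_all add: J_def vact_add_right vact_scale_right vact_square e_unit)

lemma vector_eq_scale_e: obtains c where "v = scV c e"
  using span_e by (metis UNIV_I V.span_singleton rangeE)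

lemma form_scale_e: "form (scV c e) (scV d e) = c * d"
proof -
  have "form (scV c e) (scV d e) = d * form (scV c e) e" "form (scV c e) e = c * form e e"
    using V.form_bilinear unfolding bilinear_form_def Vector_Spaces.linear_iff by blast+
  then show ?thesis by (simp add: e_unit)
qed

lemma \<beta>_add_left: "\<beta> (x + y) z = \<beta> x z + \<beta> y z"
  and \<beta>_scale_left: "\<beta> (scW c x) z = c * \<beta> x z"
  and \<beta>_linear_right: "Vector_Spaces.linear scW (*) (\<beta> x)"
  using \<beta>_bilinear unfolding bilinear_form_def Vector_Spaces.linear_iff by auto

lemma WW_bracket_eq: "WW_bracket scV form act \<beta> s t = scV (\<omega> s t) e"
  unfolding WW_bracket_def
proof (rule the_equality)
  show *: "\<forall>v. form (scV (\<omega> s t) e) v = \<beta> (vact scV form act v s) t"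
  proof
    fix v
    obtain c where "v = scV c e" by (rule vector_eq_scale_e)
    then show "form (scV (\<omega> s t) e) v = \<beta> (vact scV form act v s) t"
      by (simp add: form_scale_e vact_scale_left \<beta>_scale_left \<omega>_def J_def)
  qed
  fix x assume x: "\<forall>v. form x v = \<beta> (vact scV form act v s) t"
  obtain c where c: "x = scV c e" by (rule vector_eq_scale_e)
  have "form x (scV 1 e) = form (scV (\<omega> s t) e) (scV 1 e)" using x * by simp
  then show "x = scV (\<omega> s t) e" unfolding c form_scale_e by simp
qed

text \<open>
  For symmetric \<open>\<beta>\<close> the operator \<open>J\<close> is skew-adjoint, for skew-symmetric \<open>\<beta>\<close> it is self-adjoint. In both cases
  \<open>\<beta>(J s, t)\<close> is skew-symmetric.
\<close>

sublocale symplectic: symplectic_space scW \<omega>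
proof
  show "bilinear_form scW \<omega>"
    using \<beta>_linear_right W.vector_space_axioms
    unfolding bilinear_form_def Vector_Spaces.linear_iff
    by (auto simp: \<omega>_def J_add J_scale \<beta>_add_left \<beta>_scale_left)
  show "\<omega> s t = - \<omega> t s" for s t
  proof -
    have "\<omega> s t = \<epsilon> * \<beta> s (J t)" unfolding \<omega>_def J_def by (rule B3)
    moreover have "\<epsilon> * \<beta> s (J t) = - \<beta> (J t) s" using B2
    proof (elim disjE conjE)
      assume "\<epsilon> = -1" "\<forall>s t. \<beta> s t = \<beta> t s"
      then show ?thesis by (metis mult_minus1)
    next
      assume "\<epsilon> = 1" "\<forall>s t. \<beta> s t = - \<beta> t s"
      then show ?thesis by (metis mult_1)
    qed
    ultimately show ?thesis by (simp add: \<omega>_def)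
  qed
  show "nondegenerate \<omega>"
    unfolding nondegenerate_def
  proof (intro conjI allI impI)
    show "x = 0" if "\<forall>y. \<omega> x y = 0" for x
    proof -
      have "J x = 0" using that \<beta>_nondegenerate unfolding nondegenerate_def \<omega>_def by blast
      then have "J (J x) = 0" using J_scale[of 0 0] by simp
      then show ?thesis by (simp add: J_J)
    qed
    show "y = 0" if "\<forall>x. \<omega> x y = 0" for y
    proof -
      have "\<beta> (- x) y = 0" for x using that J_J[of x] unfolding \<omega>_def by metis
      then have "\<beta> x y = 0" for x using minus_minus[of x] by metis
      then show ?thesis using \<beta>_nondegenerate unfolding nondegenerate_def by blast
    qed
  qed
  show "fin_dim scW UNIV" by (rule fin_dim_W)
qed

definition eigenvector :: "'w \<Rightarrow> bool" where "eigenvector w \<longleftrightarrow> w \<noteq> 0 \<and> (\<exists>c. J w = scW c w)"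

text \<open>
  Since \<open>J\<^sup>2 = -1\<close>, every \<open>s\<close> is the mean of the two vectors \<open>s \<mp> \<i> J s\<close>, which are zero or eigenvectors of \<open>J\<close>.
\<close>

lemma eigenvector_projection: "J (s - scW \<i> (J s)) = scW \<i> (s - scW \<i> (J s))"
    "J (s + scW \<i> (J s)) = scW (- \<i>) (s + scW \<i> (J s))"
proof -
  have J_minus: "J (- x) = - J x" for x using J_scale[of "-1" x] by simp
  show "J (s - scW \<i> (J s)) = scW \<i> (s - scW \<i> (J s))"
    using J_add[of s "- scW \<i> (J s)"]
    by (simp add: J_minus J_scale J_J W.scale_right_diff_distrib)
  show "J (s + scW \<i> (J s)) = scW (- \<i>) (s + scW \<i> (J s))"
    by (simp add: J_add J_scale J_J W.scale_right_distrib)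
qed

lemma clifford_submodule_span_eigenvector:
  assumes "eigenvector w" shows "clifford_submodule scV form scW act (W.span {w})"
proof (rule clifford_submoduleI)
  fix v s assume "s \<in> W.span {w}"
  then obtain k where k: "s = scW k w" by (auto simp: W.span_singleton)
  obtain c where v: "v = scV c e" by (rule vector_eq_scale_e)
  obtain d where "J w = scW d w" using assms by (auto simp: eigenvector_def)
  then have "vact scV form act v s = scW (c * k * d) w"
    by (simp add: k v vact_scale_left vact_scale_right flip: J_def)
  then show "vact scV form act v s \<in> W.span {w}" by (auto simp: W.span_singleton)
qed simp

lemma irreducible_submodule_span_eigenvector:
  assumes w: "eigenvector w" shows "irreducible_submodule scV form scW act (W.span {w})"
  unfolding irreducible_submodule_def
proof (intro conjI allI impI clifford_submodule_span_eigenvector[OF w])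
  show "W.span {w} \<noteq> {0}" using w W.span_base[of w "{w}"] by (auto simp: eigenvector_def)
  fix U assume U: "clifford_submodule scV form scW act U \<and> U \<subseteq> W.span {w}"
  then have sub: "W.subspace U" by (simp add: clifford_submodule_def)
  show "U = {0} \<or> U = W.span {w}"
  proof (cases "U = {0}")
    case False
    then obtain s where s: "s \<in> U" "s \<noteq> 0" using W.subspace_0[OF sub] by blast
    then obtain k where k: "s = scW k w" using U by (auto simp: W.span_singleton)
    then have "w = scW (1 / k) s" using s by auto
    then have "w \<in> U" using s W.subspace_scale[OF sub] by metis
    then have "W.span {w} \<subseteq> U" using sub by (intro W.span_minimal) auto
    then show ?thesis using U by blast
  qed simp
qed

text \<open>
  A nonzero submodule contains an eigenvector of \<open>J\<close>, whose span is a submodule.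
\<close>

lemma irreducible_submodule_is_line:
  assumes U: "irreducible_submodule scV form scW act U"
  obtains w where "w \<noteq> 0" "U = W.span {w}"
proof -
  have sub: "W.subspace U" and cl: "\<And>s. s \<in> U \<Longrightarrow> J s \<in> U" and nz: "U \<noteq> {0}"
    using U cls_carrier by (auto simp: irreducible_submodule_def clifford_submodule_def J_def)
  obtain s where s: "s \<in> U" "s \<noteq> 0" using nz W.subspace_0[OF sub] by blast
  have "(s - scW \<i> (J s)) + (s + scW \<i> (J s)) = scW 2 s"
    using W.scale_left_distrib[of 1 1 s] by simp
  then have "s - scW \<i> (J s) \<noteq> 0 \<or> s + scW \<i> (J s) \<noteq> 0" using s(2) by force
  moreover have "s - scW \<i> (J s) \<in> U" "s + scW \<i> (J s) \<in> U"
    using s(1) cl sub by (simp_all add: W.subspace_diff W.subspace_add W.subspace_scale)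
  ultimately obtain w where w: "w \<in> U" "eigenvector w"
    using eigenvector_projection unfolding eigenvector_def by blast
  have "W.span {w} \<subseteq> U" using w sub by (intro W.span_minimal) auto
  moreover have "W.span {w} \<noteq> {0}" using w W.span_base[of w "{w}"] by (auto simp: eigenvector_def)
  ultimately have "U = W.span {w}"
    using U clifford_submodule_span_eigenvector[OF w(2)] unfolding irreducible_submodule_def by blast
  then show ?thesis using that w by (auto simp: eigenvector_def)
qed

text \<open>
  \<open>W\<close> has a basis of eigenvectors of \<open>J\<close>, which gives a decomposition into irreducible lines. As all
  irreducible submodules are lines, the number of summands of any decomposition is the dimension.
\<close>

lemma number_of_components_eq_dim: "number_of_components scV form scW act = W.dim UNIV"
  unfolding number_of_components_def
proof (rule the_equality)
  let ?E = "Collect eigenvector"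
  obtain B where B: "B \<subseteq> ?E" "W.independent B" "?E \<subseteq> W.span B"
    using W.maximal_independent_subset by blast
  have "s \<in> W.span B" for s
  proof -
    have "x \<in> W.span B" if "J x = scW c x" for x c
    proof (cases "x = 0")
      case False
      then have "eigenvector x" using that by (auto simp: eigenvector_def)
      then show ?thesis using B(3) by blast
    qed (simp add: W.span_zero)
    then have "s - scW \<i> (J s) \<in> W.span B" "s + scW \<i> (J s) \<in> W.span B"
      using eigenvector_projection by blast+
    then have "(s - scW \<i> (J s)) + (s + scW \<i> (J s)) \<in> W.span B" by (rule W.span_add)
    moreover have "(s - scW \<i> (J s)) + (s + scW \<i> (J s)) = scW 2 s"
      using W.scale_left_distrib[of 1 1 s] by simp
    ultimately have "scW (1 / 2) (scW 2 s) \<in> W.span B" by (metis W.span_scale)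
    then show ?thesis by simp
  qed
  then have spB: "W.span B = UNIV" by blast
  then have dim: "W.dim UNIV = card B" using W.basis_card_eq_dim[OF subset_UNIV _ B(2)] by simp
  obtain C where "finite C" "UNIV \<subseteq> W.span C" using fin_dim_W by (auto simp: fin_dim_def)
  then have "finite B" using W.independent_span_bound[OF _ B(2)] by blast
  then obtain w where w: "bij_betw w {..<card B} B" using ex_bij_betw_nat_finite atLeast0LessThan by metis
  have eig: "eigenvector (w i)" if "i < card B" for i using w B(1) that by (auto dest: bij_betwE)
  have "(\<forall>s. \<exists>!f. (\<forall>i<card B. f i \<in> W.span {w i}) \<and> (\<forall>i\<ge>card B. f i = 0) \<and> s = (\<Sum>i<card B. f i))"
    using W.lines_decomposition_iff[of "card B" w] eig w B(2) spB
    by (simp add: eigenvector_def bij_betw_def)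
  then show "\<exists>U. (\<forall>i<W.dim UNIV. irreducible_submodule scV form scW act (U i)) \<and>
    (\<forall>s. \<exists>!f. (\<forall>i<W.dim UNIV. f i \<in> U i) \<and> (\<forall>i\<ge>W.dim UNIV. f i = 0) \<and> s = (\<Sum>i<W.dim UNIV. f i))"
    unfolding dim using irreducible_submodule_span_eigenvector[OF eig]
    by (intro exI[of _ "\<lambda>i. W.span {w i}"] conjI) auto
next
  fix n :: nat
  assume "\<exists>U. (\<forall>i<n. irreducible_submodule scV form scW act (U i)) \<and>
    (\<forall>s. \<exists>!f. (\<forall>i<n. f i \<in> U i) \<and> (\<forall>i\<ge>n. f i = 0) \<and> s = (\<Sum>i<n. f i))"
  then obtain U where irr: "\<forall>i<n. irreducible_submodule scV form scW act (U i)"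
    and dec: "\<forall>s. \<exists>!f. (\<forall>i<n. f i \<in> U i) \<and> (\<forall>i\<ge>n. f i = 0) \<and> s = (\<Sum>i<n. f i)"
    by (elim exE conjE)
  have "\<exists>w. w \<noteq> 0 \<and> U i = W.span {w}" if "i < n" for i
    using irreducible_submodule_is_line[OF irr[rule_format, OF that]] by metis
  then have "\<forall>i\<in>{..<n}. \<exists>w. w \<noteq> 0 \<and> U i = W.span {w}" by simp
  then obtain w where w: "\<And>i. i < n \<Longrightarrow> w i \<noteq> 0" "\<And>i. i < n \<Longrightarrow> U i = W.span {w i}"
    unfolding bchoice_iff by auto
  have "(\<forall>i<n. f i \<in> U i) \<longleftrightarrow> (\<forall>i<n. f i \<in> W.span {w i})" for f using w(2) by simp
  then have "\<forall>s. \<exists>!f. (\<forall>i<n. f i \<in> W.span {w i}) \<and> (\<forall>i\<ge>n. f i = 0) \<and> s = (\<Sum>i<n. f i)"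
    using dec by simp
  then have "inj_on w {..<n} \<and> W.independent (w ` {..<n}) \<and> W.span (w ` {..<n}) = UNIV"
    by (rule W.lines_decomposition_iff[THEN iffD1, rotated]) (rule w(1))
  then show "n = W.dim UNIV"
    using W.basis_card_eq_dim[of "w ` {..<n}" UNIV] by (simp add: card_image)
qed

abbreviation "\<mm> \<equiv> extended_translation_algebra scV form scW act \<beta>"

lemma \<mm>_simps:
  "carrier \<mm> = UNIV" "scl \<mm> = (\<lambda>c (v, s). (scV c v, scW c s))"
  "brk \<mm> x y = (scV (\<omega> (snd x) (snd y)) e, 0)"
  "part \<mm> p = (if p = -2 then UNIV \<times> {0} else if p = -1 then {0} \<times> UNIV else {0})"
  by (simp_all add: extended_translation_algebra_def WW_bracket_eq split_def)

lemma vector_space_\<mm>: "vector_space (\<lambda>c (v, s). (scV c v, scW c s))"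
  by unfold_locales
    (auto simp: V.scale_right_distrib V.scale_left_distrib W.scale_right_distrib W.scale_left_distrib)

interpretation VW: vector_space "\<lambda>c (v, s). (scV c v, scW c s)"
  by (rule vector_space_\<mm>)

lemma graded_lie_algebra_\<mm>: "graded_lie_algebra \<mm>"
proof (intro graded_lie_algebra.intro graded_lie_algebra_axioms.intro)
  show "vector_space (scl \<mm>)" unfolding \<mm>_simps by (rule vector_space_\<mm>)
  show "module.subspace (scl \<mm>) (part \<mm> p)" for p
    unfolding \<mm>_simps VW.subspace_def by (auto simp: zero_prod_def)
  have "x \<in> VW.span (\<Union>p. part \<mm> p)" for x
  proof -
    have "(fst x, 0) \<in> part \<mm> (-2)" "(0, snd x) \<in> part \<mm> (-1)" by (simp_all add: \<mm>_simps)
    then have "(fst x, 0) + (0, snd x) \<in> VW.span (\<Union>p. part \<mm> p)"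
      by (intro VW.span_add VW.span_base) blast+
    then show ?thesis by simp
  qed
  then show "carrier \<mm> = module.span (scl \<mm>) (\<Union>p. part \<mm> p)"
    unfolding \<mm>_simps(1,2) by blast
  show "x q = 0" if I: "finite I" and x: "\<And>p. p \<in> I \<Longrightarrow> x p \<in> part \<mm> p" and sum0: "(\<Sum>p\<in>I. x p) = 0"
    and q: "q \<in> I" for I q x
  proof -
    have "(\<Sum>p\<in>I. fst (x p)) = 0" "(\<Sum>p\<in>I. snd (x p)) = 0"
      using sum0 by (simp_all flip: fst_sum snd_sum)
    moreover have "(\<Sum>p\<in>I. fst (x p)) = (\<Sum>p\<in>I. if p = -2 then fst (x p) else 0)"
      "(\<Sum>p\<in>I. snd (x p)) = (\<Sum>p\<in>I. if p = -1 then snd (x p) else 0)"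
      using x by (intro sum.cong refl; fastforce simp: \<mm>_simps split: if_splits)+
    ultimately have "-2 \<in> I \<Longrightarrow> fst (x (-2)) = 0" "-1 \<in> I \<Longrightarrow> snd (x (-1)) = 0"
      using I by (simp_all add: sum.delta)
    then show ?thesis using x[OF q] q by (auto simp: \<mm>_simps prod_eq_iff split: if_splits)
  qed
  fix x y z :: "'v \<times> 'w"
  show "brk \<mm> (x + y) z = brk \<mm> x z + brk \<mm> y z" "brk \<mm> x (y + z) = brk \<mm> x y + brk \<mm> x z"
    by (simp_all add: \<mm>_simps symplectic.\<omega>_add_left symplectic.\<omega>_add_right V.scale_left_distrib)
  show "brk \<mm> (scl \<mm> k x) y = scl \<mm> k (brk \<mm> x y)" "brk \<mm> x (scl \<mm> k y) = scl \<mm> k (brk \<mm> x y)" for k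
    by (simp_all add: \<mm>_simps split_def symplectic.\<omega>_scale_left symplectic.\<omega>_scale_right)
  show "brk \<mm> x x = 0"
    by (simp add: \<mm>_simps symplectic.\<omega>_self zero_prod_def)
  show "brk \<mm> x (brk \<mm> y z) + brk \<mm> y (brk \<mm> z x) + brk \<mm> z (brk \<mm> x y) = 0"
    by (simp add: \<mm>_simps symplectic.\<omega>_0_right zero_prod_def)
next
  fix x y p q
  assume xy: "x \<in> part \<mm> p" "y \<in> part \<mm> q"
  show "brk \<mm> x y \<in> part \<mm> (p + q)"
  proof (cases "p = -1 \<and> q = -1")
    case False
    then have "snd x = 0 \<or> snd y = 0" using xy by (auto simp: \<mm>_simps split: if_splits)
    then have "brk \<mm> x y = 0"
      by (auto simp: \<mm>_simps symplectic.\<omega>_0_left symplectic.\<omega>_0_right zero_prod_def)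
    then show ?thesis by (auto simp: \<mm>_simps zero_prod_def)
  qed (simp add: \<mm>_simps)
qed

text \<open>
  A symplectic basis of \<open>W\<close> for \<open>\<omega>\<close> together with \<open>e\<close> is a Heisenberg basis of \<open>\<mm>\<close>.
\<close>

theorem heisenberg_algebra_\<mm>:
  obtains l a b where "W.dim UNIV = 2 * l" "heisenberg_algebra \<mm> l a b (e, 0)"
proof -
  obtain l a b where fam: "symplectic.symplectic_family l a b"
    and span: "W.span (a ` {1..l} \<union> b ` {1..l}) = UNIV" and dim: "W.dim UNIV = 2 * l"
    by (rule symplectic.symplectic_basis)
  have l: "1 \<le> l"
  proof (rule ccontr)
    assume "\<not> 1 \<le> l"
    then have "(UNIV :: 'w set) = {0}" using span by simp
    then show False using W_nonzero by simp
  qed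
  have e: "e \<noteq> 0" using e_unit form_scale_e[of 0 0] by auto
  let ?a = "\<lambda>i. (0, a i) :: 'v \<times> 'w" and ?b = "\<lambda>i. (0, b i) :: 'v \<times> 'w"
  have "heisenberg_algebra \<mm> l ?a ?b (e, 0)"
  proof (intro heisenberg_algebra.intro heisenberg_prolongation.intro heisenberg_prolongation_axioms.intro
      heisenberg_algebra_axioms.intro graded_lie_algebra_\<mm> l, unfold \<mm>_simps(2))
    show "brk \<mm> (?a i) (?b j) = (if i = j then (e, 0) else 0)"
      "brk \<mm> (?a i) (?a j) = 0" "brk \<mm> (?b i) (?b j) = 0"
      if "i \<in> {1..l}" "j \<in> {1..l}" for i j
      using fam that by (simp_all add: symplectic.symplectic_family_def \<mm>_simps zero_prod_def)
    show "part \<mm> (-2) \<subseteq> VW.span {(e, 0)}"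
    proof -
      have "(v, 0) \<in> VW.span {(e, 0)}" for v
      proof -
        obtain c where "v = scV c e" by (rule vector_eq_scale_e)
        then show ?thesis using VW.span_scale[OF VW.span_base[of "(e, 0)" "{(e, 0)}"], of c] by simp
      qed
      then show ?thesis by (auto simp: \<mm>_simps)
    qed
    show "part \<mm> (-1) \<subseteq> VW.span (?a ` {1..l} \<union> ?b ` {1..l})"
    proof -
      have "(0, s) \<in> VW.span (?a ` {1..l} \<union> ?b ` {1..l})" if "s \<in> W.span (a ` {1..l} \<union> b ` {1..l})" for s
        using that
      proof (induction rule: W.span_induct_alt)
        case base
        show ?case using VW.span_zero by (simp add: zero_prod_def)
      next
        case (step c x y)
        then have "(0, x) \<in> ?a ` {1..l} \<union> ?b ` {1..l}" by auto
        from VW.span_add[OF VW.span_scale[OF VW.span_base[OF this], of c] step.IH]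
        show ?case by simp
      qed
      then show ?thesis using span by (auto simp: \<mm>_simps)
    qed
  qed (use e in \<open>auto simp: \<mm>_simps zero_prod_def split: if_splits\<close>)
  then show ?thesis using dim that by blast
qed

end

lemma unit_vector_of_line:
  assumes "quadratic_space scV form" "vector_space.dim scV UNIV = 1"
  obtains e where "form e e = 1" "module.span scV {e} = UNIV"
proof -
  interpret quadratic_space scV form by (rule assms)
  have form_scale: "form (scV c x) y = c * form x y" "form x (scV c y) = c * form x y" for c x y
    using form_bilinear unfolding bilinear_form_def Vector_Spaces.linear_iff by blast+
  obtain B where B: "independent B" "UNIV \<subseteq> span B" "card B = dim UNIV"
    using basis_exists[of UNIV] by metis
  then obtain f where f: "B = {f}" using assms(2) by (metis card_1_singletonE)
  have f0: "f \<noteq> 0" using B(1) f by auto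
  have "form f f \<noteq> 0"
  proof
    assume "form f f = 0"
    moreover have "\<exists>c. y = scV c f" for y using B(2) by (auto simp: f span_singleton)
    ultimately have "form f y = 0" for y using form_scale(2) by (metis mult_zero_right)
    then show False using f0 form_nondegenerate by (auto simp: nondegenerate_def)
  qed
  then have r: "csqrt (form f f) \<noteq> 0" by simp
  let ?e = "scV (1 / csqrt (form f f)) f"
  have "form ?e ?e = form f f / (csqrt (form f f))\<^sup>2"
    by (simp add: form_scale power2_eq_square)
  then have "form ?e ?e = 1" using \<open>form f f \<noteq> 0\<close> by simp
  moreover have "f \<in> span {?e}"
    using r span_scale[OF span_base[of ?e "{?e}"], of "csqrt (form f f)"] by simp
  then have "span {f} \<subseteq> span {?e}" by (intro span_minimal) auto
  then have "span {?e} = UNIV" using B(2) f by blast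
  ultimately show ?thesis by (rule that)
qed

theorem proposition4p2:
  fixes scV :: "complex \<Rightarrow> 'v::ab_group_add \<Rightarrow> 'v" and form :: "'v \<Rightarrow> 'v \<Rightarrow> complex"
    and scW :: "complex \<Rightarrow> 'w::ab_group_add \<Rightarrow> 'w" and act :: "'v clifford \<Rightarrow> 'w \<Rightarrow> 'w"
    and \<beta> :: "'w \<Rightarrow> 'w \<Rightarrow> complex" and \<epsilon> :: complex
    and N :: nat and \<mm> :: "('v \<times> 'w) graded_lie"
  assumes "extended_translation_data scV form scW act \<beta> \<epsilon>"
    and "N = number_of_components scV form scW act"
    and "\<mm> = extended_translation_algebra scV form scW act \<beta>"
    and "vector_space.dim scV (UNIV :: 'v set) = 1"
  shows "even N
    \<and> maximal_transitive_prolongation TYPE('h::ab_group_add) \<mm> (contact_algebra (N div 2))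
    \<and> (\<forall>\<gg> :: 'g::ab_group_add graded_lie.
          maximal_transitive_prolongation TYPE(vector_field) \<mm> \<gg>
          \<longrightarrow> graded_lie_isomorphic \<gg> (contact_algebra (N div 2)))"
proof -
  interpret D: extended_translation_data scV form scW act \<beta> \<epsilon> by (rule assms)
  obtain e where "form e e = 1" "module.span scV {e} = UNIV"
    using unit_vector_of_line[OF D.V.quadratic_space_axioms assms(4)] .
  then interpret translation_data_on_line scV form scW act \<beta> \<epsilon> e by unfold_locales
  obtain l a b where dim: "D.W.dim UNIV = 2 * l" and H: "heisenberg_algebra \<mm> l a b (e, 0)"
    using heisenberg_algebra_\<mm> unfolding assms(3) .
  interpret H: heisenberg_algebra \<mm> l a b "(e, 0)" by (rule H)
  have N: "N = 2 * l" using dim number_of_components_eq_dim assms(2) by simp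
  then have half: "N div 2 = l" "even N" by simp_all
  show ?thesis
    unfolding half(1)
    by (intro conjI allI impI half(2) H.maximal_transitive_prolongation_contact
        H.maximal_transitive_prolongation_unique)
qed

end
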